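(* Let $\mathfrak{g}=\mathfrak{h}\oplus\mathfrak{m}$, $\mathfrak{h}=\mathfrak{h}'\oplus\mathfrak{s}$, be a generalized Wolf space with associated groups $G$, $H=H'S$ and let $\mathcal{O}=G/H$. Let $T\subset G$ be a virtual Lie subgroup with Lie algebra $\mathfrak{t}\subset\mathfrak{g}$, acting on $\mathcal{O}$ by left multiplication. Then, up to a nonzero real scalar factor independent of $g$ and $v$, the quaternionic K\"ahler moment map $\mu$ of this action, with each $\mu_v$ ($v\in\mathfrak{t}$) seen as an $H$-equivariant map $G\to\mathfrak{s}$ (where $\mathfrak{s}\simeq\mathbb{R}^3$), is given by $$\mu_v(g)=(\mathrm{Ad}_g^{-1}v)_{\mathfrak{s}}\qquad (g\in G,\ v\in\mathfrak{t}).$$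
   Context: A generalized Wolf space is a real semisimple Lie algebra $\mathfrak{g}$ with a splitting $\mathfrak{g}=\mathfrak{h}\oplus\mathfrak{m}$, where $\mathfrak{h}$ is a subalgebra, $[\mathfrak{h},\mathfrak{m}]\subset\mathfrak{m}$ and $[\mathfrak{m},\mathfrak{m}]=\mathfrak{h}=\mathfrak{h}'\oplus\mathfrak{s}$, the last sum being a direct sum of two commuting subalgebras with $\mathfrak{s}\simeq\mathfrak{sp}(1)$ and $\mathfrak{h}'$ isomorphic to a subalgebra of $\mathfrak{sp}(k,l)$, $4k+4l=\dim\mathfrak{m}$; the adjoint action of $\mathfrak{h}=\mathfrak{h}'\oplus\mathfrak{s}$ on $\mathfrak{m}$ is isomorphic to the standard action of a subalgebra of $\mathfrak{sp}(k,l)\oplus\mathfrak{sp}(1)$ on $\mathbb{H}^{k+l}$. $G$ is the connected, simply connected Lie group with Lie algebra $\mathfrak{g}$, and $H',S,H=H'S$ are the connected subgroups with Lie algebras $\mathfrak{h}',\mathfrak{s},\mathfrak{h}$. For $\xi\in\mathfrak{g}$, $\xi_{\mathfrak{s}}$ is its component in $\mathfrak{s}$ with respect to $\mathfrak{g}=\mathfrak{h}'\oplus\mathfrak{s}\oplus\mathfrak{m}$. A virtual Lie subgroup is a Lie subgroup that is not necessarily closed. One has $T\mathcal{O}=G\times_H\mathfrak{m}$. The pseudo-Riemannian metric on $\mathcal O$ is the $G$-invariant one induced by the Killing form of $\mathfrak{g}$ restricted to $\mathfrak{m}$; its Levi-Civita connection is the canonical connection, induced by the $G$-left-invariant connection on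 the principal bundle $G\to G/H$ with horizontal spaces $l_{g*}\mathfrak{m}$ ($l_g$ is left multiplication by $g$). The quaternionic bundle is $\mathfrak{H}=G\times_H\mathfrak{s}\subset\mathrm{End}(T\mathcal{O})$ ($\mathfrak{s}$ acting on $\mathfrak{m}$ by $\mathrm{ad}$), with the connection $\nabla$ induced by the canonical connection. Sections of $\mathfrak{H}$ correspond to maps $f:G\to\mathfrak{s}$ with $f(gh)=\mathrm{Ad}_h^{-1}f(g)$ for $h\in H$. The $\mathfrak{H}$-valued quaternionic two-form $\Theta$ corresponds to $\Theta(w_1,w_2)=-\lambda[w_1,w_2]_{\mathfrak{s}}$ ($w_1,w_2\in\mathfrak{m}$) for some constant $\lambda>0$. The quaternionic K\"ahler moment map of the action of $T$ is the unique section $\mu$ of $\mathfrak{t}^*\otimes\mathfrak{H}$, written $x\mapsto(v\mapsto\mu_v(x))$, such that $\nabla\mu_v=i_{v_{\mathcal{O}}}\Theta$ for all $v\in\mathfrak{t}$, where $v_{\mathcal{O}}$ is the vector field on $\mathcal{O}$ induced by $v$; it is $T$-invariant, i.e. $\mu_{\mathrm{Ad}_tv}(tx)=\mu_v(x)$. *)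

theory Defs
  imports "HOL-Analysis.Analysis" "HOL-Algebra.Left_Coset"
begin

section \<open>Smooth manifolds\<close>

primrec Ck_on :: "nat \<Rightarrow> ('a::real_normed_vector \<Rightarrow> 'b::real_normed_vector) \<Rightarrow> 'a set \<Rightarrow> bool" where
  "Ck_on 0 f W \<longleftrightarrow> continuous_on W f"
| "Ck_on (Suc k) f W \<longleftrightarrow>
     f differentiable_on W \<and> (\<forall>v. Ck_on k (\<lambda>x. frechet_derivative f (at x) v) W)"

text \<open>Smoothness on an arbitrary subset of a Euclidean space: local extendability to a
  \<open>C\<^sup>\<infinity>\<close> function on an open set.\<close>

definition smooth_on :: "'a::euclidean_space set \<Rightarrow> ('a \<Rightarrow> 'b::euclidean_space) \<Rightarrow> bool" where
  "smooth_on S f \<longleftrightarrow>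
     (\<forall>x\<in>S. \<exists>W F. open W \<and> x \<in> W \<and> (\<forall>k. Ck_on k F W) \<and> (\<forall>y\<in>W \<inter> S. F y = f y))"

text \<open>Charts take values in a linear subspace \<open>model\<close> of the type \<open>'e\<close>, so that manifolds of every
  dimension at most \<open>DIM('e)\<close> (including 0) can be modelled over the same type.\<close>

record ('a, 'e) mfd =
  mtop :: "'a topology"
  model :: "'e set"
  atlas :: "('a set \<times> ('a \<Rightarrow> 'e)) set"

definition smooth_manifold :: "('a, 'e::euclidean_space) mfd \<Rightarrow> bool" where
  "smooth_manifold M \<longleftrightarrow>
     subspace (model M) \<and> Hausdorff_space (mtop M) \<and> second_countable (mtop M) \<and>
     (\<Union>(U, c)\<in>atlas M. U) = topspace (mtop M) \<and>
     (\<forall>(U, c)\<in>atlas M.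
        openin (mtop M) U \<and> openin (top_of_set (model M)) (c ` U) \<and>
        homeomorphic_map (subtopology (mtop M) U) (top_of_set (c ` U)) c) \<and>
     (\<forall>(U, c)\<in>atlas M. \<forall>(U', c')\<in>atlas M. smooth_on (c ` (U \<inter> U')) (c' \<circ> inv_into U c))"

definition smooth_map_on ::
  "('a, 'e::euclidean_space) mfd \<Rightarrow> ('b, 'f::euclidean_space) mfd \<Rightarrow> 'a set \<Rightarrow> ('a \<Rightarrow> 'b) \<Rightarrow> bool" where
  "smooth_map_on M N W f \<longleftrightarrow>
     continuous_map (subtopology (mtop M) W) (mtop N) f \<and>
     (\<forall>(U, c)\<in>atlas M. \<forall>(U', c')\<in>atlas N.
        smooth_on (c ` {p \<in> U \<inter> W. f p \<in> U'}) (c' \<circ> f \<circ> inv_into U c))"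

abbreviation smooth_map ::
  "('a, 'e::euclidean_space) mfd \<Rightarrow> ('b, 'f::euclidean_space) mfd \<Rightarrow> ('a \<Rightarrow> 'b) \<Rightarrow> bool" where
  "smooth_map M N f \<equiv> smooth_map_on M N (topspace (mtop M)) f"

definition eucl :: "('e::euclidean_space, 'e) mfd" where
  "eucl = \<lparr>mtop = euclidean, model = UNIV, atlas = {(UNIV, \<lambda>x. x)}\<rparr>"

definition prod_mfd ::
  "('a, 'e) mfd \<Rightarrow> ('b, 'f) mfd \<Rightarrow> ('a \<times> 'b, 'e \<times> 'f) mfd" where
  "prod_mfd M N =
     \<lparr>mtop = prod_topology (mtop M) (mtop N),
      model = model M \<times> model N,
      atlas = {(U \<times> U', \<lambda>(p, q). (c p, c' q)) | U c U' c'. (U, c) \<in> atlas M \<and> (U', c') \<in> atlas N}\<rparr>"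

text \<open>As usual when a preferred chart is chosen at each point \<open>p\<close>, the tangent space \<open>T\<^sub>pM\<close> is
  represented by \<open>model M\<close> via that chart. Accordingly \<open>mderiv M N f p\<close>, restricted to
  \<open>model M\<close>, is the differential \<open>T\<^sub>pM \<rightarrow> T\<^bsub>f(p)\<^esub>N\<close>; its values outside \<open>model M\<close> are meaningless.\<close>

definition chart_at :: "('a, 'e) mfd \<Rightarrow> 'a \<Rightarrow> 'a set \<times> ('a \<Rightarrow> 'e)" where
  "chart_at M p = (SOME C. C \<in> atlas M \<and> p \<in> fst C)"

definition chart_map :: "('a, 'e) mfd \<Rightarrow> 'a \<Rightarrow> 'a \<Rightarrow> 'e" where
  "chart_map M p = snd (chart_at M p)"

definition chart_inv :: "('a, 'e) mfd \<Rightarrow> 'a \<Rightarrow> 'e \<Rightarrow> 'a" where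
  "chart_inv M p = inv_into (fst (chart_at M p)) (snd (chart_at M p))"

definition mderiv ::
  "('a, 'e::euclidean_space) mfd \<Rightarrow> ('b, 'f::euclidean_space) mfd \<Rightarrow> ('a \<Rightarrow> 'b) \<Rightarrow> 'a \<Rightarrow> 'e \<Rightarrow> 'f" where
  "mderiv M N f p =
     frechet_derivative (chart_map N (f p) \<circ> f \<circ> chart_inv M p) (at (chart_map M p p) within model M)"

definition simply_connected_space :: "'a topology \<Rightarrow> bool" where
  "simply_connected_space X \<longleftrightarrow>
     path_connected_space X \<and>
     (\<forall>f. continuous_map (top_of_set (sphere (0::complex) 1)) X f \<longrightarrow>
       (\<exists>a. homotopic_with (\<lambda>_. True) (top_of_set (sphere (0::complex) 1)) X f (\<lambda>_. a)))"


section \<open>Lie algebras\<close>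

text \<open>Real finite-dimensional Lie algebras whose underlying vector space is a whole type. The inner
  product of \<open>euclidean_space\<close> serves only to provide the standard topology.\<close>

definition lie_algebra :: "('v::euclidean_space \<Rightarrow> 'v \<Rightarrow> 'v) \<Rightarrow> bool" where
  "lie_algebra br \<longleftrightarrow>
     bilinear br \<and> (\<forall>x. br x x = 0) \<and>
     (\<forall>x y z. br x (br y z) + br y (br z x) + br z (br x y) = 0)"

definition lie_subalgebra :: "('v::euclidean_space \<Rightarrow> 'v \<Rightarrow> 'v) \<Rightarrow> 'v set \<Rightarrow> bool" where
  "lie_subalgebra br a \<longleftrightarrow> subspace a \<and> (\<forall>x\<in>a. \<forall>y\<in>a. br x y \<in> a)"

definition lie_ideal :: "('v::euclidean_space \<Rightarrow> 'v \<Rightarrow> 'v) \<Rightarrow> 'v set \<Rightarrow> bool" where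
  "lie_ideal br a \<longleftrightarrow> subspace a \<and> (\<forall>x. \<forall>y\<in>a. br x y \<in> a)"

primrec derived_series :: "('v::euclidean_space \<Rightarrow> 'v \<Rightarrow> 'v) \<Rightarrow> nat \<Rightarrow> 'v set \<Rightarrow> 'v set" where
  "derived_series br 0 a = a"
| "derived_series br (Suc k) a =
     span {br x y | x y. x \<in> derived_series br k a \<and> y \<in> derived_series br k a}"

definition semisimple :: "('v::euclidean_space \<Rightarrow> 'v \<Rightarrow> 'v) \<Rightarrow> bool" where
  "semisimple br \<longleftrightarrow>
     lie_algebra br \<and> (\<forall>a. lie_ideal br a \<and> (\<exists>k. derived_series br k a = {0}) \<longrightarrow> a = {0})"

definition direct_sum :: "'v::euclidean_space set \<Rightarrow> 'v set \<Rightarrow> 'v set \<Rightarrow> bool" where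
  "direct_sum V A B \<longleftrightarrow>
     subspace A \<and> subspace B \<and> A \<inter> B = {0} \<and> V = {x + y | x y. x \<in> A \<and> y \<in> B}"


section \<open>Quaternions and \<open>sp(k,l)\<close>\<close>

text \<open>The pair \<open>(a, b)\<close> stands for the quaternion \<open>a + b j\<close>.\<close>

type_synonym quat = "complex \<times> complex"

definition qmult :: "quat \<Rightarrow> quat \<Rightarrow> quat" where
  "qmult p q = (fst p * fst q - snd p * cnj (snd q), fst p * snd q + snd p * cnj (fst q))"

definition qconj :: "quat \<Rightarrow> quat" where
  "qconj p = (cnj (fst p), - snd p)"

definition sp1 :: "quat set" where
  "sp1 = {p. qconj p = - p}"

definition quat_vectors :: "nat \<Rightarrow> (nat \<Rightarrow> quat) set" where
  "quat_vectors n = {x. \<forall>i\<ge>n. x i = 0}"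

definition qmat_mult :: "nat \<Rightarrow> (nat \<Rightarrow> nat \<Rightarrow> quat) \<Rightarrow> (nat \<Rightarrow> nat \<Rightarrow> quat) \<Rightarrow> nat \<Rightarrow> nat \<Rightarrow> quat" where
  "qmat_mult n A B i j = (\<Sum>r<n. qmult (A i r) (B r j))"

text \<open>Quaternionic \<open>(k+l) \<times> (k+l)\<close> matrices \<open>A\<close> with \<open>A\<^sup>* I + I A = 0\<close>, where \<open>I\<close> is diagonal with
  \<open>k\<close> entries \<open>1\<close> and \<open>l\<close> entries \<open>-1\<close>.\<close>

definition sp :: "nat \<Rightarrow> nat \<Rightarrow> (nat \<Rightarrow> nat \<Rightarrow> quat) set" where
  "sp k l = {A. (\<forall>i j. i \<ge> k + l \<or> j \<ge> k + l \<longrightarrow> A i j = 0) \<and>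
     (\<forall>i<k + l. \<forall>j<k + l.
        (if j < k then 1 else - 1 :: real) *\<^sub>R qconj (A j i) +
        (if i < k then 1 else - 1 :: real) *\<^sub>R A i j = 0)}"

text \<open>Linear injective homomorphisms of Lie algebras \<open>h' \<rightarrow> sp(k,l)\<close>, and isomorphisms
  \<open>s \<rightarrow> sp(1)\<close>.\<close>

definition embeds_sp ::
  "('v::euclidean_space \<Rightarrow> 'v \<Rightarrow> 'v) \<Rightarrow> 'v set \<Rightarrow> nat \<Rightarrow> nat \<Rightarrow> ('v \<Rightarrow> nat \<Rightarrow> nat \<Rightarrow> quat) \<Rightarrow> bool" where
  "embeds_sp br h' k l \<alpha> \<longleftrightarrow>
     \<alpha> \<in> h' \<rightarrow> sp k l \<and> inj_on \<alpha> h' \<and>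
     (\<forall>x\<in>h'. \<forall>y\<in>h'. \<forall>a b i j. \<alpha> (a *\<^sub>R x + b *\<^sub>R y) i j = a *\<^sub>R \<alpha> x i j + b *\<^sub>R \<alpha> y i j) \<and>
     (\<forall>x\<in>h'. \<forall>y\<in>h'. \<forall>i j.
        \<alpha> (br x y) i j = qmat_mult (k + l) (\<alpha> x) (\<alpha> y) i j - qmat_mult (k + l) (\<alpha> y) (\<alpha> x) i j)"

definition iso_sp1 :: "('v::euclidean_space \<Rightarrow> 'v \<Rightarrow> 'v) \<Rightarrow> 'v set \<Rightarrow> ('v \<Rightarrow> quat) \<Rightarrow> bool" where
  "iso_sp1 br s \<beta> \<longleftrightarrow>
     bij_betw \<beta> s sp1 \<and>
     (\<forall>x\<in>s. \<forall>y\<in>s. \<forall>a b. \<beta> (a *\<^sub>R x + b *\<^sub>R y) = a *\<^sub>R \<beta> x + b *\<^sub>R \<beta> y) \<and>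
     (\<forall>x\<in>s. \<forall>y\<in>s. \<beta> (br x y) = qmult (\<beta> x) (\<beta> y) - qmult (\<beta> y) (\<beta> x))"

text \<open>The standard action of \<open>(A, q) \<in> sp(k,l) \<oplus> sp(1)\<close> on the right \<open>\<bbbH>\<close>-module \<open>\<bbbH>\<^bsup>k+l\<^esup>\<close> is
  \<open>x \<mapsto> A x - x q\<close>.\<close>

definition std_action ::
  "nat \<Rightarrow> (nat \<Rightarrow> nat \<Rightarrow> quat) \<Rightarrow> quat \<Rightarrow> (nat \<Rightarrow> quat) \<Rightarrow> nat \<Rightarrow> quat" where
  "std_action n A q x i = (\<Sum>j<n. qmult (A i j) (x j)) - qmult (x i) q"

definition generalized_wolf_space ::
  "('v::euclidean_space \<Rightarrow> 'v \<Rightarrow> 'v) \<Rightarrow> 'v set \<Rightarrow> 'v set \<Rightarrow> 'v set \<Rightarrow> 'v set \<Rightarrow> bool" where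
  "generalized_wolf_space br h h' s m \<longleftrightarrow>
     semisimple br \<and>
     lie_subalgebra br h \<and> direct_sum UNIV h m \<and>
     (\<forall>x\<in>h. \<forall>y\<in>m. br x y \<in> m) \<and> span {br x y | x y. x \<in> m \<and> y \<in> m} = h \<and>
     lie_subalgebra br h' \<and> lie_subalgebra br s \<and> direct_sum h h' s \<and>
     (\<forall>x\<in>h'. \<forall>y\<in>s. br x y = 0) \<and>
     (\<exists>k l \<alpha> \<beta> \<psi>.
        dim m = 4 * k + 4 * l \<and> embeds_sp br h' k l \<alpha> \<and> iso_sp1 br s \<beta> \<and>
        bij_betw \<psi> m (quat_vectors (k + l)) \<and>
        (\<forall>x\<in>m. \<forall>y\<in>m. \<forall>a b i. \<psi> (a *\<^sub>R x + b *\<^sub>R y) i = a *\<^sub>R \<psi> x i + b *\<^sub>R \<psi> y i) \<and>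
        (\<forall>x\<in>h'. \<forall>y\<in>s. \<forall>w\<in>m. \<psi> (br (x + y) w) = std_action (k + l) (\<alpha> x) (\<beta> y) (\<psi> w)))"

definition s_part :: "'v::euclidean_space set \<Rightarrow> 'v set \<Rightarrow> 'v set \<Rightarrow> 'v \<Rightarrow> 'v" where
  "s_part h' s m \<xi> = (THE y. y \<in> s \<and> (\<exists>x\<in>h'. \<exists>z\<in>m. \<xi> = x + y + z))"


section \<open>Lie groups\<close>

definition lie_group :: "'g monoid \<Rightarrow> ('g, 'e::euclidean_space) mfd \<Rightarrow> bool" where
  "lie_group G M \<longleftrightarrow>
     group G \<and> smooth_manifold M \<and> topspace (mtop M) = carrier G \<and>
     smooth_map (prod_mfd M M) M (\<lambda>(x, y). x \<otimes>\<^bsub>G\<^esub> y) \<and>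
     smooth_map M M (\<lambda>x. inv\<^bsub>G\<^esub> x)"

text \<open>The value at \<open>g\<close> of the left-invariant vector field extending \<open>u \<in> T\<^sub>1G\<close>, and the derivative at
  \<open>g\<close> of a function along this field.\<close>

definition left_field :: "'g monoid \<Rightarrow> ('g, 'e::euclidean_space) mfd \<Rightarrow> 'e \<Rightarrow> 'g \<Rightarrow> 'e" where
  "left_field G M u g = mderiv M M (\<lambda>x. g \<otimes>\<^bsub>G\<^esub> x) \<one>\<^bsub>G\<^esub> u"

definition left_deriv ::
  "'g monoid \<Rightarrow> ('g, 'e::euclidean_space) mfd \<Rightarrow> 'e \<Rightarrow> ('g \<Rightarrow> 'f::euclidean_space) \<Rightarrow> 'g \<Rightarrow> 'f" where
  "left_deriv G M u f g = mderiv M eucl f g (left_field G M u g)"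

text \<open>\<open>\<phi>\<close> identifies the Lie algebra \<open>br\<close> with the Lie algebra \<open>T\<^sub>1G\<close> of \<open>G\<close>, whose bracket is the
  commutator of left-invariant vector fields acting on (locally defined) smooth functions.\<close>

definition has_lie_algebra ::
  "'g monoid \<Rightarrow> ('g, 'e::euclidean_space) mfd \<Rightarrow> ('v::euclidean_space \<Rightarrow> 'v \<Rightarrow> 'v) \<Rightarrow> ('v \<Rightarrow> 'e) \<Rightarrow> bool" where
  "has_lie_algebra G M br \<phi> \<longleftrightarrow>
     linear \<phi> \<and> bij_betw \<phi> UNIV (model M) \<and>
     (\<forall>U f v w. openin (mtop M) U \<and> smooth_map_on M eucl U (f :: 'g \<Rightarrow> real) \<longrightarrow>
        (\<forall>p\<in>U. left_deriv G M (\<phi> (br v w)) f p =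
                 left_deriv G M (\<phi> v) (left_deriv G M (\<phi> w) f) p -
                 left_deriv G M (\<phi> w) (left_deriv G M (\<phi> v) f) p))"

definition Ad ::
  "'g monoid \<Rightarrow> ('g, 'e::euclidean_space) mfd \<Rightarrow> ('v \<Rightarrow> 'e) \<Rightarrow> 'g \<Rightarrow> 'v \<Rightarrow> 'v" where
  "Ad G M \<phi> g v =
     the_inv_into UNIV \<phi> (mderiv M M (\<lambda>x. g \<otimes>\<^bsub>G\<^esub> x \<otimes>\<^bsub>G\<^esub> inv\<^bsub>G\<^esub> g) \<one>\<^bsub>G\<^esub> (\<phi> v))"

text \<open>\<open>T\<close> with the manifold structure \<open>N\<close> is an immersed (not necessarily closed) Lie subgroup of \<open>G\<close>
  with Lie algebra \<open>t\<close>.\<close>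

definition immersed_lie_subgroup ::
  "'g monoid \<Rightarrow> ('g, 'e::euclidean_space) mfd \<Rightarrow> ('v \<Rightarrow> 'e) \<Rightarrow> 'g set \<Rightarrow> ('g, 'e) mfd \<Rightarrow> 'v set \<Rightarrow> bool" where
  "immersed_lie_subgroup G M \<phi> T N t \<longleftrightarrow>
     subgroup T G \<and> lie_group (G\<lparr>carrier := T\<rparr>) N \<and>
     smooth_map N M (\<lambda>x. x) \<and> (\<forall>p\<in>T. inj_on (mderiv N M (\<lambda>x. x) p) (model N)) \<and>
     t = {v. \<phi> v \<in> mderiv N M (\<lambda>x. x) \<one>\<^bsub>G\<^esub> ` model N}"

definition virtual_lie_subgroup ::
  "'g monoid \<Rightarrow> ('g, 'e::euclidean_space) mfd \<Rightarrow> ('v \<Rightarrow> 'e) \<Rightarrow> 'g set \<Rightarrow> 'v set \<Rightarrow> bool" where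
  "virtual_lie_subgroup G M \<phi> T t \<longleftrightarrow> (\<exists>N. immersed_lie_subgroup G M \<phi> T N t)"

definition connected_lie_subgroup ::
  "'g monoid \<Rightarrow> ('g, 'e::euclidean_space) mfd \<Rightarrow> ('v \<Rightarrow> 'e) \<Rightarrow> 'g set \<Rightarrow> 'v set \<Rightarrow> bool" where
  "connected_lie_subgroup G M \<phi> H h \<longleftrightarrow>
     (\<exists>N. immersed_lie_subgroup G M \<phi> H N h \<and> connected_space (mtop N))"

text \<open>The homogeneous manifold structure on \<open>G/H\<close> is the one of dimension \<open>dim G - dim H\<close> for which
  the projection is a smooth submersion.\<close>

definition homogeneous_manifold ::
  "'g monoid \<Rightarrow> ('g, 'e::euclidean_space) mfd \<Rightarrow> 'g set \<Rightarrow> 'v::euclidean_space set \<Rightarrow>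
   ('g set, 'o::euclidean_space) mfd \<Rightarrow> bool" where
  "homogeneous_manifold G M H h Q \<longleftrightarrow>
     smooth_manifold Q \<and> topspace (mtop Q) = lcosets\<^bsub>G\<^esub> H \<and>
     dim (model Q) + dim h = dim (model M) \<and>
     smooth_map M Q (\<lambda>g. g <#\<^bsub>G\<^esub> H) \<and>
     (\<forall>g\<in>carrier G. mderiv M Q (\<lambda>g. g <#\<^bsub>G\<^esub> H) g ` model M = model Q)"


section \<open>The quaternionic moment map\<close>

text \<open>The value at \<open>x \<in> G/H\<close> of the vector field induced by \<open>v\<close> is the derivative at \<open>1\<close>, in the
  direction \<open>v\<close>, of the orbit map \<open>a \<mapsto> a x\<close>.\<close>

definition induced_field ::
  "'g monoid \<Rightarrow> ('g, 'e::euclidean_space) mfd \<Rightarrow> ('v \<Rightarrow> 'e) \<Rightarrow> ('g set, 'o::euclidean_space) mfd \<Rightarrow>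
   'v \<Rightarrow> 'g set \<Rightarrow> 'o" where
  "induced_field G M \<phi> Q v x = mderiv M Q (\<lambda>a. a <#\<^bsub>G\<^esub> x) \<one>\<^bsub>G\<^esub> (\<phi> v)"

text \<open>Identification \<open>G \<times>\<^sub>H m = T(G/H)\<close>: the class of \<open>(g, w)\<close> is the tangent vector
  \<open>d\<pi>(l\<^bsub>g*\<^esub> w)\<close>. Conversely, \<open>m_coord \<dots> g a\<close> represents \<open>a \<in> T\<^bsub>gH\<^esub>(G/H)\<close> at \<open>g\<close>.\<close>

definition tangent_class ::
  "'g monoid \<Rightarrow> ('g, 'e::euclidean_space) mfd \<Rightarrow> ('v \<Rightarrow> 'e) \<Rightarrow> 'g set \<Rightarrow>
   ('g set, 'o::euclidean_space) mfd \<Rightarrow> 'g \<Rightarrow> 'v \<Rightarrow> 'o" where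
  "tangent_class G M \<phi> H Q g w = mderiv M Q (\<lambda>x. x <#\<^bsub>G\<^esub> H) g (left_field G M (\<phi> w) g)"

definition m_coord ::
  "'g monoid \<Rightarrow> ('g, 'e::euclidean_space) mfd \<Rightarrow> ('v \<Rightarrow> 'e) \<Rightarrow> 'g set \<Rightarrow> 'v set \<Rightarrow>
   ('g set, 'o::euclidean_space) mfd \<Rightarrow> 'g \<Rightarrow> 'o \<Rightarrow> 'v" where
  "m_coord G M \<phi> H m Q g a = (THE w. w \<in> m \<and> tangent_class G M \<phi> H Q g w = a)"

text \<open>The class of \<open>(g, \<xi>)\<close> in \<open>G \<times>\<^sub>H s\<close>, sections of \<open>G \<times>\<^sub>H s \<rightarrow> G/H\<close>, and the equivariant map
  \<open>G \<rightarrow> s\<close> corresponding to a section. A section is smooth iff this map is.\<close>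

definition bundle_class ::
  "'g monoid \<Rightarrow> ('g, 'e::euclidean_space) mfd \<Rightarrow> ('v \<Rightarrow> 'e) \<Rightarrow> 'g set \<Rightarrow> 'g \<Rightarrow> 'v \<Rightarrow> ('g \<times> 'v) set" where
  "bundle_class G M \<phi> H g \<xi> = {(g \<otimes>\<^bsub>G\<^esub> a, Ad G M \<phi> (inv\<^bsub>G\<^esub> a) \<xi>) | a. a \<in> H}"

definition equivariant_map ::
  "'g monoid \<Rightarrow> ('g, 'e::euclidean_space) mfd \<Rightarrow> ('v \<Rightarrow> 'e) \<Rightarrow> 'g set \<Rightarrow> 'v set \<Rightarrow>
   ('g set \<Rightarrow> ('g \<times> 'v) set) \<Rightarrow> 'g \<Rightarrow> 'v" where
  "equivariant_map G M \<phi> H s \<sigma> g =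
     (THE \<xi>. \<xi> \<in> s \<and> \<sigma> (g <#\<^bsub>G\<^esub> H) = bundle_class G M \<phi> H g \<xi>)"

definition quaternionic_section ::
  "'g monoid \<Rightarrow> ('g, 'e::euclidean_space) mfd \<Rightarrow> ('v::euclidean_space \<Rightarrow> 'e) \<Rightarrow> 'g set \<Rightarrow> 'v set \<Rightarrow>
   ('g set \<Rightarrow> ('g \<times> 'v) set) \<Rightarrow> bool" where
  "quaternionic_section G M \<phi> H s \<sigma> \<longleftrightarrow>
     (\<forall>x\<in>lcosets\<^bsub>G\<^esub> H. \<exists>g\<in>x. \<exists>\<xi>\<in>s. \<sigma> x = bundle_class G M \<phi> H g \<xi>) \<and>
     smooth_map M eucl (equivariant_map G M \<phi> H s \<sigma>)"

text \<open>The canonical connection has horizontal spaces \<open>l\<^bsub>g*\<^esub> m\<close>: for a section with equivariant map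
  \<open>f\<close>, the covariant derivative in the direction of the class of \<open>(g, w)\<close>, \<open>w \<in> m\<close>, is represented at
  \<open>g\<close> by the derivative of \<open>f\<close> along \<open>l\<^bsub>g*\<^esub> w\<close>.\<close>

definition nabla ::
  "'g monoid \<Rightarrow> ('g, 'e::euclidean_space) mfd \<Rightarrow> ('v::euclidean_space \<Rightarrow> 'e) \<Rightarrow> ('g \<Rightarrow> 'v) \<Rightarrow>
   'g \<Rightarrow> 'v \<Rightarrow> 'v" where
  "nabla G M \<phi> f g w = left_deriv G M (\<phi> w) f g"

definition Theta ::
  "('v::euclidean_space \<Rightarrow> 'v \<Rightarrow> 'v) \<Rightarrow> 'v set \<Rightarrow> 'v set \<Rightarrow> 'v set \<Rightarrow> real \<Rightarrow> 'v \<Rightarrow> 'v \<Rightarrow> 'v" where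
  "Theta br h' s m lam w1 w2 = - lam *\<^sub>R s_part h' s m (br w1 w2)"

text \<open>Sections \<open>\<mu>\<close> of \<open>t\<^sup>* \<otimes> (G \<times>\<^sub>H s)\<close> with \<open>\<nabla>\<mu>\<^sub>v = \<Theta>(v\<^sub>O, \<cdot>)\<close> for all \<open>v \<in> t\<close>, where
  \<open>v\<^sub>O\<close> is the induced vector field; the equation between bundle-valued one-forms is expressed
  through the representatives at each \<open>g \<in> G\<close>.\<close>

definition quaternionic_moment_map ::
  "'g monoid \<Rightarrow> ('g, 'e::euclidean_space) mfd \<Rightarrow> ('v::euclidean_space \<Rightarrow> 'v \<Rightarrow> 'v) \<Rightarrow> ('v \<Rightarrow> 'e) \<Rightarrow>
   'g set \<Rightarrow> 'v set \<Rightarrow> 'v set \<Rightarrow> 'v set \<Rightarrow> ('g set, 'o::euclidean_space) mfd \<Rightarrow> real \<Rightarrow> 'v set \<Rightarrow>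
   ('v \<Rightarrow> 'g set \<Rightarrow> ('g \<times> 'v) set) \<Rightarrow> bool" where
  "quaternionic_moment_map G M br \<phi> H h' s m Q lam t \<mu> \<longleftrightarrow>
     (\<forall>v\<in>t. quaternionic_section G M \<phi> H s (\<mu> v)) \<and>
     (\<forall>v\<in>t. \<forall>w\<in>t. \<forall>a b. \<forall>g\<in>carrier G.
        equivariant_map G M \<phi> H s (\<mu> (a *\<^sub>R v + b *\<^sub>R w)) g =
        a *\<^sub>R equivariant_map G M \<phi> H s (\<mu> v) g + b *\<^sub>R equivariant_map G M \<phi> H s (\<mu> w) g) \<and>
     (\<forall>v\<in>t. \<forall>g\<in>carrier G. \<forall>w\<in>m.
        nabla G M \<phi> (equivariant_map G M \<phi> H s (\<mu> v)) g w =
        Theta br h' s m lam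
          (m_coord G M \<phi> H m Q g (induced_field G M \<phi> Q v (g <#\<^bsub>G\<^esub> H))) w)"

end

theory Submission
  imports Defs
begin

text \<open>All differentials are computed on plots, i.e. smooth maps from open subsets of Euclidean spaces,
  for which the chain rule holds whatever charts are preferred. The Lie bracket, given as a commutator
  of left-invariant fields, is identified with the derivative of \<open>Ad\<close> at the unit; hence the derivative of
  \<open>g \<mapsto> (Ad\<^sub>g\<^sup>-\<^sup>1 v)\<^sub>s\<close> along \<open>w \<in> m\<close> is \<open>-[w, Ad\<^sub>g\<^sup>-\<^sup>1 v]\<^sub>s\<close>. Only the \<open>m\<close>-component of
  \<open>Ad\<^sub>g\<^sup>-\<^sup>1 v\<close> contributes, and it represents the induced vector field at \<open>g\<close>, so that
  \<open>-\<lambda> (Ad\<^sub>g\<^sup>-\<^sup>1 v)\<^sub>s\<close> is a moment map. It is equivariant because the splitting of the Lie algebra is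
  \<open>ad\<^sub>h\<close>-invariant and \<open>H\<close> is connected. The difference of two moment maps is annihilated by \<open>m\<close>, hence
  by \<open>[m, m] = h\<close>, hence constant; its value is fixed by \<open>Ad\<^sub>H\<close>, so it commutes with \<open>s = sp(1)\<close> and is zero.\<close>

section \<open>Smooth maps on open sets\<close>

text \<open>The obstacle is that \<open>mderiv\<close> reads a differential through charts picked by
  \<open>SOME\<close>, one for each point, and within a model subspace that may have empty interior.
  The velocity of a plot is an ordinary derivative on an open set, so both difficulties are settled
  once, in the chain rule \<open>velocity_compose\<close>. Plots may have any Euclidean domain type.
  Hence products of plots are available, and quantities such as \<open>Ad\<close>, left derivatives
  and logarithmic derivatives become partial derivatives of one jointly smooth function of two
  variables. This gives their smoothness and, through the symmetry of second derivatives, the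
  commutator formula.

  No exponential map is used. Its role near the unit is taken by a parametrisation coming from a
  chart, and invariance under a group is obtained from invariance under its Lie algebra by
  uniqueness for linear differential equations along straight segments.\<close>

abbreviation fder :: "('a::real_normed_vector \<Rightarrow> 'b::real_normed_vector) \<Rightarrow> 'a \<Rightarrow> 'a \<Rightarrow> 'b" where
  "fder f x \<equiv> frechet_derivative f (at x)"

lemma fder_eqI: "(f has_derivative D) (at x) \<Longrightarrow> fder f x = D"
  by (rule frechet_derivative_at[symmetric])

lemma fder_works: "f differentiable (at x) \<Longrightarrow> (f has_derivative fder f x) (at x)"
  by (simp add: frechet_derivative_works)

lemma fder_cong:
  assumes "open X" "x \<in> X" "\<And>y. y \<in> X \<Longrightarrow> f y = g y"
  shows "fder f x = fder g x"
proof -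
  have "\<And>D. (f has_derivative D) (at x) \<longleftrightarrow> (g has_derivative D) (at x)"
    using assms by (metis has_derivative_transform_within_open)
  then show ?thesis unfolding frechet_derivative_def by simp
qed

lemma Ck_on_cong:
  assumes "open W" "\<And>x. x \<in> W \<Longrightarrow> f x = g x"
  shows "Ck_on k f W \<longleftrightarrow> Ck_on k g W"
  using assms(2)
proof (induction k arbitrary: f g)
  case 0 then show ?case by (simp cong: continuous_on_cong)
next
  case (Suc k)
  have "f differentiable_on W \<longleftrightarrow> g differentiable_on W"
    unfolding differentiable_on_def using Suc.prems
    by (metis differentiable_transform_within zero_less_one)
  moreover have "Ck_on k (\<lambda>x. fder f x v) W \<longleftrightarrow> Ck_on k (\<lambda>x. fder g x v) W" for v
    by (rule Suc.IH) (metis fder_cong assms(1) Suc.prems)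
  ultimately show ?case by simp
qed

lemma Ck_on_subset: "Ck_on k f W \<Longrightarrow> V \<subseteq> W \<Longrightarrow> Ck_on k f V"
proof (induction k arbitrary: f)
  case 0 then show ?case by (auto intro: continuous_on_subset)
next
  case (Suc k) then show ?case by (auto intro: differentiable_on_subset)
qed

lemma Ck_on_Suc_imp: "Ck_on (Suc k) f W \<Longrightarrow> Ck_on k f W"
proof (induction k arbitrary: f)
  case 0 then show ?case by (auto intro: differentiable_imp_continuous_on)
next
  case (Suc k)
  show ?case unfolding Ck_on.simps(2)[of k]
    using Suc.prems Suc.IH by (metis Ck_on.simps(2))
qed

lemma Ck_on_local:
  assumes "\<And>x. x \<in> W \<Longrightarrow> \<exists>V. open V \<and> x \<in> V \<and> Ck_on k f V"
  shows "Ck_on k f W"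
  using assms
proof (induction k arbitrary: f)
  case 0
  then show ?case
    by (metis Ck_on.simps(1) continuous_at_imp_continuous_on continuous_on_eq_continuous_at)
next
  case (Suc k)
  have "f differentiable_on W" unfolding differentiable_on_def
  proof
    fix x assume "x \<in> W"
    then obtain V where "open V" "x \<in> V" "f differentiable_on V" using Suc.prems by auto
    then have "f differentiable (at x)"
      by (simp add: differentiable_on_eq_differentiable_at)
    then show "f differentiable (at x within W)" by (rule differentiable_at_withinI)
  qed
  moreover have "Ck_on k (\<lambda>x. fder f x v) W" for v
    by (rule Suc.IH) (use Suc.prems in fastforce)
  ultimately show ?case by simp
qed

lemma Ck_on_const: "Ck_on k (\<lambda>x. c) W"
  by (induction k arbitrary: c) (auto simp: differentiable_on_def)

lemma Ck_on_linear: "bounded_linear L \<Longrightarrow> Ck_on k L W"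
proof (induction k)
  case 0 then show ?case by (simp add: linear_continuous_on)
next
  case (Suc k)
  have "fder L x = L" for x
    by (rule fder_eqI) (rule bounded_linear_imp_has_derivative[OF Suc.prems])
  then show ?case
    using Suc.prems by (simp add: bounded_linear_imp_differentiable_on Ck_on_const)
qed

text \<open>Lets an explicit derivative formula replace \<open>frechet_derivative\<close>, so that
  each closure property below is an induction on \<open>k\<close> driven by the matching
  differentiation rule.\<close>

lemma Ck_on_SucI:
  assumes "open W" "\<And>x. x \<in> W \<Longrightarrow> (f has_derivative D x) (at x)"
    and "\<And>v. Ck_on k (\<lambda>x. D x v) W"
  shows "Ck_on (Suc k) f W"
proof -
  have "fder f x = D x" if "x \<in> W" for x using assms(2)[OF that] by (rule fder_eqI)
  then have "Ck_on k (\<lambda>x. fder f x v) W" for v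
    using assms(3)[of v] by (subst Ck_on_cong[OF assms(1)]) auto
  moreover have "f differentiable_on W"
    using assms(2) by (metis differentiableI differentiable_at_imp_differentiable_on)
  ultimately show ?thesis by simp
qed

lemma Ck_on_SucD:
  assumes "open W" "Ck_on (Suc k) f W"
  shows "\<And>x. x \<in> W \<Longrightarrow> (f has_derivative fder f x) (at x)" "\<And>v. Ck_on k (\<lambda>x. fder f x v) W"
    "Ck_on k f W"
  using assms Ck_on_Suc_imp[OF assms(2)]
  by (auto simp: differentiable_on_eq_differentiable_at intro: fder_works)

lemma Ck_on_bounded_linear:
  assumes "bounded_linear L" "open W" "Ck_on k f W"
  shows "Ck_on k (\<lambda>x. L (f x)) W"
  using assms(3)
proof (induction k arbitrary: f)
  case 0 then show ?case
    by (simp add: assms(1) bounded_linear.continuous_on)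
next
  case (Suc k)
  note * = Ck_on_SucD[OF assms(2) Suc.prems]
  show ?case
    by (rule Ck_on_SucI[OF assms(2) bounded_linear.has_derivative[OF assms(1) *(1)]])
      (auto intro: Suc.IH *)
qed

lemma Ck_on_add:
  assumes "open W" "Ck_on k f W" "Ck_on k g W"
  shows "Ck_on k (\<lambda>x. f x + g x) W"
  using assms(2,3)
proof (induction k arbitrary: f g)
  case 0 then show ?case by (auto intro: continuous_intros)
next
  case (Suc k)
  note * = Ck_on_SucD[OF assms(1) Suc.prems(1)] Ck_on_SucD[OF assms(1) Suc.prems(2)]
  show ?case
    by (rule Ck_on_SucI[OF assms(1) has_derivative_add[OF *(1) *(4)]]) (auto intro: Suc.IH *)
qed

lemma Ck_on_sum:
  assumes "open W" "\<And>i. i \<in> I \<Longrightarrow> Ck_on k (f i) W"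
  shows "Ck_on k (\<lambda>x. \<Sum>i\<in>I. f i x) W"
  using assms(2)
  by (induction I rule: infinite_finite_induct) (auto intro: Ck_on_add assms(1) Ck_on_const)

lemma Ck_on_scaleR:
  assumes "open W" "Ck_on k f W" "Ck_on k g W"
  shows "Ck_on k (\<lambda>x. f x *\<^sub>R g x) W"
  using assms(2,3)
proof (induction k arbitrary: f g)
  case 0 then show ?case by (auto intro: continuous_intros)
next
  case (Suc k)
  note * = Ck_on_SucD[OF assms(1) Suc.prems(1)] Ck_on_SucD[OF assms(1) Suc.prems(2)]
  show ?case
    by (rule Ck_on_SucI[OF assms(1) has_derivative_scaleR[OF *(1) *(4)]])
      (auto intro!: Suc.IH Ck_on_add * assms(1))
qed

lemma Ck_on_Pair:
  assumes "open W" "Ck_on k f W" "Ck_on k g W"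
  shows "Ck_on k (\<lambda>x. (f x, g x)) W"
  using assms(2,3)
proof (induction k arbitrary: f g)
  case 0 then show ?case by (auto intro: continuous_intros)
next
  case (Suc k)
  note * = Ck_on_SucD[OF assms(1) Suc.prems(1)] Ck_on_SucD[OF assms(1) Suc.prems(2)]
  show ?case
    by (rule Ck_on_SucI[OF assms(1) has_derivative_Pair[OF *(1) *(4)]])
      (auto intro!: Suc.IH Ck_on_add * assms(1))
qed

lemma linear_basis_expand:
  fixes L :: "'a::euclidean_space \<Rightarrow> 'b::real_vector"
  assumes "linear L" shows "L v = (\<Sum>b\<in>Basis. (v \<bullet> b) *\<^sub>R L b)"
proof -
  have "L v = L (\<Sum>b\<in>Basis. (v \<bullet> b) *\<^sub>R b)" by (simp add: euclidean_representation)
  also have "\<dots> = (\<Sum>b\<in>Basis. (v \<bullet> b) *\<^sub>R L b)"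
    by (simp add: assms linear_sum linear_cmul o_def)
  finally show ?thesis .
qed

lemma Ck_on_compose:
  fixes f :: "'a::euclidean_space \<Rightarrow> 'b::euclidean_space" and g :: "'b \<Rightarrow> 'c::real_normed_vector"
  assumes "open W" "open V" "f ` W \<subseteq> V" "Ck_on k f W" "Ck_on k g V"
  shows "Ck_on k (\<lambda>x. g (f x)) W"
  using assms(4,5)
proof (induction k arbitrary: g)
  case 0 then show ?case using assms(3) by (auto intro: continuous_on_compose2)
next
  case (Suc k)
  note f = Ck_on_SucD[OF assms(1) Suc.prems(1)] and g = Ck_on_SucD[OF assms(2) Suc.prems(2)]
  have "((\<lambda>x. g (f x)) has_derivative (\<lambda>v. fder g (f x) (fder f x v))) (at x)" if "x \<in> W" for x
    using has_derivative_compose[OF f(1)[OF that] g(1)[of "f x"]] assms(3) that by auto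
  moreover have "Ck_on k (\<lambda>x. fder g (f x) (fder f x v)) W" for v
  proof -
    \<comment> \<open>The direction \<open>fder f x v\<close> moves with \<open>x\<close>, while the
      induction hypothesis concerns derivatives of \<open>g\<close> in fixed directions; expanding
      in a basis separates the two.\<close>
    have "fder g (f x) (fder f x v) = (\<Sum>b\<in>Basis. (fder f x v \<bullet> b) *\<^sub>R fder g (f x) b)"
      if "x \<in> W" for x
      by (rule linear_basis_expand, rule has_derivative_linear, rule g(1)) (use assms(3) that in auto)
    moreover have "Ck_on k (\<lambda>x. \<Sum>b\<in>Basis. (fder f x v \<bullet> b) *\<^sub>R fder g (f x) b) W"
      by (auto intro!: Ck_on_sum Ck_on_scaleR Suc.IH f(2,3) g(2) assms(1)
          Ck_on_bounded_linear[OF bounded_linear_inner_left])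
    ultimately show ?thesis by (subst Ck_on_cong[OF assms(1)])
  qed
  ultimately show ?case by (intro Ck_on_SucI[OF assms(1)])
qed

text \<open>Openness is built in because \<open>Ck_on\<close> combines differentiability within
  \<open>W\<close> with derivatives at full neighbourhoods; on open sets the two agree.\<close>

definition smooth_in ::
  "'a::euclidean_space set \<Rightarrow> ('a \<Rightarrow> 'b::euclidean_space) \<Rightarrow> bool" where
  "smooth_in W f \<longleftrightarrow> open W \<and> (\<forall>k. Ck_on k f W)"

lemma smooth_in_open: "smooth_in W f \<Longrightarrow> open W"
  by (simp add: smooth_in_def)

lemma smooth_in_cong: "open W \<Longrightarrow> (\<And>x. x \<in> W \<Longrightarrow> f x = g x) \<Longrightarrow> smooth_in W f = smooth_in W g"
  using Ck_on_cong unfolding smooth_in_def by blast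

lemma smooth_in_subset: "smooth_in W f \<Longrightarrow> open V \<Longrightarrow> V \<subseteq> W \<Longrightarrow> smooth_in V f"
  using Ck_on_subset unfolding smooth_in_def by blast

lemma smooth_in_local:
  assumes "open W" "\<And>x. x \<in> W \<Longrightarrow> \<exists>V. x \<in> V \<and> smooth_in V f"
  shows "smooth_in W f"
  using assms Ck_on_local unfolding smooth_in_def by meson

lemma smooth_in_const: "open W \<Longrightarrow> smooth_in W (\<lambda>x. c)"
  by (simp add: smooth_in_def Ck_on_const)

lemma smooth_in_linear: "open W \<Longrightarrow> linear L \<Longrightarrow> smooth_in W L"
  by (simp add: smooth_in_def Ck_on_linear linear_conv_bounded_linear)

lemma smooth_in_linear_compose: "linear L \<Longrightarrow> smooth_in W f \<Longrightarrow> smooth_in W (\<lambda>x. L (f x))"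
  by (simp add: smooth_in_def Ck_on_bounded_linear linear_conv_bounded_linear)

lemma smooth_in_Pair: "smooth_in W f \<Longrightarrow> smooth_in W g \<Longrightarrow> smooth_in W (\<lambda>x. (f x, g x))"
  by (simp add: smooth_in_def Ck_on_Pair)

lemma smooth_in_compose:
  assumes "smooth_in W f" "smooth_in V g" "f ` W \<subseteq> V"
  shows "smooth_in W (\<lambda>x. g (f x))"
  using assms by (auto simp: smooth_in_def intro: Ck_on_compose)

lemma smooth_in_fder: "smooth_in W f \<Longrightarrow> smooth_in W (\<lambda>x. fder f x v)"
  by (metis Ck_on.simps(2) smooth_in_def)

lemma smooth_in_has_derivative:
  "smooth_in W f \<Longrightarrow> x \<in> W \<Longrightarrow> (f has_derivative fder f x) (at x)"
  by (metis Ck_on_SucD(1) smooth_in_def)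

lemma smooth_in_differentiable: "smooth_in W f \<Longrightarrow> x \<in> W \<Longrightarrow> f differentiable (at x)"
  using smooth_in_has_derivative differentiableI by blast

lemma smooth_in_linear_fder: "smooth_in W f \<Longrightarrow> x \<in> W \<Longrightarrow> linear (fder f x)"
  using smooth_in_has_derivative has_derivative_linear by blast

lemma smooth_in_continuous: "smooth_in W f \<Longrightarrow> continuous_on W f"
  by (metis Ck_on.simps(1) smooth_in_def)

lemma fder_linear_compose:
  fixes L :: "'a::euclidean_space \<Rightarrow> 'b::real_normed_vector"
  assumes "linear L" "g differentiable (at x)"
  shows "fder (\<lambda>y. L (g y)) x v = L (fder g x v)"
proof -
  have "bounded_linear L" using assms(1) by (simp add: linear_conv_bounded_linear)
  then have "((\<lambda>y. L (g y)) has_derivative (\<lambda>v. L (fder g x v))) (at x)"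
    by (rule bounded_linear.has_derivative) (rule fder_works[OF assms(2)])
  then show ?thesis by (simp add: fder_eqI)
qed

section \<open>Symmetry of second derivatives\<close>

lemma fder_line:
  assumes "f differentiable (at (x + s *\<^sub>R u))"
  shows "((\<lambda>s. f (x + s *\<^sub>R u)) has_vector_derivative fder f (x + s *\<^sub>R u) u) (at s)"
proof -
  have "((\<lambda>s. x + s *\<^sub>R u) has_derivative (\<lambda>d. d *\<^sub>R u)) (at s)"
    by (auto intro!: derivative_eq_intros)
  from has_derivative_compose[OF this fder_works[OF assms]]
  show ?thesis
    unfolding has_vector_derivative_def
    using linear_cmul[OF linear_frechet_derivative[OF assms]] by simp
qed

text \<open>Both iterated derivatives are limits of the same second-order difference quotient.\<close>

lemma second_difference:
  fixes f :: "'a::euclidean_space \<Rightarrow> real"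
  assumes f: "smooth_in W f" and W: "\<And>s t. 0 \<le> s \<Longrightarrow> s \<le> r \<Longrightarrow> 0 \<le> t \<Longrightarrow> t \<le> r \<Longrightarrow> x + s *\<^sub>R u + t *\<^sub>R v \<in> W"
    and r: "0 < r"
  shows "\<exists>s t. 0 < s \<and> s < r \<and> 0 < t \<and> t < r \<and>
    f (x + r *\<^sub>R u + r *\<^sub>R v) - f (x + r *\<^sub>R u) - f (x + r *\<^sub>R v) + f x =
      r * r * fder (\<lambda>z. fder f z u) (x + s *\<^sub>R u + t *\<^sub>R v) v"
proof -
  \<comment> \<open>The mean value theorem is applied to the increment \<open>p\<close> in the
    direction \<open>u\<close>, and then to \<open>q\<close>, the \<open>u\<close>-derivative at the
    intermediate point, in the direction \<open>v\<close>.\<close>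
  define p where "p s = f ((x + r *\<^sub>R v) + s *\<^sub>R u) - f (x + s *\<^sub>R u)" for s
  have p: "(p has_real_derivative
      fder f ((x + r *\<^sub>R v) + s *\<^sub>R u) u - fder f (x + s *\<^sub>R u) u) (at s)" if "0 \<le> s" "s \<le> r" for s
    unfolding p_def has_real_derivative_iff_has_vector_derivative
    by (intro has_vector_derivative_diff fder_line smooth_in_differentiable[OF f])
      (use W[of s r] W[of s 0] that r in \<open>auto simp: algebra_simps\<close>)
  obtain s where s: "0 < s" "s < r" and
    ps: "p r - p 0 = (r - 0) * (fder f ((x + r *\<^sub>R v) + s *\<^sub>R u) u - fder f (x + s *\<^sub>R u) u)"
    using MVT2[OF r p] by auto
  define q where "q t = fder f ((x + s *\<^sub>R u) + t *\<^sub>R v) u" for t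
  have q: "(q has_real_derivative fder (\<lambda>z. fder f z u) ((x + s *\<^sub>R u) + t *\<^sub>R v) v) (at t)"
    if "0 \<le> t" "t \<le> r" for t
    unfolding q_def has_real_derivative_iff_has_vector_derivative
    by (intro fder_line smooth_in_differentiable[OF smooth_in_fder[OF f]])
      (use W[of s t] that s in auto)
  obtain t where t: "0 < t" "t < r" and
    qt: "q r - q 0 = (r - 0) * fder (\<lambda>z. fder f z u) ((x + s *\<^sub>R u) + t *\<^sub>R v) v"
    using MVT2[OF r q] by auto
  have "(x + r *\<^sub>R v) + s *\<^sub>R u = (x + s *\<^sub>R u) + r *\<^sub>R v" by simp
  then have "p r - p 0 = r * (q r - q 0)" using ps unfolding q_def by (metis add.right_neutral diff_zero scale_zero_left)
  moreover have "p r - p 0 = f (x + r *\<^sub>R u + r *\<^sub>R v) - f (x + r *\<^sub>R u) - f (x + r *\<^sub>R v) + f x"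
    by (simp add: p_def algebra_simps)
  ultimately show ?thesis using s t qt by auto
qed

lemma fder_fder_commute_real:
  fixes f :: "'a::euclidean_space \<Rightarrow> real"
  assumes f: "smooth_in W f" and x: "x \<in> W"
  shows "fder (\<lambda>z. fder f z u) x v = fder (\<lambda>z. fder f z v) x u"
proof -
  obtain e where e: "e > 0" "ball x e \<subseteq> W" 
    using smooth_in_open[OF f] x open_contains_ball by blast
  define K where "K = norm u + norm v + 1"
  have K: "K > 0" unfolding K_def by (smt (verit) norm_ge_zero)
  \<comment> \<open>Every point of the parallelogram spanned at \<open>x\<close> by the two vectors
    scaled by \<open>r\<close> is closer to \<open>x\<close> than \<open>r * K\<close>; the summand
    1 in \<open>K\<close> makes the bound strict.\<close>
  have small: "dist (x + s *\<^sub>R u + t *\<^sub>R v) x < r * K" if "0 \<le> s" "s \<le> r" "0 \<le> t" "t \<le> r" "0 < r" for s t r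
  proof -
    have "dist (x + s *\<^sub>R u + t *\<^sub>R v) x = norm (s *\<^sub>R u + t *\<^sub>R v)" by (simp add: dist_norm)
    also have "\<dots> \<le> s * norm u + t * norm v" using that norm_triangle_ineq[of "s *\<^sub>R u" "t *\<^sub>R v"] by simp
    also have "\<dots> \<le> r * norm u + r * norm v" using that by (intro add_mono mult_right_mono) auto
    also have "\<dots> < r * K" using that by (simp add: K_def algebra_simps)
    finally show ?thesis .
  qed
  let ?A = "\<lambda>y. fder (\<lambda>z. fder f z u) y v" and ?B = "\<lambda>y. fder (\<lambda>z. fder f z v) y u"
  have cont: "isCont ?A x" "isCont ?B x"
    using smooth_in_continuous[OF smooth_in_fder[OF smooth_in_fder[OF f]]] smooth_in_open[OF f] x
    by (auto simp: continuous_on_eq_continuous_at)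
  show ?thesis
  proof (rule ccontr)
    assume "?A x \<noteq> ?B x"
    \<comment> \<open>Half the gap: the two mean values coincide, yet each is closer than
      \<open>d\<close> to its own limit.\<close>
    define d where "d = \<bar>?A x - ?B x\<bar> / 2"
    have d: "d > 0" using \<open>?A x \<noteq> ?B x\<close> by (simp add: d_def)
    obtain a where a: "a > 0" "\<And>y. dist y x < a \<Longrightarrow> dist (?A y) (?A x) < d"
      using cont(1) d unfolding continuous_at_eps_delta by blast
    obtain b where b: "b > 0" "\<And>y. dist y x < b \<Longrightarrow> dist (?B y) (?B x) < d"
      using cont(2) d unfolding continuous_at_eps_delta by blast
    define r where "r = min e (min a b) / K"
    have r: "r > 0" "r * K \<le> e" "r * K \<le> a" "r * K \<le> b"
      using e a b K by (auto simp: r_def)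
    have W: "x + s *\<^sub>R u + t *\<^sub>R v \<in> W" "x + s *\<^sub>R v + t *\<^sub>R u \<in> W"
      if "0 \<le> s" "s \<le> r" "0 \<le> t" "t \<le> r" for s t
      using small[of s r t] small[of t r s] that e(2) r
      by (auto simp: dist_commute add_ac subset_iff)
    obtain s t where st: "0 < s" "s < r" "0 < t" "t < r"
      and 1: "f (x + r *\<^sub>R u + r *\<^sub>R v) - f (x + r *\<^sub>R u) - f (x + r *\<^sub>R v) + f x =
        r * r * ?A (x + s *\<^sub>R u + t *\<^sub>R v)"
      using second_difference[OF f W(1) r(1)] by blast
    obtain s' t' where st': "0 < s'" "s' < r" "0 < t'" "t' < r"
      and 2: "f (x + r *\<^sub>R v + r *\<^sub>R u) - f (x + r *\<^sub>R v) - f (x + r *\<^sub>R u) + f x =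
        r * r * ?B (x + s' *\<^sub>R v + t' *\<^sub>R u)"
      using second_difference[OF f W(2) r(1)] by blast
    have eq: "x + r *\<^sub>R v + r *\<^sub>R u = x + r *\<^sub>R u + r *\<^sub>R v" by simp
    have "r * r * ?A (x + s *\<^sub>R u + t *\<^sub>R v) = r * r * ?B (x + s' *\<^sub>R v + t' *\<^sub>R u)"
      using 1 2 unfolding eq by linarith
    then have "?A (x + s *\<^sub>R u + t *\<^sub>R v) = ?B (x + s' *\<^sub>R v + t' *\<^sub>R u)" using r by simp
    moreover have "dist (?A (x + s *\<^sub>R u + t *\<^sub>R v)) (?A x) < d"
      using small[of s r t] st r by (intro a) auto
    moreover have "dist (?B (x + s' *\<^sub>R v + t' *\<^sub>R u)) (?B x) < d"
      using small[of t' r s'] st' r by (intro b) (auto simp: add_ac)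
    ultimately have "dist (?A x) (?B x) < d + d"
      using dist_triangle3[of "?A x" "?B x" "?A (x + s *\<^sub>R u + t *\<^sub>R v)"] by simp
    then show False by (simp add: d_def dist_real_def)
  qed
qed

lemma fder_fder_commute:
  fixes f :: "'a::euclidean_space \<Rightarrow> 'b::euclidean_space"
  assumes f: "smooth_in W f" and x: "x \<in> W"
  shows "fder (\<lambda>z. fder f z u) x v = fder (\<lambda>z. fder f z v) x u"
proof (rule euclidean_eqI)
  fix b :: 'b
  have lin: "linear (\<lambda>y. y \<bullet> b)" by (simp add: linear_iff inner_add_left)
  have *: "fder (\<lambda>z. fder f z u) x v \<bullet> b = fder (\<lambda>z. fder (\<lambda>y. f y \<bullet> b) z u) x v" for u v
  proof -
    have "fder (\<lambda>z. fder (\<lambda>y. f y \<bullet> b) z u) x = fder (\<lambda>z. fder f z u \<bullet> b) x"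
      by (rule fder_cong[OF smooth_in_open[OF f] x])
        (rule fder_linear_compose[OF lin smooth_in_differentiable[OF f]])
    then have "fder (\<lambda>z. fder (\<lambda>y. f y \<bullet> b) z u) x v = fder (\<lambda>z. fder f z u \<bullet> b) x v"
      by (rule fun_cong)
    also have "\<dots> = fder (\<lambda>z. fder f z u) x v \<bullet> b"
      by (rule fder_linear_compose[OF lin smooth_in_differentiable[OF smooth_in_fder[OF f] x]])
    finally show ?thesis by simp
  qed
  show "fder (\<lambda>z. fder f z u) x v \<bullet> b = fder (\<lambda>z. fder f z v) x u \<bullet> b"
    unfolding * by (rule fder_fder_commute_real[OF smooth_in_linear_compose[OF lin f] x])
qed

section \<open>Plots and velocities\<close>

text \<open>The set \<open>S\<close> may have no interior, where derivatives of \<open>f\<close>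
  make no sense. After a smooth map from an open set into \<open>S\<close>, the local extensions of
  \<open>f\<close> yield genuine smoothness.\<close>

lemma smooth_on_compose:
  assumes "smooth_on S f" "smooth_in W q" "q ` W \<subseteq> S"
  shows "smooth_in W (\<lambda>x. f (q x))"
proof (rule smooth_in_local[OF smooth_in_open[OF assms(2)]])
  fix x assume x: "x \<in> W"
  then obtain V F where V: "open V" "q x \<in> V" "\<forall>k. Ck_on k F V" "\<forall>y\<in>V \<inter> S. F y = f y"
    using assms(1,3) unfolding smooth_on_def by (metis image_subset_iff)
  define B where "B = W \<inter> q -` V"
  have B: "open B"
    unfolding B_def using smooth_in_continuous[OF assms(2)] smooth_in_open[OF assms(2)] V(1)
    by (simp add: continuous_on_open_vimage Int_commute)
  have "smooth_in B (\<lambda>x. F (q x))"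
    by (rule smooth_in_compose[of B q V F]) (use V B in \<open>auto simp: smooth_in_def[of V] B_def
      intro: smooth_in_subset[OF assms(2)]\<close>)
  moreover have "F (q y) = f (q y)" if "y \<in> B" for y
    using that V(4) assms(3) by (auto simp: B_def)
  ultimately have "smooth_in B (\<lambda>x. f (q x))" using smooth_in_cong[OF B] by (metis (no_types, lifting))
  then show "\<exists>V. x \<in> V \<and> smooth_in V (\<lambda>x. f (q x))"
    using x V(2) by (intro exI[of _ B]) (auto simp: B_def)
qed

text \<open>The notion of plot from diffeology. The domain type is free, so that maps of two
  parameters are covered as well.\<close>

definition plot ::
  "('a, 'e::euclidean_space) mfd \<Rightarrow> 'd::euclidean_space set \<Rightarrow> ('d \<Rightarrow> 'a) \<Rightarrow> bool" where
  "plot M W p \<longleftrightarrow> open W \<and> continuous_map (top_of_set W) (mtop M) p \<and>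
     (\<forall>(U, c)\<in>atlas M. smooth_in {x \<in> W. p x \<in> U} (\<lambda>x. c (p x)))"

lemma plot_open: "plot M W p \<Longrightarrow> open W"
  by (simp add: plot_def)

lemma plot_in: "plot M W p \<Longrightarrow> x \<in> W \<Longrightarrow> p x \<in> topspace (mtop M)"
  by (auto simp: plot_def continuous_map_def)

lemma plot_vimage_open:
  assumes "plot M W p" "openin (mtop M) U" shows "open {x \<in> W. p x \<in> U}"
proof -
  have "openin (top_of_set W) {x \<in> topspace (top_of_set W). p x \<in> U}"
    using assms openin_continuous_map_preimage unfolding plot_def by blast
  then show ?thesis using plot_open[OF assms(1)] by (simp add: openin_open_eq)
qed

lemma plot_subset:
  assumes "plot M W p" "open V" "V \<subseteq> W" shows "plot M V p"
  unfolding plot_def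
proof (intro conjI ballI)
  show "continuous_map (top_of_set V) (mtop M) p"
    using assms continuous_map_from_subtopology_mono unfolding plot_def by blast
  fix C assume C: "C \<in> atlas M"
  obtain U c where [simp]: "C = (U, c)" by (cases C)
  have sm: "smooth_in {x \<in> W. p x \<in> U} (\<lambda>x. c (p x))" using assms(1) C by (auto simp: plot_def)
  have "{x \<in> V. p x \<in> U} = V \<inter> {x \<in> W. p x \<in> U}" using assms(3) by auto
  then have "open {x \<in> V. p x \<in> U}" using assms(2) smooth_in_open[OF sm] by auto
  then show "case C of (U, c) \<Rightarrow> smooth_in {x \<in> V. p x \<in> U} (\<lambda>x. c (p x))"
    using smooth_in_subset[OF sm] assms(3) by auto
qed (rule assms(2))

lemma plot_cong:
  assumes "plot M W p" "\<And>x. x \<in> W \<Longrightarrow> p x = q x" shows "plot M W q"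
  unfolding plot_def
proof (intro conjI ballI)
  show "continuous_map (top_of_set W) (mtop M) q"
    using assms continuous_map_eq[of "top_of_set W" "mtop M" p q] by (simp add: plot_def)
  fix C assume C: "C \<in> atlas M"
  obtain U c where [simp]: "C = (U, c)" by (cases C)
  have sm: "smooth_in {x \<in> W. p x \<in> U} (\<lambda>x. c (p x))" using assms(1) C by (auto simp: plot_def)
  have "{x \<in> W. q x \<in> U} = {x \<in> W. p x \<in> U}" using assms(2) by auto
  then show "case C of (U, c) \<Rightarrow> smooth_in {x \<in> W. q x \<in> U} (\<lambda>x. c (q x))"
    using smooth_in_cong[OF smooth_in_open[OF sm], of "\<lambda>x. c (p x)" "\<lambda>x. c (q x)"] sm assms(2) by auto
qed (use assms in \<open>simp add: plot_def\<close>)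

lemma plot_reparam:
  assumes "plot M W p" "smooth_in V q" "q ` V \<subseteq> W"
  shows "plot M V (\<lambda>x. p (q x))"
  unfolding plot_def
proof (intro conjI ballI)
  show V: "open V" by (rule smooth_in_open[OF assms(2)])
  have cq: "continuous_map (top_of_set V) (top_of_set W) q"
    using smooth_in_continuous[OF assms(2)] assms(3) by (auto simp: continuous_map_iff_continuous)
  then show "continuous_map (top_of_set V) (mtop M) (\<lambda>x. p (q x))"
    using continuous_map_compose[of "top_of_set V" "top_of_set W" q "mtop M" p] assms(1)
    by (simp add: plot_def o_def)
  fix C assume C: "C \<in> atlas M"
  obtain U c where [simp]: "C = (U, c)" by (cases C)
  have sm: "smooth_in {x \<in> W. p x \<in> U} (\<lambda>x. c (p x))" using assms(1) C by (auto simp: plot_def)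
  have eq: "{x \<in> V. p (q x) \<in> U} = q -` {x \<in> W. p x \<in> U} \<inter> V" using assms(3) by auto
  have "open {x \<in> V. p (q x) \<in> U}"
    unfolding eq using smooth_in_continuous[OF assms(2)] V smooth_in_open[OF sm]
    by (meson continuous_on_open_vimage)
  then show "case C of (U, c) \<Rightarrow> smooth_in {x \<in> V. p (q x) \<in> U} (\<lambda>x. c (p (q x)))"
    using smooth_in_compose[OF smooth_in_subset[OF assms(2)] sm, of "{x \<in> V. p (q x) \<in> U}"] assms(3)
    by auto
qed

text \<open>Only a covering by injective charts is asked of \<open>M\<close>, not that
  \<open>M\<close> is a manifold. Hence the lemma applies to \<open>prod_mfd M M\<close> directly,
  which is what \<open>plot_mult\<close> needs.\<close>

lemma smooth_map_on_plot:
  assumes cover: "topspace (mtop M) \<subseteq> (\<Union>(U, c)\<in>atlas M. U)"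
    and inj: "\<And>U c. (U, c) \<in> atlas M \<Longrightarrow> inj_on c U"
    and N: "\<And>U c. (U, c) \<in> atlas N \<Longrightarrow> openin (mtop N) U"
    and f: "smooth_map_on M N X f" and p: "plot M W p" "p ` W \<subseteq> X"
  shows "plot N W (\<lambda>x. f (p x))"
  unfolding plot_def
proof (intro conjI ballI)
  show W: "open W" by (rule plot_open[OF p(1)])
  have "continuous_map (top_of_set W) (subtopology (mtop M) X) p"
    using p by (auto simp: plot_def continuous_map_in_subtopology)
  then show cont: "continuous_map (top_of_set W) (mtop N) (\<lambda>x. f (p x))"
    using f continuous_map_compose[of "top_of_set W" _ p "mtop N" f]
    by (auto simp: smooth_map_on_def o_def)
  fix C assume C: "C \<in> atlas N"
  obtain U' c' where C': "C = (U', c')" by (cases C)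
  have "openin (top_of_set W) {x \<in> topspace (top_of_set W). f (p x) \<in> U'}"
    using openin_continuous_map_preimage[OF cont] N C C' by blast
  then have op: "open {x \<in> W. f (p x) \<in> U'}" using W by (simp add: openin_open_eq)
  have "smooth_in {x \<in> W. f (p x) \<in> U'} (\<lambda>x. c' (f (p x)))"
  proof (rule smooth_in_local[OF op])
    fix x assume x: "x \<in> {x \<in> W. f (p x) \<in> U'}"
    then obtain U c where U: "(U, c) \<in> atlas M" "p x \<in> U"
      using cover plot_in[OF p(1)] by fastforce
    have sm: "smooth_in {x \<in> W. p x \<in> U} (\<lambda>x. c (p x))" using p(1) U by (auto simp: plot_def)
    let ?V = "{x \<in> W. f (p x) \<in> U'} \<inter> {x \<in> W. p x \<in> U}"
    have V: "open ?V" using op smooth_in_open[OF sm] by auto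
    have "smooth_on (c ` {q \<in> U \<inter> X. f q \<in> U'}) (c' \<circ> f \<circ> inv_into U c)"
      using f U C C' by (auto simp: smooth_map_on_def)
    then have "smooth_in ?V (\<lambda>x. (c' \<circ> f \<circ> inv_into U c) (c (p x)))"
      by (rule smooth_on_compose) (use smooth_in_subset[OF sm V] p(2) in auto)
    moreover have "(c' \<circ> f \<circ> inv_into U c) (c (p y)) = c' (f (p y))" if "y \<in> ?V" for y
      using that inj[OF U(1)] by simp
    ultimately have "smooth_in ?V (\<lambda>x. c' (f (p x)))"
      using smooth_in_cong[OF V] by (metis (no_types, lifting))
    then show "\<exists>V. x \<in> V \<and> smooth_in V (\<lambda>x. c' (f (p x)))"
      using x U by (intro exI[of _ ?V]) simp
  qed
  then show "case C of (U, c) \<Rightarrow> smooth_in {x \<in> W. f (p x) \<in> U} (\<lambda>x. c (f (p x)))"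
    by (simp add: C')
qed

lemma plot_Pair:
  assumes "plot M W p" "plot N W q"
  shows "plot (prod_mfd M N) W (\<lambda>x. (p x, q x))"
  unfolding plot_def
proof (intro conjI ballI)
  show "open W" by (rule plot_open[OF assms(1)])
  show "continuous_map (top_of_set W) (mtop (prod_mfd M N)) (\<lambda>x. (p x, q x))"
    using assms by (simp add: plot_def prod_mfd_def continuous_map_pairedI)
  fix C assume "C \<in> atlas (prod_mfd M N)"
  then obtain U c U' c' where C: "C = (U \<times> U', \<lambda>(p, q). (c p, c' q))"
    "(U, c) \<in> atlas M" "(U', c') \<in> atlas N" by (auto simp: prod_mfd_def)
  have 1: "smooth_in {x \<in> W. p x \<in> U} (\<lambda>x. c (p x))" "smooth_in {x \<in> W. q x \<in> U'} (\<lambda>x. c' (q x))"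
    using assms C by (auto simp: plot_def)
  let ?V = "{x \<in> W. p x \<in> U} \<inter> {x \<in> W. q x \<in> U'}"
  have "open ?V" by (intro open_Int smooth_in_open[OF 1(1)] smooth_in_open[OF 1(2)])
  then have "smooth_in ?V (\<lambda>x. (c (p x), c' (q x)))"
    using 1 by (intro smooth_in_Pair) (auto intro: smooth_in_subset)
  moreover have "{x \<in> W. (p x, q x) \<in> U \<times> U'} = ?V" by auto
  ultimately show "case C of (U, c) \<Rightarrow> smooth_in {x \<in> W. (p x, q x) \<in> U} (\<lambda>x. c (p x, q x))"
    using C(1) by simp
qed

lemma chart_map_eucl [simp]: "chart_map eucl p = (\<lambda>x. x)"
proof -
  have "chart_at eucl p = (UNIV, \<lambda>x. x)"
    unfolding chart_at_def by (rule some1_equality) (auto simp: eucl_def)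
  then show ?thesis by (simp add: chart_map_def)
qed

lemma plot_eucl: "plot eucl W f \<longleftrightarrow> smooth_in W f"
  by (auto simp: plot_def eucl_def smooth_in_open smooth_in_continuous)

text \<open>Charts take values in a subspace that may be proper, so their inverses are defined on sets
  without interior. Precomposing with a linear projection turns them into plots on open sets.\<close>

definition mproj :: "('a, 'e::euclidean_space) mfd \<Rightarrow> 'e \<Rightarrow> 'e" where
  "mproj M = (SOME P. P \<in> UNIV \<rightarrow> model M \<and> linear P \<and> (\<forall>x\<in>model M. P x = x))"

definition mdom :: "('a, 'e::euclidean_space) mfd \<Rightarrow> 'a \<Rightarrow> 'e set" where
  "mdom M q = {y. mproj M y \<in> chart_map M q ` fst (chart_at M q)}"

definition mparam :: "('a, 'e::euclidean_space) mfd \<Rightarrow> 'a \<Rightarrow> 'e \<Rightarrow> 'a" where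
  "mparam M q y = chart_inv M q (mproj M y)"

text \<open>Uses the chart preferred at \<open>p x\<close>, the one through which
  \<open>mderiv\<close> represents the tangent space there; velocities and differentials thus share
  coordinates.\<close>

definition velocity ::
  "('a, 'e::euclidean_space) mfd \<Rightarrow> ('d::euclidean_space \<Rightarrow> 'a) \<Rightarrow> 'd \<Rightarrow> 'd \<Rightarrow> 'e" where
  "velocity M p x = fder (\<lambda>y. chart_map M (p x) (p y)) x"

lemma velocity_eucl [simp]: "velocity eucl f x = fder f x"
  by (simp add: velocity_def)

section \<open>Tangent vectors and the chain rule\<close>

locale manifold =
  fixes M :: "('a, 'e::euclidean_space) mfd"
  assumes smooth_manifold: "smooth_manifold M"
begin

lemma subspace_model: "subspace (model M)"
  using smooth_manifold by (simp add: smooth_manifold_def)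

lemma atlas_cover: "(\<Union>(U, c)\<in>atlas M. U) = topspace (mtop M)"
  using smooth_manifold by (simp add: smooth_manifold_def)

lemma atlasD:
  assumes "(U, c) \<in> atlas M"
  shows "openin (mtop M) U" "openin (top_of_set (model M)) (c ` U)"
    "homeomorphic_map (subtopology (mtop M) U) (top_of_set (c ` U)) c"
  using assms smooth_manifold by (auto simp: smooth_manifold_def)

lemma chart_inj: assumes "(U, c) \<in> atlas M" shows "inj_on c U"
proof -
  have "U \<subseteq> topspace (mtop M)" using atlasD(1)[OF assms] openin_subset by blast
  then show ?thesis
    using homeomorphic_imp_injective_map[OF atlasD(3)[OF assms]] by (simp add: inf_absorb2)
qed

lemma transition:
  "(U, c) \<in> atlas M \<Longrightarrow> (U', c') \<in> atlas M \<Longrightarrow> smooth_on (c ` (U \<inter> U')) (c' \<circ> inv_into U c)"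
  using smooth_manifold by (fastforce simp: smooth_manifold_def)

lemma chart_at:
  assumes "q \<in> topspace (mtop M)"
  shows "(fst (chart_at M q), chart_map M q) \<in> atlas M" "q \<in> fst (chart_at M q)"
proof -
  have "\<exists>C. C \<in> atlas M \<and> q \<in> fst C" using assms atlas_cover by fastforce
  from someI_ex[OF this] show "(fst (chart_at M q), chart_map M q) \<in> atlas M" "q \<in> fst (chart_at M q)"
    by (auto simp: chart_at_def chart_map_def)
qed

lemma chart_inv_chart:
  assumes "q \<in> topspace (mtop M)" "x \<in> fst (chart_at M q)"
  shows "chart_inv M q (chart_map M q x) = x"
  using chart_inj[OF chart_at(1)[OF assms(1)]] assms(2) by (simp add: chart_inv_def chart_map_def)

lemma chart_in_model:
  assumes "q \<in> topspace (mtop M)" "x \<in> fst (chart_at M q)"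
  shows "chart_map M q x \<in> model M"
  using atlasD(2)[OF chart_at(1)[OF assms(1)]] assms(2) openin_subset by fastforce

lemma mproj: "linear (mproj M)" "\<And>x. mproj M x \<in> model M" "\<And>x. x \<in> model M \<Longrightarrow> mproj M x = x"
proof -
  have "\<exists>P. P \<in> UNIV \<rightarrow> model M \<and> linear P \<and> (\<forall>x\<in>model M. P x = x)"
    using linear_exists_left_inverse_on[of "\<lambda>x::'e. x" "model M"] subspace_model linear_id
    by (fastforce simp: id_def inj_on_def)
  from someI_ex[OF this] show "linear (mproj M)" "\<And>x. mproj M x \<in> model M"
    "\<And>x. x \<in> model M \<Longrightarrow> mproj M x = x" by (auto simp: mproj_def)
qed

lemma chart_plot:
  assumes U: "(U, c) \<in> atlas M" and q: "smooth_in W q" "q ` W \<subseteq> c ` U"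
  shows "plot M W (\<lambda>x. inv_into U c (q x))"
  unfolding plot_def
proof (intro conjI ballI)
  show W: "open W" by (rule smooth_in_open[OF q(1)])
  have UM: "U \<subseteq> topspace (mtop M)" using atlasD(1)[OF U] openin_subset by blast
  obtain g where g: "homeomorphic_maps (subtopology (mtop M) U) (top_of_set (c ` U)) c g"
    using atlasD(3)[OF U] homeomorphic_map_maps by blast
  \<comment> \<open>Continuity is known for the inverse \<open>g\<close> supplied by the
    homeomorphism; it passes to \<open>inv_into U c\<close> because the two agree on the image of
    the chart.\<close>
  have geq: "g y = inv_into U c y" if "y \<in> c ` U" for y
    using that g UM chart_inj[OF U] by (auto simp: homeomorphic_maps_def)
  have "continuous_map (top_of_set (c ` U)) (mtop M) g"
    using g continuous_map_into_fulltopology unfolding homeomorphic_maps_def by blast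
  moreover have "continuous_map (top_of_set W) (top_of_set (c ` U)) q"
    using q smooth_in_continuous by (auto simp: continuous_map_iff_continuous)
  ultimately have "continuous_map (top_of_set W) (mtop M) (g \<circ> q)"
    by (rule continuous_map_compose[rotated])
  then show cont: "continuous_map (top_of_set W) (mtop M) (\<lambda>x. inv_into U c (q x))"
    by (rule continuous_map_eq) (use geq q(2) in auto)
  fix C assume C: "C \<in> atlas M"
  obtain U' c' where C': "C = (U', c')" by (cases C)
  let ?V = "{x \<in> W. inv_into U c (q x) \<in> U'}"
  have "openin (top_of_set W) {x \<in> topspace (top_of_set W). inv_into U c (q x) \<in> U'}"
    using openin_continuous_map_preimage[OF cont] atlasD(1) C C' by blast
  then have V: "open ?V" using W by (simp add: openin_open_eq)
  have "q ` ?V \<subseteq> c ` (U \<inter> U')"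
  proof
    fix y assume "y \<in> q ` ?V"
    then obtain x where x: "x \<in> W" "y = q x" "inv_into U c (q x) \<in> U'" by auto
    then obtain u where "u \<in> U" "q x = c u" using q(2) by blast
    then show "y \<in> c ` (U \<inter> U')" using x chart_inj[OF U] by auto
  qed
  then have "smooth_in ?V (\<lambda>x. (c' \<circ> inv_into U c) (q x))"
    using smooth_on_compose[OF transition[OF U] smooth_in_subset[OF q(1) V]] C C' by blast
  then show "case C of (U', c') \<Rightarrow> smooth_in {x \<in> W. inv_into U c (q x) \<in> U'} (\<lambda>x. c' (inv_into U c (q x)))"
    by (simp add: C')
qed

lemma chart_dom_open:
  assumes "(U, c) \<in> atlas M" shows "open {y. mproj M y \<in> c ` U}"
proof -
  obtain T where T: "open T" "c ` U = model M \<inter> T"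
    using atlasD(2)[OF assms] by (auto simp: openin_open)
  have "{y. mproj M y \<in> c ` U} = mproj M -` T" using T mproj(2) by auto
  moreover have "open (mproj M -` T)"
    by (rule open_vimage[OF T(1)]) (simp add: linear_continuous_on mproj(1) linear_conv_bounded_linear[symmetric])
  ultimately show ?thesis by simp
qed

lemma chart_dom_plot:
  assumes U: "(U, c) \<in> atlas M"
  shows "plot M {y. mproj M y \<in> c ` U} (\<lambda>y. inv_into U c (mproj M y))"
  by (rule chart_plot[OF U smooth_in_linear[OF chart_dom_open[OF U] mproj(1)]]) auto

lemma mparam_plot: "q \<in> topspace (mtop M) \<Longrightarrow> plot M (mdom M q) (mparam M q)"
  using chart_dom_plot[OF chart_at(1)] by (simp add: mdom_def mparam_def[abs_def] chart_inv_def chart_map_def)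

lemma mparam_chart:
  assumes "q \<in> topspace (mtop M)" "x \<in> fst (chart_at M q)"
  shows "chart_map M q x \<in> mdom M q" "mparam M q (chart_map M q x) = x"
  using chart_in_model[OF assms] chart_inv_chart[OF assms] assms(2)
  by (auto simp: mdom_def mparam_def mproj(3))

lemma mparam_base:
  assumes "q \<in> topspace (mtop M)"
  shows "chart_map M q q \<in> mdom M q" "mparam M q (chart_map M q q) = q"
  using mparam_chart[OF assms chart_at(2)[OF assms]] by auto

lemma mparam_eq: "y \<in> model M \<Longrightarrow> mparam M q y = chart_inv M q y"
  by (simp add: mparam_def mproj(3))

lemma plot_chart_smooth:
  assumes p: "plot M W p" and q: "q \<in> topspace (mtop M)"
  shows "smooth_in {y \<in> W. p y \<in> fst (chart_at M q)} (\<lambda>y. chart_map M q (p y))"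
  using p chart_at(1)[OF q] by (auto simp: plot_def)

lemma velocity_has_derivative:
  assumes p: "plot M W p" and x: "x \<in> W"
  shows "((\<lambda>y. chart_map M (p x) (p y)) has_derivative velocity M p x) (at x)"
proof -
  have q: "p x \<in> topspace (mtop M)" using plot_in p x .
  show ?thesis unfolding velocity_def
    by (rule smooth_in_has_derivative[OF plot_chart_smooth[OF p q]]) (use x chart_at(2)[OF q] in auto)
qed

lemma linear_velocity: "plot M W p \<Longrightarrow> x \<in> W \<Longrightarrow> linear (velocity M p x)"
  using velocity_has_derivative has_derivative_linear by blast

text \<open>Near \<open>x\<close> the coordinate expression lies in \<open>model M\<close>, so it
  equals its own projection, and a linear projection passes through the derivative.\<close>

lemma velocity_in_model:
  assumes p: "plot M W p" and x: "x \<in> W"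
  shows "velocity M p x a \<in> model M"
proof -
  have q: "p x \<in> topspace (mtop M)" using plot_in p x .
  let ?V = "{y \<in> W. p y \<in> fst (chart_at M (p x))}" and ?g = "\<lambda>y. chart_map M (p x) (p y)"
  have V: "open ?V" "x \<in> ?V"
    using smooth_in_open[OF plot_chart_smooth[OF p q]] x chart_at(2)[OF q] by auto
  have "fder ?g x = fder (\<lambda>y. mproj M (?g y)) x"
    by (rule fder_cong[OF V]) (auto simp: mproj(3) chart_in_model[OF q])
  also have "\<dots> = (\<lambda>a. mproj M (fder ?g x a))"
    by (intro ext fder_linear_compose[OF mproj(1)])
      (use velocity_has_derivative[OF p x] differentiableI in blast)
  finally have "velocity M p x a = mproj M (fder ?g x a)" unfolding velocity_def by metis
  then show ?thesis using mproj(2) by simp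
qed

text \<open>In the preferred chart \<open>mparam M q\<close> reads as \<open>mproj M\<close>, a
  linear map that is the identity on the model. So every tangent vector is the velocity of a plot
  and can be handled by the chain rule.\<close>

lemma velocity_mparam:
  assumes q: "q \<in> topspace (mtop M)" and u: "u \<in> model M"
  shows "velocity M (mparam M q) (chart_map M q q) u = u"
proof -
  note b = mparam_base[OF q]
  have eq: "chart_map M q (mparam M q y) = mproj M y" if "y \<in> mdom M q" for y
    using that by (auto simp: mdom_def mparam_def chart_inv_chart[OF q])
  have "velocity M (mparam M q) (chart_map M q q) = fder (mproj M) (chart_map M q q)"
    unfolding velocity_def b(2)
    by (rule fder_cong[OF plot_open[OF mparam_plot[OF q]] b(1) eq])
  also have "\<dots> = mproj M"
    by (rule fder_eqI) (simp add: bounded_linear_imp_has_derivative linear_conv_bounded_linear[symmetric] mproj(1))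
  finally show ?thesis using mproj(3)[OF u] by simp
qed

lemma plot_compose:
  assumes "manifold N" "smooth_map_on M N X f" "plot M W p" "p ` W \<subseteq> X"
  shows "plot N W (\<lambda>x. f (p x))"
  by (rule smooth_map_on_plot[OF _ chart_inj manifold.atlasD(1)[OF assms(1)] assms(2-4)])
    (simp add: atlas_cover)

text \<open>Converse of \<open>plot_compose\<close>. Plots with domain type \<open>'e\<close>
  suffice as tests, since inverse charts precomposed with \<open>mproj M\<close> are among them.
  Smoothness of group-theoretic expressions becomes a matter of combining plots.\<close>

lemma smooth_map_onI:
  assumes N: "\<And>U c. (U, c) \<in> atlas N \<Longrightarrow> openin (mtop N) U" and X: "openin (mtop M) X"
    and f: "\<And>W (p :: 'e \<Rightarrow> 'a). plot M W p \<Longrightarrow> p ` W \<subseteq> X \<Longrightarrow> plot N W (\<lambda>x. f (p x))"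
  shows "smooth_map_on M N X f"
proof -
  have D: "plot N {y. mproj M y \<in> c ` (U \<inter> X)} (\<lambda>y. f (inv_into U c (mproj M y)))"
    "plot M {y. mproj M y \<in> c ` (U \<inter> X)} (\<lambda>y. inv_into U c (mproj M y))" if U: "(U, c) \<in> atlas M" for U c
  proof -
    note D = chart_dom_plot[OF U]
    have eq: "{y. mproj M y \<in> c ` (U \<inter> X)} = {y \<in> {y. mproj M y \<in> c ` U}. inv_into U c (mproj M y) \<in> X}"
      using chart_inj[OF U] by (auto simp: image_iff)
    have op: "open {y. mproj M y \<in> c ` (U \<inter> X)}"
      unfolding eq by (rule plot_vimage_open[OF D X])
    show *: "plot M {y. mproj M y \<in> c ` (U \<inter> X)} (\<lambda>y. inv_into U c (mproj M y))"
      by (rule plot_subset[OF D op]) auto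
    show "plot N {y. mproj M y \<in> c ` (U \<inter> X)} (\<lambda>y. f (inv_into U c (mproj M y)))"
      by (rule f[OF *]) (use chart_inj[OF U] in auto)
  qed
  have inM: "c x \<in> model M" if "(U, c) \<in> atlas M" "x \<in> U" for U c x
    using atlasD(2)[OF that(1)] openin_subset that(2) by fastforce
  show ?thesis unfolding smooth_map_on_def
  proof (intro conjI ballI)
    have XM: "X \<subseteq> topspace (mtop M)" using X openin_subset by blast
    show "continuous_map (subtopology (mtop M) X) (mtop N) f"
      unfolding continuous_map_def
    proof (intro conjI allI impI)
      have fx: "f x \<in> topspace (mtop N)" if x: "x \<in> X" for x
      proof -
        obtain U c where U: "(U, c) \<in> atlas M" "x \<in> U" using x XM atlas_cover by fastforce
        have "f (inv_into U c (mproj M (c x))) \<in> topspace (mtop N)"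
          by (rule plot_in[OF D(1)[OF U(1)]]) (use U x inM in \<open>auto simp: mproj(3)\<close>)
        then show ?thesis using inM[OF U] chart_inj[OF U(1)] U(2) by (simp add: mproj(3))
      qed
      then show "f \<in> topspace (subtopology (mtop M) X) \<rightarrow> topspace (mtop N)" by auto
      fix V assume V: "openin (mtop N) V"
      have "openin (mtop M) {x \<in> X. f x \<in> V}"
      proof (subst openin_subopen, intro ballI)
        fix x assume x: "x \<in> {x \<in> X. f x \<in> V}"
        then obtain U c where U: "(U, c) \<in> atlas M" "x \<in> U" using XM atlas_cover by fastforce
        let ?B = "{y \<in> {y. mproj M y \<in> c ` (U \<inter> X)}. f (inv_into U c (mproj M y)) \<in> V}"
        have B: "open ?B" by (rule plot_vimage_open[OF D(1)[OF U(1)] V])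
        have UM: "U \<subseteq> topspace (mtop M)" using atlasD(1)[OF U(1)] openin_subset by blast
        have "continuous_map (subtopology (mtop M) U) euclidean c"
          using homeomorphic_imp_continuous_map[OF atlasD(3)[OF U(1)]] continuous_map_into_fulltopology by blast
        then have "openin (subtopology (mtop M) U) {z \<in> topspace (subtopology (mtop M) U). c z \<in> ?B}"
          by (rule openin_continuous_map_preimage) (use B in simp)
        moreover have "{z \<in> topspace (subtopology (mtop M) U). c z \<in> ?B} = {z \<in> U. z \<in> X \<and> f z \<in> V}"
          using UM inM[OF U(1)] by (auto simp: mproj(3) inv_into_f_f[OF chart_inj[OF U(1)]] dest: inj_onD[OF chart_inj[OF U(1)]])
        ultimately have "openin (mtop M) {z \<in> U. z \<in> X \<and> f z \<in> V}"
          using atlasD(1)[OF U(1)] by (simp add: openin_trans_full)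
        then show "\<exists>T. openin (mtop M) T \<and> x \<in> T \<and> T \<subseteq> {x \<in> X. f x \<in> V}"
          using x U by (intro exI[of _ "{z \<in> U. z \<in> X \<and> f z \<in> V}"]) auto
      qed
      then show "openin (subtopology (mtop M) X) {x \<in> topspace (subtopology (mtop M) X). f x \<in> V}"
        using XM X by (simp add: openin_open_subtopology inf_absorb2 Collect_conj_eq)
    qed
    have "smooth_on (c ` {p \<in> U \<inter> X. f p \<in> U'}) (c' \<circ> f \<circ> inv_into U c)"
      if U: "(U, c) \<in> atlas M" and U': "(U', c') \<in> atlas N" for U c U' c'
    proof -
    \<comment> \<open>An extension to an open set is wanted; inserting \<open>mproj M\<close>
      extends the coordinate expression off the model subspace.\<close>
    let ?W = "{y \<in> {y. mproj M y \<in> c ` (U \<inter> X)}. f (inv_into U c (mproj M y)) \<in> U'}"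
    have sm: "smooth_in ?W (\<lambda>y. c' (f (inv_into U c (mproj M y))))"
      using D(1)[OF U] U' by (auto simp: plot_def)
    show ?thesis
      unfolding smooth_on_def
    proof (intro ballI exI conjI)
      fix x assume x: "x \<in> c ` {p \<in> U \<inter> X. f p \<in> U'}"
      then show "x \<in> ?W" using inM[OF U] chart_inj[OF U] by (auto simp: mproj(3))
      show "open ?W" by (rule smooth_in_open[OF sm])
      show "\<forall>k. Ck_on k (\<lambda>y. c' (f (inv_into U c (mproj M y)))) ?W" using sm by (simp add: smooth_in_def)
      fix y assume "y \<in> ?W \<inter> c ` {p \<in> U \<inter> X. f p \<in> U'}"
      then show "c' (f (inv_into U c (mproj M y))) = (c' \<circ> f \<circ> inv_into U c) y"
        using inM[OF U] by (auto simp: mproj(3))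
    qed
    qed
    then show "case C of (U, c) \<Rightarrow> \<forall>(U', c')\<in>atlas N.
        smooth_on (c ` {p \<in> U \<inter> X. f p \<in> U'}) (c' \<circ> f \<circ> inv_into U c)" if "C \<in> atlas M" for C
      using that by auto
  qed
qed

text \<open>On the model the coordinate expression agrees with that of the plot
  \<open>f (mparam M q y)\<close>, which is differentiable on an open set. This ensures that
  \<open>mderiv\<close> is a true derivative and not an arbitrary value of
  \<open>frechet_derivative\<close>.\<close>

lemma chart_rep_differentiable:
  assumes N: "manifold N" and X: "openin (mtop M) X" and f: "smooth_map_on M N X f" and q: "q \<in> X"
  shows "(chart_map N (f q) \<circ> f \<circ> chart_inv M q) differentiable (at (chart_map M q q) within model M)"
proof -
  interpret N: manifold N by (rule N)
  have qM: "q \<in> topspace (mtop M)" using X q openin_subset by blast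
  let ?D = "{y \<in> mdom M q. mparam M q y \<in> X}" and ?e = "chart_map M q q"
  have D: "plot M ?D (mparam M q)"
    by (rule plot_subset[OF mparam_plot[OF qM] plot_vimage_open[OF mparam_plot[OF qM] X]]) auto
  have P: "plot N ?D (\<lambda>y. f (mparam M q y))"
    by (rule plot_compose[OF N f D]) auto
  have e: "?e \<in> ?D" "mparam M q ?e = q" using mparam_base[OF qM] q by auto
  have "((\<lambda>y. chart_map N (f (mparam M q ?e)) (f (mparam M q y)))
      has_derivative velocity N (\<lambda>y. f (mparam M q y)) ?e) (at ?e within model M)"
    by (rule has_derivative_at_withinI[OF N.velocity_has_derivative[OF P e(1)]])
  then have "((chart_map N (f q) \<circ> f \<circ> chart_inv M q)
      has_derivative velocity N (\<lambda>y. f (mparam M q y)) ?e) (at ?e within model M)"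
    unfolding e(2)
    by (rule has_derivative_transform[rotated 2]) (use chart_in_model[OF qM chart_at(2)[OF qM]] in \<open>auto simp: mparam_eq\<close>)
  then show ?thesis by (rule differentiableI)
qed

text \<open>The target chart on both sides is the one preferred at \<open>f (p x)\<close>, and the
  source chart cancels against its inverse, so the chain rule holds without any transition
  map.\<close>

lemma velocity_compose:
  assumes N: "manifold N" and X: "openin (mtop M) X" and f: "smooth_map_on M N X f"
    and p: "plot M W p" and x: "x \<in> W" "p x \<in> X"
  shows "velocity N (\<lambda>y. f (p y)) x a = mderiv M N f (p x) (velocity M p x a)"
proof -
  let ?q = "p x"
  have q: "?q \<in> topspace (mtop M)" using plot_in[OF p x(1)] .
  let ?c = "chart_map M ?q" and ?g = "chart_map N (f ?q) \<circ> f \<circ> chart_inv M ?q"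
  let ?V = "{y \<in> W. p y \<in> fst (chart_at M ?q)}"
  have V: "open ?V" "x \<in> ?V"
    using smooth_in_open[OF plot_chart_smooth[OF p q]] x chart_at(2)[OF q] by auto
  have g: "(?g has_derivative mderiv M N f ?q) (at (?c (p x)) within model M)"
    using chart_rep_differentiable[OF N X f x(2)] by (simp add: mderiv_def frechet_derivative_works)
  have "((\<lambda>y. ?g (?c (p y))) has_derivative (\<lambda>a. mderiv M N f ?q (velocity M p x a))) (at x within ?V)"
    by (rule has_derivative_in_compose[OF has_derivative_at_withinI[OF velocity_has_derivative[OF p x(1)]]])
      (rule has_derivative_subset[OF g], auto intro: chart_in_model[OF q])
  then have "((\<lambda>y. ?g (?c (p y))) has_derivative (\<lambda>a. mderiv M N f ?q (velocity M p x a))) (at x)"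
    unfolding at_within_open[OF V(2) V(1)] .
  then have "((\<lambda>y. chart_map N (f ?q) (f (p y))) has_derivative (\<lambda>a. mderiv M N f ?q (velocity M p x a))) (at x)"
    by (rule has_derivative_transform_within_open[OF _ V]) (auto simp: chart_inv_chart[OF q])
  then show ?thesis unfolding velocity_def by (simp add: fder_eqI)
qed

lemma linear_mderiv:
  assumes "manifold N" "openin (mtop M) X" "smooth_map_on M N X f" "q \<in> X"
  shows "linear (mderiv M N f q)"
  using chart_rep_differentiable[OF assms] by (simp add: mderiv_def linear_frechet_derivative)

lemma mderiv_velocity:
  assumes N: "manifold N" and X: "openin (mtop M) X" and f: "smooth_map_on M N X f"
    and q: "q \<in> X" and u: "u \<in> model M"
  shows "mderiv M N f q u = velocity N (\<lambda>y. f (mparam M q y)) (chart_map M q q) u"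
proof -
  have qM: "q \<in> topspace (mtop M)" using X q openin_subset by blast
  show ?thesis
    using velocity_compose[OF N X f mparam_plot[OF qM] mparam_base(1)[OF qM], of u] q
    by (simp add: mparam_base[OF qM] velocity_mparam[OF qM u])
qed

lemma mderiv_in_model:
  assumes N: "manifold N" and X: "openin (mtop M) X" and f: "smooth_map_on M N X f"
    and q: "q \<in> X" and u: "u \<in> model M"
  shows "mderiv M N f q u \<in> model N"
proof -
  have qM: "q \<in> topspace (mtop M)" using X q openin_subset by blast
  let ?D = "{y \<in> mdom M q. mparam M q y \<in> X}"
  have D: "plot M ?D (mparam M q)"
    by (rule plot_subset[OF mparam_plot[OF qM] plot_vimage_open[OF mparam_plot[OF qM] X]]) auto
  have P: "plot N ?D (\<lambda>y. f (mparam M q y))"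
    by (rule plot_compose[OF N f D]) auto
  show ?thesis unfolding mderiv_velocity[OF assms]
    by (rule manifold.velocity_in_model[OF N P]) (use mparam_base[OF qM] q in auto)
qed

lemma plot_const:
  assumes "q \<in> topspace (mtop M)" "open W"
  shows "plot M W (\<lambda>x. q)"
proof -
  have "plot M W (\<lambda>x. chart_inv M q (chart_map M q q))"
    unfolding chart_inv_def chart_map_def
    by (rule chart_plot[OF _ smooth_in_const[OF assms(2)]])
      (use chart_at[OF assms(1)] in \<open>auto simp: chart_map_def\<close>)
  then show ?thesis by (simp add: chart_inv_chart[OF assms(1) chart_at(2)[OF assms(1)]])
qed

end

lemma velocity_cong:
  assumes "open V" "x \<in> V" "\<And>y. y \<in> V \<Longrightarrow> p y = q y"
  shows "velocity M p x = velocity M q x"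
  unfolding velocity_def assms(3)[OF assms(2)]
  by (rule fder_cong[OF assms(1,2)]) (simp add: assms(3))

lemma velocity_const: "velocity M (\<lambda>y. q) x = (\<lambda>a. 0)"
  by (simp add: velocity_def)

lemma manifold_eucl: "manifold (eucl :: ('f::euclidean_space, 'f) mfd)"
proof
  have "smooth_on UNIV (\<lambda>x::'f. x)"
    unfolding smooth_on_def using Ck_on_linear[OF bounded_linear_ident] by blast
  moreover have "second_countable (euclidean :: 'f topology)"
  proof -
    obtain B :: "'f set set" where B: "countable B" "topological_basis B"
      using ex_countable_basis by blast
    show ?thesis unfolding second_countable_def
    proof (intro exI conjI ballI allI impI)
      show "countable B" by (rule B)
      show "openin euclidean V" if "V \<in> B" for V using that B(2) by (simp add: topological_basis_open)
      show "\<exists>V\<in>B. x \<in> V \<and> V \<subseteq> U" if "openin euclidean U \<and> x \<in> U" for U x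
        using that topological_basisE[OF B(2)] by (metis open_openin)
    qed
  qed
  moreover have "homeomorphic_map euclidean euclidean (\<lambda>x::'f. x)"
    using homeomorphic_map_id[of "euclidean :: 'f topology" euclidean] by (simp only: id_def)
  moreover have "inv_into UNIV (\<lambda>x::'f. x) = (\<lambda>x. x)" using inv_id by (simp add: id_def)
  ultimately show "smooth_manifold (eucl :: ('f, 'f) mfd)"
    unfolding smooth_manifold_def eucl_def
    by (auto simp: o_def)
qed

section \<open>Lie groups and the adjoint representation\<close>

lemma fder_fst:
  assumes "F differentiable (at (x, y))"
  shows "fder (\<lambda>x. F (x, y)) x u = fder F (x, y) (u, 0)"
proof -
  have "((\<lambda>x. (x, y)) has_derivative (\<lambda>u. (u, 0))) (at x)"
    by (auto intro!: derivative_eq_intros)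
  from has_derivative_compose[OF this fder_works[OF assms]] show ?thesis
    by (simp add: fder_eqI)
qed

lemma fder_snd:
  assumes "F differentiable (at (x, y))"
  shows "fder (\<lambda>y. F (x, y)) y u = fder F (x, y) (0, u)"
proof -
  have "((\<lambda>y. (x, y)) has_derivative (\<lambda>u. (0, u))) (at y)"
    by (auto intro!: derivative_eq_intros)
  from has_derivative_compose[OF this fder_works[OF assms]] show ?thesis
    by (simp add: fder_eqI)
qed

lemma smooth_in_slice:
  assumes "smooth_in Z F" "open W" "\<And>x. x \<in> W \<Longrightarrow> (x, y) \<in> Z"
  shows "smooth_in W (\<lambda>x. fder F (x, y) v)"
proof -
  have "smooth_in W (\<lambda>x. (x, y))"
    by (intro smooth_in_Pair smooth_in_const smooth_in_linear[OF _ linear_ident] assms(2))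
  then show ?thesis
    by (rule smooth_in_compose[OF _ smooth_in_fder[OF assms(1)]]) (use assms(3) in auto)
qed

text \<open>Product rule for a moving operator applied to a moving vector. Differentiability of
  \<open>A\<close> is asked on fixed vectors only, because a basis expansion reduces the claim to
  products of scalars and vectors.\<close>

lemma fder_family_apply:
  fixes A :: "'d::euclidean_space \<Rightarrow> 'b::euclidean_space \<Rightarrow> 'c::euclidean_space"
  assumes W: "open W" "x \<in> W" and lin: "\<And>y. y \<in> W \<Longrightarrow> linear (A y)"
    and A: "\<And>b. (\<lambda>y. A y b) differentiable (at x)" and a: "a differentiable (at x)"
  shows "fder (\<lambda>y. A y (a y)) x v = A x (fder a x v) + fder (\<lambda>y. A y (a x)) x v"
proof -
  have *: "fder (\<lambda>y. A y (c y)) x v =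
      (\<Sum>b\<in>Basis. (c x \<bullet> b) *\<^sub>R fder (\<lambda>y. A y b) x v + (fder c x v \<bullet> b) *\<^sub>R A x b)"
    if c: "c differentiable (at x)" for c
  proof -
    have "fder (\<lambda>y. A y (c y)) x = fder (\<lambda>y. \<Sum>b\<in>Basis. (c y \<bullet> b) *\<^sub>R A y b) x"
      by (rule fder_cong[OF W linear_basis_expand[OF lin]])
    also have "\<dots> = (\<lambda>v. \<Sum>b\<in>Basis. (c x \<bullet> b) *\<^sub>R fder (\<lambda>y. A y b) x v + (fder c x v \<bullet> b) *\<^sub>R A x b)"
      by (intro fder_eqI has_derivative_sum has_derivative_scaleR has_derivative_inner_left
          fder_works A c)
    finally show ?thesis by simp
  qed
  have "A x (fder a x v) = (\<Sum>b\<in>Basis. (fder a x v \<bullet> b) *\<^sub>R A x b)"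
    by (rule linear_basis_expand[OF lin[OF W(2)]])
  moreover have "fder (\<lambda>y. A y (a x)) x v = (\<Sum>b\<in>Basis. (a x \<bullet> b) *\<^sub>R fder (\<lambda>y. A y b) x v)"
    using *[of "\<lambda>y. a x"] by simp
  ultimately show ?thesis by (simp only: *[OF a] sum.distrib add.commute)
qed

section \<open>Lie groups and left-invariant fields\<close>

locale lie_grp = group G for G :: "'g monoid" (structure) +
  fixes M :: "('g, 'e::euclidean_space) mfd"
  assumes lie_group: "lie_group G M"
begin

sublocale manifold M
  using lie_group by unfold_locales (simp add: lie_group_def)

lemma topspace_M: "topspace (mtop M) = carrier G"
  using lie_group by (simp add: lie_group_def)

lemma openin_carrier: "openin (mtop M) (carrier G)"
  using openin_topspace[of "mtop M"] by (simp add: topspace_M)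

lemma plot_mult:
  assumes "plot M W p" "plot M W q" shows "plot M W (\<lambda>x. p x \<otimes> q x)"
proof -
  have "plot M W (\<lambda>x. (\<lambda>(x, y). x \<otimes> y) (p x, q x))"
  proof (rule smooth_map_on_plot[where M = "prod_mfd M M" and X = "topspace (mtop (prod_mfd M M))"])
    show "smooth_map (prod_mfd M M) M (\<lambda>(x, y). x \<otimes> y)"
      using lie_group by (simp add: lie_group_def)
    show "plot (prod_mfd M M) W (\<lambda>x. (p x, q x))" by (rule plot_Pair[OF assms])
    then show "(\<lambda>x. (p x, q x)) ` W \<subseteq> topspace (mtop (prod_mfd M M))" using plot_in by blast
    show "openin (mtop M) U" if "(U, c) \<in> atlas M" for U c using atlasD(1)[OF that] .
    show "inj_on c U" if C: "(U, c) \<in> atlas (prod_mfd M M)" for U c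
    proof -
      obtain U1 c1 U2 c2 where "U = U1 \<times> U2" "c = (\<lambda>(p, q). (c1 p, c2 q))"
        "(U1, c1) \<in> atlas M" "(U2, c2) \<in> atlas M" using C by (auto simp: prod_mfd_def)
      then show ?thesis
        using chart_inj by (auto simp: inj_on_def)
    qed
    show "topspace (mtop (prod_mfd M M)) \<subseteq> (\<Union>(U, c)\<in>atlas (prod_mfd M M). U)"
    proof
      fix z assume z: "z \<in> topspace (mtop (prod_mfd M M))"
      obtain x y where [simp]: "z = (x, y)" by (cases z)
      have xy: "x \<in> topspace (mtop M)" "y \<in> topspace (mtop M)" using z by (auto simp: prod_mfd_def)
      have "(fst (chart_at M x) \<times> fst (chart_at M y), \<lambda>(p, q). (chart_map M x p, chart_map M y q))
          \<in> atlas (prod_mfd M M)"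
        using chart_at(1)[OF xy(1)] chart_at(1)[OF xy(2)] unfolding prod_mfd_def by auto
      then show "z \<in> (\<Union>(U, c)\<in>atlas (prod_mfd M M). U)"
        by (rule UN_I) (simp add: chart_at(2)[OF xy(1)] chart_at(2)[OF xy(2)])
    qed
  qed
  then show ?thesis by simp
qed

lemma plot_inv:
  assumes "plot M W p" shows "plot M W (\<lambda>x. inv (p x))"
  by (rule plot_compose[OF manifold_axioms _ assms, of "topspace (mtop M)"])
    (use lie_group plot_in[OF assms] in \<open>auto simp: lie_group_def\<close>)

lemma plot_carrier: "plot M W p \<Longrightarrow> x \<in> W \<Longrightarrow> p x \<in> carrier G"
  using plot_in topspace_M by blast

lemma smooth_map_group:
  assumes "\<And>W (p :: 'e \<Rightarrow> 'g). plot M W p \<Longrightarrow> plot M W (\<lambda>x. f (p x))"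
  shows "smooth_map_on M M (carrier G) f"
  by (rule smooth_map_onI[OF atlasD(1) openin_carrier assms])

lemma smooth_left_mult: "g \<in> carrier G \<Longrightarrow> smooth_map_on M M (carrier G) (\<lambda>x. g \<otimes> x)"
  by (rule smooth_map_group) (intro plot_mult plot_const, auto simp: topspace_M plot_open)

lemma smooth_right_mult: "g \<in> carrier G \<Longrightarrow> smooth_map_on M M (carrier G) (\<lambda>x. x \<otimes> g)"
  by (rule smooth_map_group) (intro plot_mult plot_const, auto simp: topspace_M plot_open)

lemma smooth_conj: "g \<in> carrier G \<Longrightarrow> smooth_map_on M M (carrier G) (\<lambda>x. g \<otimes> x \<otimes> inv g)"
  by (rule smooth_map_group) (intro plot_mult plot_const, auto simp: topspace_M plot_open)

text \<open>A fixed parametrisation of a neighbourhood of the unit, standing in for the exponential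
  map: by \<open>velocity_\<sigma>\<close> its velocity at \<open>base\<close> in a direction
  \<open>u\<close> of the model is \<open>u\<close> itself.\<close>

definition "\<sigma> = mparam M \<one>"
definition "base = chart_map M \<one> \<one>"
definition "dom0 = mdom M \<one>"

lemma one_topspace: "\<one> \<in> topspace (mtop M)"
  by (simp add: topspace_M)

lemma \<sigma>_plot: "plot M dom0 \<sigma>"
  using mparam_plot[OF one_topspace] by (simp add: \<sigma>_def dom0_def)

lemma base: "base \<in> dom0" "\<sigma> base = \<one>"
  using mparam_base[OF one_topspace] by (simp_all add: \<sigma>_def dom0_def base_def)

lemma \<sigma>_carrier: "y \<in> dom0 \<Longrightarrow> \<sigma> y \<in> carrier G"
  using plot_carrier[OF \<sigma>_plot] .

lemma open_dom0: "open dom0"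
  using plot_open[OF \<sigma>_plot] .

lemma velocity_\<sigma>: "u \<in> model M \<Longrightarrow> velocity M \<sigma> base u = u"
  using velocity_mparam[OF one_topspace] by (simp add: \<sigma>_def base_def)

lemma plot_left_mult: "g \<in> carrier G \<Longrightarrow> plot M W q \<Longrightarrow> plot M W (\<lambda>y. g \<otimes> q y)"
  by (intro plot_mult plot_const) (auto simp: topspace_M plot_open)

lemma plot_right_mult: "g \<in> carrier G \<Longrightarrow> plot M W q \<Longrightarrow> plot M W (\<lambda>y. q y \<otimes> g)"
  by (intro plot_mult plot_const) (auto simp: topspace_M plot_open)

lemma smooth_plot:
  "smooth_map_on M (eucl :: ('f::euclidean_space, 'f) mfd) X f \<Longrightarrow> plot M W p \<Longrightarrow> p ` W \<subseteq> X \<Longrightarrow>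
    smooth_in W (\<lambda>x. f (p x))"
  using plot_compose[OF manifold_eucl] plot_eucl by blast

lemma smooth_euclI:
  fixes f :: "'g \<Rightarrow> 'f::euclidean_space"
  assumes "openin (mtop M) X"
    "\<And>W (p :: 'e \<Rightarrow> 'g). plot M W p \<Longrightarrow> p ` W \<subseteq> X \<Longrightarrow> smooth_in W (\<lambda>x. f (p x))"
  shows "smooth_map_on M eucl X f"
  by (rule smooth_map_onI[OF manifold.atlasD(1)[OF manifold_eucl] assms(1)])
    (use assms(2) in \<open>simp_all add: plot_eucl\<close>)

lemma velocity_left_mult:
  assumes g: "g \<in> carrier G" and q: "plot M V q" "y \<in> V" "q y = \<one>"
  shows "velocity M (\<lambda>y. g \<otimes> q y) y a = left_field G M (velocity M q y a) g"
  using velocity_compose[OF manifold_axioms openin_carrier smooth_left_mult[OF g] q(1,2), of a] q(3)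
  by (simp add: left_field_def)

lemma linear_left_field: "g \<in> carrier G \<Longrightarrow> linear (\<lambda>u. left_field G M u g)"
  unfolding left_field_def
  using linear_mderiv[OF manifold_axioms openin_carrier smooth_left_mult one_closed] by simp

lemma left_field_\<sigma>:
  assumes g: "g \<in> carrier G" and u: "u \<in> model M"
  shows "left_field G M u g = velocity M (\<lambda>y. g \<otimes> \<sigma> y) base u"
  using velocity_left_mult[OF g \<sigma>_plot base] velocity_\<sigma>[OF u] by simp

text \<open>Any plot through the unit computes a left derivative, because only its velocity there
  enters. The plot \<open>\<sigma>\<close> is the standard choice; subgroups and logarithmic
  derivatives call for others.\<close>

lemma left_deriv_plot:
  fixes f :: "'g \<Rightarrow> 'f::euclidean_space"
  assumes X: "openin (mtop M) X" and f: "smooth_map_on M eucl X f" and g: "g \<in> X"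
    and q: "plot M V q" "y \<in> V" "q y = \<one>"
  shows "fder (\<lambda>y. f (g \<otimes> q y)) y a = left_deriv G M (velocity M q y a) f g"
proof -
  have gc: "g \<in> carrier G" using X g openin_subset topspace_M by blast
  show ?thesis
    using velocity_compose[OF manifold_eucl X f plot_left_mult[OF gc q(1)] q(2), of a] g q(3) gc
    by (simp add: velocity_left_mult[OF gc q] left_deriv_def)
qed

lemma left_deriv_\<sigma>:
  fixes f :: "'g \<Rightarrow> 'f::euclidean_space"
  assumes "openin (mtop M) X" "smooth_map_on M eucl X f" "g \<in> X" "u \<in> model M"
  shows "left_deriv G M u f g = fder (\<lambda>y. f (g \<otimes> \<sigma> y)) base u"
  using left_deriv_plot[OF assms(1-3) \<sigma>_plot base] velocity_\<sigma>[OF assms(4)] by simp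

text \<open>The value depends on \<open>q\<close> only through its velocity at the unit, so a
  conjugated plot may be exchanged for \<open>\<sigma>\<close> with an adjusted direction. This is
  how \<open>Ad\<close> enters \<open>commutator_Ad\<close>.\<close>

lemma right_deriv_plot:
  fixes f :: "'g \<Rightarrow> 'f::euclidean_space"
  assumes X: "openin (mtop M) X" and f: "smooth_map_on M eucl X f" and g: "g \<in> X"
    and q: "plot M V q" "y \<in> V" "q y = \<one>"
  shows "fder (\<lambda>y. f (q y \<otimes> g)) y a =
    mderiv M eucl f g (mderiv M M (\<lambda>x. x \<otimes> g) \<one> (velocity M q y a))"
proof -
  have gc: "g \<in> carrier G" using X g openin_subset topspace_M by blast
  have "velocity M (\<lambda>y. q y \<otimes> g) y a = mderiv M M (\<lambda>x. x \<otimes> g) \<one> (velocity M q y a)"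
    using velocity_compose[OF manifold_axioms openin_carrier smooth_right_mult[OF gc] q(1,2), of a] q(3)
    by simp
  then show ?thesis
    using velocity_compose[OF manifold_eucl X f plot_right_mult[OF gc q(1)] q(2), of a] g q(3) gc
    by simp
qed

lemma plot_mult_prod:
  assumes "plot M W p" "plot M V q"
  shows "plot M (W \<times> V) (\<lambda>z. p (fst z) \<otimes> q (snd z))"
proof (rule plot_mult)
  have op: "open (W \<times> V)" by (intro open_Times plot_open[OF assms(1)] plot_open[OF assms(2)])
  show "plot M (W \<times> V) (\<lambda>z. p (fst z))"
    by (rule plot_reparam[OF assms(1) smooth_in_linear[OF op linear_fst]]) auto
  show "plot M (W \<times> V) (\<lambda>z. q (snd z))"
    by (rule plot_reparam[OF assms(2) smooth_in_linear[OF op linear_snd]]) auto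
qed

text \<open>The function \<open>f (p x \<otimes> \<sigma> y)\<close> is jointly smooth; the left
  derivative is its partial derivative in \<open>y\<close> at \<open>base\<close>, hence smooth in
  \<open>x\<close>.\<close>

lemma smooth_left_deriv:
  fixes f :: "'g \<Rightarrow> 'f::euclidean_space"
  assumes X: "openin (mtop M) X" and f: "smooth_map_on M eucl X f" and u: "u \<in> model M"
  shows "smooth_map_on M eucl X (left_deriv G M u f)"
proof (rule smooth_euclI[OF X])
  fix W and p :: "'e \<Rightarrow> 'g" assume p: "plot M W p" "p ` W \<subseteq> X"
  let ?r = "\<lambda>z. p (fst z) \<otimes> \<sigma> (snd z)"
  define Z where "Z = {z \<in> W \<times> dom0. ?r z \<in> X}"
  have r: "plot M Z ?r"
    unfolding Z_def by (rule plot_subset[OF plot_mult_prod[OF p(1) \<sigma>_plot]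
          plot_vimage_open[OF plot_mult_prod[OF p(1) \<sigma>_plot] X]]) auto
  have F: "smooth_in Z (\<lambda>z. f (?r z))"
    by (rule smooth_plot[OF f r]) (auto simp: Z_def)
  have Z: "(x, base) \<in> Z" if "x \<in> W" for x
    using that p base plot_carrier[OF p(1)] by (auto simp: Z_def)
  have "left_deriv G M u f (p x) = fder (\<lambda>z. f (?r z)) (x, base) (0, u)" if x: "x \<in> W" for x
  proof -
    have "left_deriv G M u f (p x) = fder (\<lambda>y. f (p x \<otimes> \<sigma> y)) base u"
      by (rule left_deriv_\<sigma>[OF X f _ u]) (use p x in auto)
    also have "\<dots> = fder (\<lambda>z. f (?r z)) (x, base) (0, u)"
      using fder_snd[OF smooth_in_differentiable[OF F Z[OF x]], of u] by simp
    finally show ?thesis .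
  qed
  then show "smooth_in W (\<lambda>x. left_deriv G M u f (p x))"
    using smooth_in_slice[OF F plot_open[OF p(1)] Z] smooth_in_cong[OF plot_open[OF p(1)]]
    by (metis (no_types, lifting))
qed

end

section \<open>The adjoint representation and the bracket\<close>

locale lie_grp_alg = lie_grp G M for G :: "'g monoid" (structure) and M :: "('g, 'e::euclidean_space) mfd" +
  fixes br :: "'v::euclidean_space \<Rightarrow> 'v \<Rightarrow> 'v" and \<phi> :: "'v \<Rightarrow> 'e"
  assumes has_lie_algebra: "has_lie_algebra G M br \<phi>"
begin

abbreviation Adj :: "'g \<Rightarrow> 'v \<Rightarrow> 'v" where "Adj \<equiv> Ad G M \<phi>"

lemma linear_\<phi>: "linear \<phi>"
  using has_lie_algebra by (simp add: has_lie_algebra_def)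

lemma inj_\<phi>: "inj \<phi>"
  using has_lie_algebra by (simp add: has_lie_algebra_def bij_betw_def)

lemma range_\<phi>: "range \<phi> = model M"
  using has_lie_algebra by (simp add: has_lie_algebra_def bij_betw_def)

lemma \<phi>_in [simp]: "\<phi> v \<in> model M"
  using range_\<phi> by blast

text \<open>A left inverse of \<open>\<phi>\<close> that is linear on the whole type; unlike the
  set-theoretic inverse in \<open>Ad\<close>, it can be moved through derivatives taken in
  \<open>'e\<close>.\<close>

definition "\<psi> = (SOME L. linear L \<and> L \<circ> \<phi> = id)"

lemma \<psi>: "linear \<psi>" "\<And>v. \<psi> (\<phi> v) = v" "\<And>u. u \<in> model M \<Longrightarrow> \<phi> (\<psi> u) = u"
proof -
  have "\<exists>L. linear L \<and> L \<circ> \<phi> = id"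
    by (rule linear_injective_left_inverse[OF linear_\<phi> inj_\<phi>])
  from someI_ex[OF this] show *: "linear \<psi>" "\<And>v. \<psi> (\<phi> v) = v"
    by (auto simp: \<psi>_def dest: fun_cong)
  show "\<phi> (\<psi> u) = u" if "u \<in> model M" for u
    using that *(2) range_\<phi> by (metis rangeE)
qed

lemma \<phi>_Ad:
  assumes "g \<in> carrier G"
  shows "\<phi> (Adj g v) = mderiv M M (\<lambda>x. g \<otimes> x \<otimes> inv g) \<one> (\<phi> v)"
proof -
  have "mderiv M M (\<lambda>x. g \<otimes> x \<otimes> inv g) \<one> (\<phi> v) \<in> model M"
    by (rule mderiv_in_model[OF manifold_axioms openin_carrier smooth_conj[OF assms]]) auto
  then show ?thesis
    unfolding Ad_def using f_the_inv_into_f[OF inj_\<phi>] range_\<phi> by blast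
qed

lemma Ad_eq: "g \<in> carrier G \<Longrightarrow> Adj g v = \<psi> (mderiv M M (\<lambda>x. g \<otimes> x \<otimes> inv g) \<one> (\<phi> v))"
  using \<phi>_Ad \<psi>(2) by metis

lemma linear_Ad:
  assumes "g \<in> carrier G" shows "linear (Adj g)"
proof -
  have "linear (mderiv M M (\<lambda>x. g \<otimes> x \<otimes> inv g) \<one>)"
    by (rule linear_mderiv[OF manifold_axioms openin_carrier smooth_conj[OF assms]]) auto
  then have "linear (\<lambda>v. \<psi> (mderiv M M (\<lambda>x. g \<otimes> x \<otimes> inv g) \<one> (\<phi> v)))"
    using linear_compose[OF linear_compose[OF linear_\<phi>] \<psi>(1)] by (simp add: o_def)
  then show ?thesis using Ad_eq[OF assms] by presburger
qed

lemma velocity_conj: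
  assumes g: "g \<in> carrier G" and q: "plot M V q" "y \<in> V" "q y = \<one>"
  shows "velocity M (\<lambda>y. g \<otimes> q y \<otimes> inv g) y a = \<phi> (Adj g (\<psi> (velocity M q y a)))"
  using velocity_compose[OF manifold_axioms openin_carrier smooth_conj[OF g] q(1,2), of a] q(3)
  by (simp add: \<phi>_Ad[OF g] \<psi>(3)[OF velocity_in_model[OF q(1,2)]])

lemma Ad_one: "Adj \<one> v = v"
proof -
  have "\<phi> (Adj \<one> v) = velocity M (\<lambda>y. \<one> \<otimes> \<sigma> y \<otimes> inv \<one>) base (\<phi> v)"
    using velocity_conj[OF one_closed \<sigma>_plot base, of "\<phi> v"] by (simp add: velocity_\<sigma> \<psi>(2))
  also have "\<dots> = velocity M \<sigma> base (\<phi> v)"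
    by (rule fun_cong, rule velocity_cong[OF open_dom0 base(1)]) (simp add: \<sigma>_carrier)
  finally show ?thesis using velocity_\<sigma>[OF \<phi>_in] \<psi>(2) by metis
qed

lemma Ad_mult:
  assumes g: "g \<in> carrier G" and k: "k \<in> carrier G"
  shows "Adj (g \<otimes> k) v = Adj g (Adj k v)"
proof -
  let ?q = "\<lambda>y. k \<otimes> \<sigma> y \<otimes> inv k"
  have q: "plot M dom0 ?q" "?q base = \<one>"
    using k by (auto intro!: plot_left_mult plot_right_mult \<sigma>_plot simp: base)
  have "\<phi> (Adj (g \<otimes> k) v) = velocity M (\<lambda>y. (g \<otimes> k) \<otimes> \<sigma> y \<otimes> inv (g \<otimes> k)) base (\<phi> v)"
    using velocity_conj[OF m_closed[OF g k] \<sigma>_plot base, of "\<phi> v"] by (simp add: velocity_\<sigma> \<psi>(2))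
  also have "\<dots> = velocity M (\<lambda>y. g \<otimes> ?q y \<otimes> inv g) base (\<phi> v)"
    by (rule fun_cong, rule velocity_cong[OF open_dom0 base(1)])
      (use g k in \<open>simp add: \<sigma>_carrier inv_mult_group m_assoc\<close>)
  also have "\<dots> = \<phi> (Adj g (\<psi> (velocity M ?q base (\<phi> v))))"
    by (rule velocity_conj[OF g q(1) base(1) q(2)])
  also have "velocity M ?q base (\<phi> v) = \<phi> (Adj k v)"
    using velocity_conj[OF k \<sigma>_plot base, of "\<phi> v"] by (simp add: velocity_\<sigma> \<psi>(2))
  finally show ?thesis using \<psi>(2) by metis
qed

text \<open>Conjugation by \<open>p x\<close> sends \<open>\<sigma> base\<close> to the unit for
  every \<open>x\<close>, so the one chart at the unit serves all \<open>x\<close>, and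
  \<open>Ad\<close> is a partial derivative of a jointly smooth function.\<close>

lemma smooth_Ad_plot:
  assumes p: "plot M W p"
  shows "smooth_in W (\<lambda>x. Adj (p x) w)"
proof -
  let ?r = "\<lambda>z. (p (fst z) \<otimes> \<sigma> (snd z)) \<otimes> inv p (fst z)"
  have op: "open (W \<times> dom0)" by (intro open_Times plot_open[OF p] open_dom0)
  have r: "plot M (W \<times> dom0) ?r"
    by (intro plot_mult plot_mult_prod p \<sigma>_plot plot_inv
        plot_reparam[OF p smooth_in_linear[OF op linear_fst]]) auto
  define Z where "Z = {z \<in> W \<times> dom0. ?r z \<in> fst (chart_at M \<one>)}"
  have F: "smooth_in Z (\<lambda>z. chart_map M \<one> (?r z))"
    using plot_chart_smooth[OF r one_topspace] by (simp add: Z_def)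
  have Z: "(x, base) \<in> Z" if "x \<in> W" for x
    using that base plot_carrier[OF p] chart_at(2)[OF one_topspace] by (auto simp: Z_def)
  have "Adj (p x) w = \<psi> (fder (\<lambda>z. chart_map M \<one> (?r z)) (x, base) (0, \<phi> w))" if x: "x \<in> W" for x
  proof -
    have px: "p x \<in> carrier G" using plot_carrier[OF p x] .
    have "\<phi> (Adj (p x) w) = velocity M (\<lambda>y. p x \<otimes> \<sigma> y \<otimes> inv (p x)) base (\<phi> w)"
      using velocity_conj[OF px \<sigma>_plot base, of "\<phi> w"] by (simp add: velocity_\<sigma> \<psi>(2))
    also have "\<dots> = fder (\<lambda>y. chart_map M \<one> (p x \<otimes> \<sigma> y \<otimes> inv (p x))) base (\<phi> w)"
      using px by (simp add: velocity_def base)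
    also have "\<dots> = fder (\<lambda>z. chart_map M \<one> (?r z)) (x, base) (0, \<phi> w)"
      using fder_snd[OF smooth_in_differentiable[OF F Z[OF x]], of "\<phi> w"] by simp
    finally show ?thesis using \<psi>(2) by metis
  qed
  then show ?thesis
    using smooth_in_linear_compose[OF \<psi>(1) smooth_in_slice[OF F plot_open[OF p] Z, of "(0, \<phi> w)"]]
      smooth_in_cong[OF plot_open[OF p]] by (metis (no_types, lifting))
qed

lemma smooth_Ad: "smooth_map_on M eucl (carrier G) (\<lambda>g. Adj g w)"
  by (rule smooth_euclI[OF openin_carrier smooth_Ad_plot])

lemma smooth_Ad_inv: "smooth_map_on M eucl (carrier G) (\<lambda>g. Adj (inv g) w)"
  by (rule smooth_euclI[OF openin_carrier smooth_Ad_plot[OF plot_inv]])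

text \<open>Writing \<open>f(x y) = f((x y x\<^sup>-\<^sup>1) x)\<close> and differentiating first in \<open>y\<close> and then in \<open>x\<close> at the
  unit gives \<open>X\<^sub>v X\<^sub>w f - X\<^sub>w X\<^sub>v f\<close> as the derivative of \<open>f\<close> in the direction of the derivative of
  \<open>x \<mapsto> Ad\<^sub>x w\<close> along \<open>v\<close>.\<close>

lemma commutator_Ad:
  fixes f :: "'g \<Rightarrow> 'f::euclidean_space"
  assumes X: "openin (mtop M) X" "\<one> \<in> X" and f: "smooth_map_on M eucl X f"
  shows "left_deriv G M (\<phi> v) (left_deriv G M (\<phi> w) f) \<one> =
    left_deriv G M (\<phi> (fder (\<lambda>x. Adj (\<sigma> x) w) base (\<phi> v))) f \<one> +
    left_deriv G M (\<phi> w) (left_deriv G M (\<phi> v) f) \<one>"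
proof -
  let ?r = "\<lambda>z. \<sigma> (fst z) \<otimes> \<sigma> (snd z)"
  define \<Psi> where "\<Psi> z = f (?r z)" for z
  define Z where "Z = {z \<in> dom0 \<times> dom0. ?r z \<in> X}"
  have r: "plot M Z ?r"
    unfolding Z_def by (rule plot_subset[OF plot_mult_prod[OF \<sigma>_plot \<sigma>_plot]
          plot_vimage_open[OF plot_mult_prod[OF \<sigma>_plot \<sigma>_plot] X(1)]]) auto
  have \<Psi>: "smooth_in Z \<Psi>"
    unfolding \<Psi>_def by (rule smooth_plot[OF f r]) (auto simp: Z_def)
  define B where "B = {x \<in> dom0. \<sigma> x \<in> X}"
  have B: "open B" "base \<in> B"
    using plot_vimage_open[OF \<sigma>_plot X(1)] base X(2) by (auto simp: B_def)
  have BZ: "(x, base) \<in> Z" "(base, x) \<in> Z" if "x \<in> B" for x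
    using that base \<sigma>_carrier by (auto simp: B_def Z_def)
  have bb: "(base, base) \<in> Z" using BZ B by blast
  have first: "left_deriv G M (\<phi> u) f (\<sigma> x) = fder \<Psi> (x, base) (0, \<phi> u)" if x: "x \<in> B" for u x
  proof -
    have "left_deriv G M (\<phi> u) f (\<sigma> x) = fder (\<lambda>y. f (\<sigma> x \<otimes> \<sigma> y)) base (\<phi> u)"
      by (rule left_deriv_\<sigma>[OF X(1) f]) (use x in \<open>auto simp: B_def\<close>)
    also have "\<dots> = fder \<Psi> (x, base) (0, \<phi> u)"
      using fder_snd[OF smooth_in_differentiable[OF \<Psi> BZ(1)[OF x]], of "\<phi> u"] by (simp add: \<Psi>_def)
    finally show ?thesis .
  qed
  have second: "left_deriv G M (\<phi> a) (left_deriv G M (\<phi> u) f) \<one> =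
      fder (\<lambda>x. fder \<Psi> (x, base) (0, \<phi> u)) base (\<phi> a)" for u a
  proof -
    have "left_deriv G M (\<phi> a) (left_deriv G M (\<phi> u) f) \<one> =
        fder (\<lambda>y. left_deriv G M (\<phi> u) f (\<one> \<otimes> \<sigma> y)) base (\<phi> a)"
      by (rule left_deriv_\<sigma>[OF X(1) smooth_left_deriv[OF X(1) f \<phi>_in] X(2) \<phi>_in])
    also have "fder (\<lambda>y. left_deriv G M (\<phi> u) f (\<one> \<otimes> \<sigma> y)) base =
        fder (\<lambda>x. fder \<Psi> (x, base) (0, \<phi> u)) base"
      by (rule fder_cong[OF B]) (simp add: first[symmetric] B_def \<sigma>_carrier)
    finally show ?thesis .
  qed
  have key: "fder \<Psi> (x, base) (0, \<phi> w) = fder \<Psi> (base, x) (\<phi> (Adj (\<sigma> x) w), 0)" if x: "x \<in> B" for x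
  proof -
    have \<sigma>x: "\<sigma> x \<in> X" "\<sigma> x \<in> carrier G" using x \<sigma>_carrier by (auto simp: B_def)
    let ?k = "\<lambda>y. \<sigma> x \<otimes> \<sigma> y \<otimes> inv (\<sigma> x)"
    have k: "plot M dom0 ?k" "?k base = \<one>"
      using \<sigma>x by (auto intro!: plot_left_mult plot_right_mult \<sigma>_plot simp: base)
    have kv: "velocity M ?k base (\<phi> w) = \<phi> (Adj (\<sigma> x) w)"
      using velocity_conj[OF \<sigma>x(2) \<sigma>_plot base, of "\<phi> w"] by (simp add: velocity_\<sigma> \<psi>(2))
    have "fder \<Psi> (x, base) (0, \<phi> w) = fder (\<lambda>y. f (\<sigma> x \<otimes> \<sigma> y)) base (\<phi> w)"
      using fder_snd[OF smooth_in_differentiable[OF \<Psi> BZ(1)[OF x]], of "\<phi> w"] by (simp add: \<Psi>_def)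
    also have "\<dots> = fder (\<lambda>y. f (?k y \<otimes> \<sigma> x)) base (\<phi> w)"
      by (rule fun_cong, rule fder_cong[OF open_dom0 base(1)]) (use \<sigma>x \<sigma>_carrier in \<open>simp add: m_assoc\<close>)
    also have "\<dots> = fder (\<lambda>y. f (\<sigma> y \<otimes> \<sigma> x)) base (\<phi> (Adj (\<sigma> x) w))"
      using right_deriv_plot[OF X(1) f \<sigma>x(1) k(1) base(1) k(2), of "\<phi> w"]
        right_deriv_plot[OF X(1) f \<sigma>x(1) \<sigma>_plot base, of "\<phi> (Adj (\<sigma> x) w)"]
      by (simp add: kv velocity_\<sigma>)
    also have "\<dots> = fder \<Psi> (base, x) (\<phi> (Adj (\<sigma> x) w), 0)"
      using fder_fst[OF smooth_in_differentiable[OF \<Psi> BZ(2)[OF x]], of "\<phi> (Adj (\<sigma> x) w)"]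
      by (simp add: \<Psi>_def)
    finally show ?thesis .
  qed
  let ?a = "\<lambda>x. \<phi> (Adj (\<sigma> x) w)"
  have Adiff: "(\<lambda>x. Adj (\<sigma> x) w) differentiable (at base)"
    by (rule smooth_in_differentiable[OF smooth_Ad_plot[OF \<sigma>_plot] base(1)])
  have a: "smooth_in dom0 ?a"
    by (rule smooth_in_linear_compose[OF linear_\<phi> smooth_Ad_plot[OF \<sigma>_plot]])
  have slice: "(\<lambda>x. fder \<Psi> (base, x) (b, 0)) differentiable (at base)" for b
  proof -
    have "smooth_in B (\<lambda>x. (base, x))"
      by (intro smooth_in_Pair smooth_in_const smooth_in_linear[OF _ linear_ident] B)
    then have "smooth_in B (\<lambda>x. fder \<Psi> (base, x) (b, 0))"
      by (rule smooth_in_compose[OF _ smooth_in_fder[OF \<Psi>]]) (use BZ in auto)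
    then show ?thesis using smooth_in_differentiable B(2) by blast
  qed
  have lin: "linear (\<lambda>b. fder \<Psi> (base, x) (b, 0))" if "x \<in> B" for x
  proof -
    have "linear (\<lambda>b::'e. (b, 0::'e))" by (simp add: linear_iff)
    from linear_compose[OF this smooth_in_linear_fder[OF \<Psi> BZ(2)[OF that]]]
    show ?thesis by (simp add: o_def)
  qed
  have "left_deriv G M (\<phi> v) (left_deriv G M (\<phi> w) f) \<one> =
      fder (\<lambda>x. fder \<Psi> (base, x) (?a x, 0)) base (\<phi> v)"
    unfolding second by (rule fun_cong, rule fder_cong[OF B key])
  \<comment> \<open>By the product rule the moving vector gives the \<open>Ad\<close> term and the
    moving base point gives a mixed second derivative.\<close>
  also have "\<dots> = fder \<Psi> (base, base) (fder ?a base (\<phi> v), 0) +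
      fder (\<lambda>x. fder \<Psi> (base, x) (?a base, 0)) base (\<phi> v)"
    by (rule fder_family_apply[OF B lin slice smooth_in_differentiable[OF a base(1)]])
  also have "fder (\<lambda>x. fder \<Psi> (base, x) (?a base, 0)) base (\<phi> v) =
      left_deriv G M (\<phi> w) (left_deriv G M (\<phi> v) f) \<one>"
  proof -
    have d: "(\<lambda>z. fder \<Psi> z b) differentiable (at (base, base))" for b
      by (rule smooth_in_differentiable[OF smooth_in_fder[OF \<Psi>] bb])
    \<comment> \<open>At \<open>base\<close> the vector is \<open>\<phi> w\<close>, since
      \<open>Ad\<close> of the unit is the identity; exchanging the two directions then produces the
      iterated left derivative in the other order.\<close>
    have "fder (\<lambda>x. fder \<Psi> (base, x) (?a base, 0)) base (\<phi> v) =
        fder (\<lambda>z. fder \<Psi> z (\<phi> w, 0)) (base, base) (0, \<phi> v)"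
      using fder_snd[OF d] by (simp add: base Ad_one)
    also have "\<dots> = fder (\<lambda>z. fder \<Psi> z (0, \<phi> v)) (base, base) (\<phi> w, 0)"
      by (rule fder_fder_commute[OF \<Psi> bb])
    also have "\<dots> = fder (\<lambda>x. fder \<Psi> (x, base) (0, \<phi> v)) base (\<phi> w)"
      using fder_fst[OF d] by metis
    finally show ?thesis by (simp add: second)
  qed
  also have "fder \<Psi> (base, base) (fder ?a base (\<phi> v), 0) =
      left_deriv G M (\<phi> (fder (\<lambda>x. Adj (\<sigma> x) w) base (\<phi> v))) f \<one>"
  proof -
    let ?z = "fder (\<lambda>x. Adj (\<sigma> x) w) base (\<phi> v)"
    have "fder ?a base (\<phi> v) = \<phi> ?z" by (rule fder_linear_compose[OF linear_\<phi> Adiff])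
    moreover have "fder \<Psi> (base, base) (\<phi> ?z, 0) = fder (\<lambda>y. f (\<sigma> y \<otimes> \<sigma> base)) base (\<phi> ?z)"
      using fder_fst[OF smooth_in_differentiable[OF \<Psi> bb], of "\<phi> ?z"] by (simp add: \<Psi>_def)
    moreover have "fder (\<lambda>y. f (\<sigma> y \<otimes> \<sigma> base)) base (\<phi> ?z) = fder (\<lambda>y. f (\<one> \<otimes> \<sigma> y)) base (\<phi> ?z)"
      by (rule fun_cong, rule fder_cong[OF open_dom0 base(1)]) (simp add: base \<sigma>_carrier)
    ultimately show ?thesis using left_deriv_\<sigma>[OF X(1) f X(2) \<phi>_in] by metis
  qed
  finally show ?thesis .
qed

lemma bracket:
  fixes f :: "'g \<Rightarrow> real"
  assumes "openin (mtop M) X" "smooth_map_on M eucl X f" "p \<in> X"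
  shows "left_deriv G M (\<phi> (br v w)) f p =
    left_deriv G M (\<phi> v) (left_deriv G M (\<phi> w) f) p - left_deriv G M (\<phi> w) (left_deriv G M (\<phi> v) f) p"
  using assms has_lie_algebra unfolding has_lie_algebra_def by blast

text \<open>The bracket is known only through its action on functions. The coordinates of the chart
  at the unit serve as test functions: their left derivatives there return the components of the
  direction, so an identity of derivations becomes one of vectors.\<close>

lemma fder_Ad_base: "fder (\<lambda>y. Adj (\<sigma> y) w) base (\<phi> v) = br v w"
proof -
  let ?U = "fst (chart_at M \<one>)" and ?z = "fder (\<lambda>y. Adj (\<sigma> y) w) base (\<phi> v)"
  have U: "openin (mtop M) ?U" "\<one> \<in> ?U"
    using atlasD(1)[OF chart_at(1)[OF one_topspace]] chart_at(2)[OF one_topspace] by auto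
  have "\<phi> (br v w) = \<phi> ?z"
  proof (rule euclidean_eqI)
    fix b :: 'e
    let ?f = "\<lambda>g. chart_map M \<one> g \<bullet> b"
    have lin: "linear (\<lambda>y. y \<bullet> b)" by (simp add: linear_iff inner_add_left)
    have f: "smooth_map_on M eucl ?U ?f"
    proof (rule smooth_euclI[OF U(1)])
      fix W and p :: "'e \<Rightarrow> 'g" assume p: "plot M W p" "p ` W \<subseteq> ?U"
      then have "{y \<in> W. p y \<in> ?U} = W" by auto
      then show "smooth_in W (\<lambda>x. ?f (p x))"
        using plot_chart_smooth[OF p(1) one_topspace] by (intro smooth_in_linear_compose[OF lin]) simp
    qed
    have eq: "left_deriv G M (\<phi> u) ?f \<one> = \<phi> u \<bullet> b" for u
    proof -
      have "left_deriv G M (\<phi> u) ?f \<one> = fder (\<lambda>y. ?f (\<one> \<otimes> \<sigma> y)) base (\<phi> u)"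
        by (rule left_deriv_\<sigma>[OF U(1) f U(2) \<phi>_in])
      also have "\<dots> = fder (\<lambda>y. chart_map M \<one> (\<sigma> y) \<bullet> b) base (\<phi> u)"
        by (rule fun_cong, rule fder_cong[OF open_dom0 base(1)]) (simp add: \<sigma>_carrier)
      also have "\<dots> = fder (\<lambda>y. chart_map M \<one> (\<sigma> y)) base (\<phi> u) \<bullet> b"
        by (rule fder_linear_compose[OF lin])
          (use velocity_has_derivative[OF \<sigma>_plot base(1)] base(2) differentiableI in force)
      also have "fder (\<lambda>y. chart_map M \<one> (\<sigma> y)) base (\<phi> u) = velocity M \<sigma> base (\<phi> u)"
        by (simp add: velocity_def base)
      finally show ?thesis by (simp add: velocity_\<sigma>)
    qed
    show "\<phi> (br v w) \<bullet> b = \<phi> ?z \<bullet> b"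
      using bracket[OF U(1) f U(2), of v w] commutator_Ad[OF U f, of v w] eq[of "br v w"] eq[of ?z]
      by linarith
  qed
  then show ?thesis using inj_\<phi> by (simp add: inj_eq)
qed

text \<open>Obtained by differentiating the constant composite of \<open>Ad\<close> at
  \<open>\<sigma> y\<close> and at its inverse, both of which are the identity at
  \<open>base\<close>.\<close>

lemma fder_Ad_inv_base: "fder (\<lambda>y. Adj (inv \<sigma> y) w) base (\<phi> v) = - br v w"
proof -
  have B: "(\<lambda>y. Adj (inv \<sigma> y) w) differentiable (at base)"
    by (rule smooth_in_differentiable[OF smooth_Ad_plot[OF plot_inv[OF \<sigma>_plot]] base(1)])
  have "fder (\<lambda>y. Adj (\<sigma> y) (Adj (inv \<sigma> y) w)) base (\<phi> v) =
      Adj (\<sigma> base) (fder (\<lambda>y. Adj (inv \<sigma> y) w) base (\<phi> v)) +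
      fder (\<lambda>y. Adj (\<sigma> y) (Adj (inv \<sigma> base) w)) base (\<phi> v)"
    by (rule fder_family_apply[OF open_dom0 base(1) linear_Ad[OF \<sigma>_carrier]
          smooth_in_differentiable[OF smooth_Ad_plot[OF \<sigma>_plot] base(1)] B])
  moreover have "fder (\<lambda>y. Adj (\<sigma> y) (Adj (inv \<sigma> y) w)) base = fder (\<lambda>y. w) base"
    by (rule fder_cong[OF open_dom0 base(1)]) (simp add: Ad_mult[symmetric] \<sigma>_carrier Ad_one)
  ultimately show ?thesis
    by (simp add: base Ad_one fder_Ad_base eq_neg_iff_add_eq_0)
qed

text \<open>Inverting \<open>g \<otimes> \<sigma> y\<close> reverses the factors, so the variation
  acts after \<open>Adj (inv g)\<close>; this places \<open>Adj (inv g) w\<close> inside the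
  bracket.\<close>

lemma left_deriv_Ad_inv:
  assumes g: "g \<in> carrier G"
  shows "left_deriv G M (\<phi> v) (\<lambda>g. Adj (inv g) w) g = - br v (Adj (inv g) w)"
proof -
  have "left_deriv G M (\<phi> v) (\<lambda>g. Adj (inv g) w) g = fder (\<lambda>y. Adj (inv (g \<otimes> \<sigma> y)) w) base (\<phi> v)"
    by (rule left_deriv_\<sigma>[OF openin_carrier smooth_Ad_inv g \<phi>_in])
  also have "\<dots> = fder (\<lambda>y. Adj (inv \<sigma> y) (Adj (inv g) w)) base (\<phi> v)"
    by (rule fun_cong, rule fder_cong[OF open_dom0 base(1)])
      (use g in \<open>simp add: \<sigma>_carrier inv_mult_group Ad_mult\<close>)
  finally show ?thesis by (simp add: fder_Ad_inv_base)
qed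

text \<open>The left logarithmic derivative \<open>p\<^sup>-\<^sup>1 dp\<close> of a plot \<open>p\<close>.\<close>

definition ldiff :: "('d::euclidean_space \<Rightarrow> 'g) \<Rightarrow> 'd \<Rightarrow> 'd \<Rightarrow> 'v" where
  "ldiff p x a = \<psi> (velocity M (\<lambda>y. inv (p x) \<otimes> p y) x a)"

text \<open>Writing \<open>p y\<close> as \<open>p x\<close> times a plot through the unit turns a
  derivative along an arbitrary plot into a left derivative.\<close>

lemma fder_plot_ldiff:
  fixes f :: "'g \<Rightarrow> 'f::euclidean_space"
  assumes X: "openin (mtop M) X" and f: "smooth_map_on M eucl X f"
    and p: "plot M W p" "x \<in> W" "p x \<in> X"
  shows "fder (\<lambda>y. f (p y)) x a = left_deriv G M (\<phi> (ldiff p x a)) f (p x)"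
proof -
  have px: "p x \<in> carrier G" using plot_carrier[OF p(1,2)] .
  have q: "plot M W (\<lambda>y. inv (p x) \<otimes> p y)" "inv (p x) \<otimes> p x = \<one>"
    using plot_left_mult[OF _ p(1)] px by auto
  have "fder (\<lambda>y. f (p y)) x a = fder (\<lambda>y. f (p x \<otimes> (inv (p x) \<otimes> p y))) x a"
    by (rule fun_cong, rule fder_cong[OF plot_open[OF p(1)] p(2)])
      (use px plot_carrier[OF p(1)] in \<open>simp add: m_assoc[symmetric]\<close>)
  also have "\<dots> = left_deriv G M (velocity M (\<lambda>y. inv (p x) \<otimes> p y) x a) f (p x)"
    by (rule left_deriv_plot[OF X f p(3) q(1) p(2) q(2)])
  finally show ?thesis
    by (simp add: ldiff_def \<psi>(3)[OF velocity_in_model[OF q(1) p(2)]])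
qed

lemma left_deriv_Ad:
  assumes g: "g \<in> carrier G"
  shows "left_deriv G M (\<phi> v) (\<lambda>g. Adj g w) g = Adj g (br v w)"
proof -
  have "left_deriv G M (\<phi> v) (\<lambda>g. Adj g w) g = fder (\<lambda>y. Adj (g \<otimes> \<sigma> y) w) base (\<phi> v)"
    by (rule left_deriv_\<sigma>[OF openin_carrier smooth_Ad g \<phi>_in])
  also have "\<dots> = fder (\<lambda>y. Adj g (Adj (\<sigma> y) w)) base (\<phi> v)"
    by (rule fun_cong, rule fder_cong[OF open_dom0 base(1)]) (use g in \<open>simp add: \<sigma>_carrier Ad_mult\<close>)
  also have "\<dots> = Adj g (fder (\<lambda>y. Adj (\<sigma> y) w) base (\<phi> v))"
    by (rule fder_linear_compose[OF linear_Ad[OF g]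
          smooth_in_differentiable[OF smooth_Ad_plot[OF \<sigma>_plot] base(1)]])
  finally show ?thesis by (simp add: fder_Ad_base)
qed

end

section \<open>Connected Lie subgroups\<close>

text \<open>Such neighbourhoods are parametrised by balls: segments to the centre are available in
  them, and functions with zero derivative are constant on them.\<close>

lemma (in manifold) chart_ball:
  assumes q: "q \<in> topspace (mtop M)" and r: "r > 0"
  defines "B \<equiv> {x \<in> fst (chart_at M q). chart_map M q x \<in> ball (chart_map M q q) r}"
  shows "openin (mtop M) B" "q \<in> B"
proof -
  let ?U = "fst (chart_at M q)"
  have U: "openin (mtop M) ?U" by (rule atlasD(1)[OF chart_at(1)[OF q]])
  then have UM: "?U \<subseteq> topspace (mtop M)" by (rule openin_subset)
  have "continuous_map (subtopology (mtop M) ?U) euclidean (chart_map M q)"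
    using homeomorphic_imp_continuous_map[OF atlasD(3)[OF chart_at(1)[OF q]]]
      continuous_map_into_fulltopology by blast
  then have "openin (subtopology (mtop M) ?U)
      {x \<in> topspace (subtopology (mtop M) ?U). chart_map M q x \<in> ball (chart_map M q q) r}"
    by (rule openin_continuous_map_preimage) simp
  moreover have "{x \<in> topspace (subtopology (mtop M) ?U). chart_map M q x \<in> ball (chart_map M q q) r} = B"
    using UM by (auto simp: B_def)
  ultimately show "openin (mtop M) B" using U openin_trans_full by metis
  show "q \<in> B" using chart_at(2)[OF q] r by (simp add: B_def)
qed

text \<open>The equivalence in \<open>loc\<close> makes both the set where \<open>P\<close> holds
  and its complement open.\<close>

lemma connected_space_locally_constant:
  assumes X: "connected_space X"
    and loc: "\<And>q. q \<in> topspace X \<Longrightarrow> \<exists>V. openin X V \<and> q \<in> V \<and> (\<forall>x\<in>V. P x \<longleftrightarrow> P q)"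
    and p: "p \<in> topspace X" "P p" and q: "q \<in> topspace X"
  shows "P q"
proof -
  let ?T = "{x \<in> topspace X. P x}"
  have "openin X ?T"
  proof (subst openin_subopen, intro ballI)
    fix x assume x: "x \<in> ?T"
    then obtain V where "openin X V" "x \<in> V" "\<forall>y\<in>V. P y \<longleftrightarrow> P x" using loc by blast
    then show "\<exists>V. openin X V \<and> x \<in> V \<and> V \<subseteq> ?T" using x openin_subset by (intro exI[of _ V]) blast
  qed
  moreover have "openin X (topspace X - ?T)"
  proof (subst openin_subopen, intro ballI)
    fix x assume x: "x \<in> topspace X - ?T"
    then obtain V where "openin X V" "x \<in> V" "\<forall>y\<in>V. P y \<longleftrightarrow> P x" using loc by blast
    then show "\<exists>V. openin X V \<and> x \<in> V \<and> V \<subseteq> topspace X - ?T"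
      using x openin_subset by (intro exI[of _ V]) blast
  qed
  ultimately have "openin X ?T \<and> closedin X ?T" by (simp add: closedin_def)
  then have "?T = {} \<or> ?T = topspace X" using X unfolding connected_space_clopen_in by blast
  then show ?thesis using p q by blast
qed

section \<open>Uniqueness for linear differential equations\<close>

lemma gronwall_zero:
  fixes q :: "real \<Rightarrow> real"
  assumes q: "\<And>t. 0 \<le> t \<Longrightarrow> t \<le> 1 \<Longrightarrow> (q has_real_derivative q' t) (at t)"
    and le: "\<And>t. 0 \<le> t \<Longrightarrow> t \<le> 1 \<Longrightarrow> q' t \<le> C * q t"
    and "q 0 = 0" and t: "0 \<le> t" "t \<le> 1" and "q t \<ge> 0"
  shows "q t = 0"
proof -
  \<comment> \<open>The integrating factor turns the differential inequality into monotonicity, and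
    \<open>q\<close> starts at zero.\<close>
  let ?p = "\<lambda>t. q t * exp (- C * t)"
  have "?p 0 \<ge> ?p t"
  proof (rule DERIV_nonpos_imp_nonincreasing[OF t(1)])
    fix x assume x: "0 \<le> x" "x \<le> t"
    have "(?p has_real_derivative (q' x - C * q x) * exp (- C * x)) (at x)"
      using x t by (auto intro!: derivative_eq_intros q simp: algebra_simps)
    moreover have "(q' x - C * q x) * exp (- C * x) \<le> 0"
      using le[of x] x t by (simp add: mult_nonpos_nonneg)
    ultimately show "\<exists>y. DERIV ?p x :> y \<and> y \<le> 0" by blast
  qed
  then have "q t * exp (- C * t) \<le> 0" using assms(3) by simp
  then have "q t \<le> 0" by (simp add: mult_le_0_iff not_le)
  then show ?thesis using assms(6) by simp
qed

text \<open>The unknown is the operator \<open>L t\<close>, with \<open>A\<close> acting inside its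
  argument. Gronwall's inequality is applied to the sum of the squared norms of the images of the
  basis, which is why \<open>A\<close> is bounded on \<open>Basis\<close> only.\<close>

lemma linear_ode_zero:
  fixes L :: "real \<Rightarrow> 'a::euclidean_space \<Rightarrow> 'b::euclidean_space"
  assumes lin: "\<And>t. 0 \<le> t \<Longrightarrow> t \<le> 1 \<Longrightarrow> linear (L t)"
    and der: "\<And>t b. 0 \<le> t \<Longrightarrow> t \<le> 1 \<Longrightarrow> ((\<lambda>t. L t b) has_vector_derivative L t (A t b)) (at t)"
    and A: "\<And>t b. 0 \<le> t \<Longrightarrow> t \<le> 1 \<Longrightarrow> b \<in> Basis \<Longrightarrow> norm (A t b) \<le> c"
    and L0: "\<And>b. L 0 b = 0" and t: "0 \<le> t" "t \<le> 1"
  shows "L t b = 0"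
proof -
  define q where "q t = (\<Sum>b\<in>Basis. L t b \<bullet> L t b)" for t
  define n where "n t = (\<Sum>b\<in>Basis. norm (L t b))" for t
  define q' where "q' t = (\<Sum>b\<in>Basis. 2 * (L t b \<bullet> L t (A t b)))" for t
  have "(q has_real_derivative q' t) (at t)" if "0 \<le> t" "t \<le> 1" for t
  proof -
    have "((\<lambda>t. L t b \<bullet> L t b) has_real_derivative 2 * (L t b \<bullet> L t (A t b))) (at t)" for b
    proof -
      have "((\<lambda>t. L t b \<bullet> L t b) has_derivative
          (\<lambda>d. L t b \<bullet> (d *\<^sub>R L t (A t b)) + (d *\<^sub>R L t (A t b)) \<bullet> L t b)) (at t)"
        using der[OF that, of b] unfolding has_vector_derivative_def
        by (intro has_derivative_inner)
      then show ?thesis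
        by (simp add: has_field_derivative_def inner_commute algebra_simps mult_commute_abs)
    qed
    then show ?thesis unfolding q_def q'_def by (intro DERIV_sum)
  qed
  moreover have "q' t \<le> (2 * c * DIM('a)) * q t" if t: "0 \<le> t" "t \<le> 1" for t
  proof -
    have c: "c \<ge> 0" using A[OF t] norm_ge_zero order_trans nonempty_Basis by (metis ex_in_conv)
    have 1: "norm (L t (A t b)) \<le> c * n t" if b: "b \<in> Basis" for b
    proof -
      have "norm (L t (A t b)) = norm (\<Sum>i\<in>Basis. (A t b \<bullet> i) *\<^sub>R L t i)"
        by (subst linear_basis_expand[OF lin[OF t]]) simp
      also have "\<dots> \<le> (\<Sum>i\<in>Basis. \<bar>A t b \<bullet> i\<bar> * norm (L t i))"
        by (rule order_trans[OF norm_sum]) simp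
      also have "\<dots> \<le> (\<Sum>i\<in>Basis. c * norm (L t i))"
        by (intro sum_mono mult_right_mono order_trans[OF Basis_le_norm A[OF t b]]) auto
      finally show ?thesis by (simp add: n_def sum_distrib_left)
    qed
    have "q' t \<le> (\<Sum>b\<in>Basis. 2 * (norm (L t b) * (c * n t)))"
      unfolding q'_def
      by (intro sum_mono mult_left_mono order_trans[OF norm_cauchy_schwarz] 1) auto
    also have "\<dots> = 2 * c * (n t)\<^sup>2"
      by (simp add: n_def sum_distrib_left sum_distrib_right power2_eq_square mult_ac)
    \<comment> \<open>Cauchy-Schwarz for a sum of \<open>DIM('a)\<close> norms; this is the origin
      of the dimension in the Gronwall constant.\<close>
    also have "\<dots> \<le> 2 * c * (DIM('a) * q t)"
    proof -
      have "(n t)\<^sup>2 \<le> (\<Sum>b\<in>(Basis::'a set). (norm (L t b))\<^sup>2) * DIM('a)"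
        unfolding n_def using sum_squared_le_sum_of_squares[of "\<lambda>b. norm (L t b)" "Basis :: 'a set"]
        by simp
      then show ?thesis using c by (intro mult_left_mono) (auto simp: q_def power2_norm_eq_inner mult.commute)
    qed
    finally show ?thesis by (simp add: mult_ac)
  qed
  moreover have "q 0 = 0" by (simp add: q_def L0)
  moreover have "q t \<ge> 0" by (simp add: q_def sum_nonneg)
  ultimately have "q t = 0" using gronwall_zero t by blast
  then have *: "L t b = 0" if "b \<in> Basis" for b
    using that by (simp add: q_def sum_nonneg_eq_0_iff)
  show ?thesis by (subst linear_basis_expand[OF lin[OF t]]) (simp add: *)
qed

section \<open>Invariance under connected subgroups\<close>

context lie_grp_alg
begin

text \<open>The product \<open>inv (p x) \<otimes> p y\<close> is the unit on the diagonal, so one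
  chart serves all \<open>x\<close>; the logarithmic derivative is its derivative in the second
  slot, restricted to the diagonal.\<close>

lemma smooth_ldiff:
  assumes p: "plot M W p"
  shows "smooth_in W (\<lambda>x. ldiff p x a)"
proof -
  let ?r = "\<lambda>z. inv (p (fst z)) \<otimes> p (snd z)"
  have r: "plot M (W \<times> W) ?r" by (rule plot_mult_prod[OF plot_inv[OF p] p])
  define Z where "Z = {z \<in> W \<times> W. ?r z \<in> fst (chart_at M \<one>)}"
  have F: "smooth_in Z (\<lambda>z. chart_map M \<one> (?r z))"
    using plot_chart_smooth[OF r one_topspace] by (simp add: Z_def)
  have Z: "(x, x) \<in> Z" if "x \<in> W" for x
    using that plot_carrier[OF p that] chart_at(2)[OF one_topspace] by (auto simp: Z_def)
  have W: "open W" by (rule plot_open[OF p])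
  have "smooth_in W (\<lambda>x. (x, x))"
    by (intro smooth_in_Pair smooth_in_linear[OF W linear_ident])
  then have "smooth_in W (\<lambda>x. fder (\<lambda>z. chart_map M \<one> (?r z)) (x, x) (0, a))"
    by (rule smooth_in_compose[OF _ smooth_in_fder[OF F]]) (use Z in auto)
  then have *: "smooth_in W (\<lambda>x. \<psi> (fder (\<lambda>z. chart_map M \<one> (?r z)) (x, x) (0, a)))"
    by (rule smooth_in_linear_compose[OF \<psi>(1)])
  have "\<psi> (fder (\<lambda>z. chart_map M \<one> (?r z)) (x, x) (0, a)) = ldiff p x a" if x: "x \<in> W" for x
    using fder_snd[OF smooth_in_differentiable[OF F Z[OF x]], of a] plot_carrier[OF p x]
    by (simp add: ldiff_def velocity_def)
  then show ?thesis using * smooth_in_cong[OF W] by (metis (no_types, lifting))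
qed

end

locale lie_sub = lie_grp_alg G M br \<phi>
  for G :: "'g monoid" (structure) and M :: "('g, 'e::euclidean_space) mfd"
    and br :: "'v::euclidean_space \<Rightarrow> 'v \<Rightarrow> 'v" and \<phi> :: "'v \<Rightarrow> 'e" +
  fixes H :: "'g set" and N :: "('g, 'e) mfd" and h :: "'v set"
  assumes immersed: "immersed_lie_subgroup G M \<phi> H N h"
begin

lemma subgroup_H: "subgroup H G"
  using immersed by (simp add: immersed_lie_subgroup_def)

lemma lie_group_H: "lie_group (G\<lparr>carrier := H\<rparr>) N"
  using immersed by (simp add: immersed_lie_subgroup_def)

sublocale S: lie_grp "G\<lparr>carrier := H\<rparr>" N
proof (intro lie_grp.intro lie_grp_axioms.intro)
  show "Group.group (G\<lparr>carrier := H\<rparr>)" using lie_group_H unfolding lie_group_def by blast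
qed (rule lie_group_H)

lemma H_carrier: "a \<in> H \<Longrightarrow> a \<in> carrier G"
  using subgroup_H subgroup.subset by blast

lemma h_eq: "h = {v. \<phi> v \<in> mderiv N M (\<lambda>x. x) \<one> ` model N}"
  using immersed by (simp add: immersed_lie_subgroup_def)

lemma smooth_incl: "smooth_map_on N M H (\<lambda>x. x)"
  using immersed S.topspace_M by (simp add: immersed_lie_subgroup_def)

lemma openin_H: "openin (mtop N) H"
  using S.openin_carrier by simp

lemma plot_incl: "plot N W p \<Longrightarrow> plot M W p"
  by (rule S.plot_compose[OF manifold_axioms smooth_incl]) (use S.plot_carrier in auto)

lemma S_base: "S.base \<in> S.dom0" "S.\<sigma> S.base = \<one>"
  using S.base by simp_all

text \<open>The product \<open>inv (p x) \<otimes> p y\<close> is a plot for the structure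
  \<open>N\<close> of the subgroup, not just for \<open>M\<close>; its velocity at the unit is
  therefore in the image of the differential of the inclusion, which defines
  \<open>h\<close>.\<close>

lemma ldiff_in:
  assumes p: "plot N W p" "x \<in> W"
  shows "ldiff p x a \<in> h"
proof -
  have px: "p x \<in> H" using S.plot_carrier[OF p] by simp
  have i: "inv (p x) \<in> H" using subgroup.m_inv_closed[OF subgroup_H px] .
  let ?q = "\<lambda>y. inv (p x) \<otimes> p y"
  have q: "plot N W ?q" using S.plot_left_mult[of "inv (p x)", OF _ p(1)] i by simp
  have qx: "?q x = \<one>" using px H_carrier by simp
  have "velocity M ?q x a = mderiv N M (\<lambda>x. x) \<one> (velocity N ?q x a)"
    using S.velocity_compose[OF manifold_axioms openin_H smooth_incl q p(2), of a] qx
      subgroup.one_closed[OF subgroup_H] by simp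
  then have "velocity M ?q x a \<in> mderiv N M (\<lambda>x. x) \<one> ` model N"
    using S.velocity_in_model[OF q p(2)] by blast
  moreover have "\<phi> (\<psi> (velocity M ?q x a)) = velocity M ?q x a"
    by (rule \<psi>(3)[OF velocity_in_model[OF plot_incl[OF q] p(2)]])
  ultimately show ?thesis by (simp add: ldiff_def h_eq)
qed

text \<open>Realises elements of \<open>h\<close> by a plot inside \<open>H\<close>, so that
  whatever is constant along \<open>H\<close> can be differentiated in the direction
  \<open>v\<close>.\<close>

lemma h_velocity:
  assumes "v \<in> h"
  obtains u where "velocity M S.\<sigma> S.base u = \<phi> v"
proof -
  obtain u where u: "u \<in> model N" "\<phi> v = mderiv N M (\<lambda>x. x) \<one> u" using assms h_eq by blast
  have "velocity M S.\<sigma> S.base u = mderiv N M (\<lambda>x. x) \<one> u"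
    using S.velocity_compose[OF manifold_axioms openin_H smooth_incl S.\<sigma>_plot S_base(1), of u]
      S.velocity_\<sigma>[OF u(1)] S_base subgroup.one_closed[OF subgroup_H] by simp
  then show thesis using that u(2) by simp
qed

text \<open>With \<open>R\<close> a projection along \<open>W\<close> and \<open>P\<close> one onto \<open>W\<close>, invariance of \<open>W\<close> under \<open>ad\<^sub>h\<close> makes
  \<open>R Ad\<^sub>p P\<close> solve a homogeneous linear equation along each segment from \<open>e\<close>, where it vanishes.\<close>

lemma Ad_invariant_local:
  assumes W: "subspace W" and br: "bilinear br" and inv: "\<And>x w. x \<in> h \<Longrightarrow> w \<in> W \<Longrightarrow> br x w \<in> W"
    and p: "plot N (ball e r) p" "p e = \<one>" and y: "y \<in> ball e r" and w: "w \<in> W"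
  shows "Adj (p y) w \<in> W"
proof -
  obtain P where P: "linear P" "\<And>x. P x \<in> W" "\<And>x. x \<in> W \<Longrightarrow> P x = x"
    using linear_exists_left_inverse_on[of "\<lambda>x::'v. x" W] W linear_id
    by (fastforce simp: id_def inj_on_def)
  have pM: "plot M (ball e r) p" by (rule plot_incl[OF p(1)])
  define \<gamma> where "\<gamma> t = e + t *\<^sub>R (y - e)" for t
  have \<gamma>: "\<gamma> t \<in> ball e r" if "0 \<le> t" "t \<le> 1" for t
  proof -
    have "norm (t *\<^sub>R (y - e)) \<le> norm (y - e)" using that by (simp add: mult_left_le_one_le)
    then show ?thesis using y by (simp add: \<gamma>_def dist_norm norm_minus_commute)
  qed
  define x where "x t = ldiff p (\<gamma> t) (y - e)" for t
  define R where "R v = v - P v" for v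
  have R: "linear R" unfolding R_def by (intro linear_compose_sub linear_ident P(1))
  define L where "L t b = R (Adj (p (\<gamma> t)) (P b))" for t b
  define A where "A t b = br (x t) (P b)" for t b
  have pc: "p (\<gamma> t) \<in> carrier G" if "0 \<le> t" "t \<le> 1" for t
    using plot_carrier[OF pM \<gamma>[OF that]] .
  have AW: "A t b \<in> W" if "0 \<le> t" "t \<le> 1" for t b
    unfolding A_def x_def by (intro inv ldiff_in[OF p(1)] \<gamma> that P(2))
  have lin: "linear (L t)" if "0 \<le> t" "t \<le> 1" for t
    using linear_compose[OF linear_compose[OF P(1) linear_Ad[OF pc[OF that]]] R]
    by (simp add: L_def[abs_def] o_def)
  have der: "((\<lambda>t. L t b) has_vector_derivative L t (A t b)) (at t)" if t: "0 \<le> t" "t \<le> 1" for t b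
  proof -
    have "((\<lambda>s. (\<lambda>z. Adj (p z) (P b)) (e + s *\<^sub>R (y - e))) has_vector_derivative
        fder (\<lambda>z. Adj (p z) (P b)) (e + t *\<^sub>R (y - e)) (y - e)) (at t)"
      by (rule fder_line, rule smooth_in_differentiable[OF smooth_Ad_plot[OF pM]])
        (use \<gamma>[OF t] in \<open>simp add: \<gamma>_def\<close>)
    then have "((\<lambda>s. Adj (p (\<gamma> s)) (P b)) has_vector_derivative
        fder (\<lambda>z. Adj (p z) (P b)) (\<gamma> t) (y - e)) (at t)" by (simp add: \<gamma>_def)
    also have "fder (\<lambda>z. Adj (p z) (P b)) (\<gamma> t) (y - e) = Adj (p (\<gamma> t)) (A t b)"
      using fder_plot_ldiff[OF openin_carrier smooth_Ad pM \<gamma>[OF t] pc[OF t]] left_deriv_Ad[OF pc[OF t]]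
      by (simp add: A_def x_def)
    \<comment> \<open>Since \<open>L\<close> contains \<open>P\<close>, the equation closes up only
      because \<open>A t b\<close> already lies in \<open>W\<close>, where \<open>P\<close> is the
      identity.\<close>
    also have "A t b = P (A t b)" by (rule P(3)[OF AW[OF t], symmetric])
    finally show ?thesis
      unfolding L_def using bounded_linear.has_vector_derivative[of R] R
      by (simp add: linear_conv_bounded_linear)
  qed
  \<comment> \<open>The bound comes from compactness of the parameter interval, continuity of the
    logarithmic derivative and finiteness of the basis.\<close>
  have "\<exists>c. \<forall>t b. 0 \<le> t \<and> t \<le> 1 \<and> b \<in> Basis \<longrightarrow> norm (A t b) \<le> c"
  proof -
    have cx: "continuous_on {0..1} x"
      unfolding x_def
      by (rule continuous_on_compose2[OF smooth_in_continuous[OF smooth_ldiff[OF pM]]])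
        (use \<gamma> in \<open>auto simp: \<gamma>_def[abs_def] intro!: continuous_intros\<close>)
    have "bounded ((\<lambda>t. A t b) ` {0..1})" for b
    proof -
      have "linear (\<lambda>x. br x (P b))" using br by (simp add: bilinear_def)
      then have "continuous_on UNIV (\<lambda>x. br x (P b))"
        by (simp add: linear_continuous_on linear_conv_bounded_linear)
      then have "continuous_on {0..1} (\<lambda>t. A t b)"
        unfolding A_def by (rule continuous_on_compose2[OF _ cx]) auto
      then show ?thesis using compact_continuous_image compact_imp_bounded compact_Icc by blast
    qed
    then have "bounded (\<Union>b\<in>Basis. (\<lambda>t. A t b) ` {0..1})" by (intro bounded_UN) auto
    then show ?thesis unfolding bounded_iff by fastforce
  qed
  then obtain c where c: "\<And>t b. 0 \<le> t \<Longrightarrow> t \<le> 1 \<Longrightarrow> b \<in> Basis \<Longrightarrow> norm (A t b) \<le> c" by blast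
  have L0: "L 0 b = 0" for b using p(2) by (simp add: L_def \<gamma>_def Ad_one R_def P)
  have "L 1 w = 0" by (rule linear_ode_zero[of L A c 1 w, OF lin der c L0]) auto
  then have "Adj (p y) w = P (Adj (p y) w)" by (simp add: L_def \<gamma>_def R_def P(3)[OF w])
  then show ?thesis using P(2) by metis
qed

text \<open>The elements preserving \<open>W\<close> form an open and closed set for the topology of
  \<open>N\<close>: near \<open>g\<close> one multiplies by elements \<open>u\<close> close to the
  unit. Both \<open>u\<close> and its inverse have to preserve \<open>W\<close>, to give the
  equivalence that local constancy asks for.\<close>

lemma Ad_invariant:
  assumes W: "subspace W" and br: "bilinear br" and inv: "\<And>x w. x \<in> h \<Longrightarrow> w \<in> W \<Longrightarrow> br x w \<in> W"
    and conn: "connected_space (mtop N)" and a: "a \<in> H" and w: "w \<in> W"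
  shows "Adj a w \<in> W"
proof -
  obtain r where r: "r > 0" "ball S.base r \<subseteq> S.dom0"
    using S.open_dom0 S_base(1) open_contains_ball by blast
  have p: "plot N (ball S.base r) S.\<sigma>" by (rule plot_subset[OF S.\<sigma>_plot open_ball r(2)])
  have \<sigma>H: "S.\<sigma> y \<in> H" if "y \<in> ball S.base r" for y using S.plot_carrier[OF p that] by simp
  have "plot N (ball S.base r) (\<lambda>y. inv\<^bsub>G\<lparr>carrier := H\<rparr>\<^esub> S.\<sigma> y)" by (rule S.plot_inv[OF p])
  then have p': "plot N (ball S.base r) (\<lambda>y. inv (S.\<sigma> y))"
    by (rule plot_cong) (simp add: \<sigma>H m_inv_consistent[OF subgroup_H])
  define V where "V = {x \<in> fst (chart_at N \<one>). chart_map N \<one> x \<in> ball S.base r}"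
  have one: "\<one> \<in> topspace (mtop N)" using S.one_topspace by simp
  have V: "openin (mtop N) V" "\<one> \<in> V"
    using S.chart_ball[OF one r(1)] by (simp_all add: V_def S.base_def)
  have AdV: "Adj u w \<in> W" "Adj (inv u) w \<in> W" if u: "u \<in> V" and w: "w \<in> W" for u w
  proof -
    have eq: "S.\<sigma> (chart_map N \<one> u) = u"
      using S.mparam_chart(2)[OF one] u by (simp add: V_def S.\<sigma>_def)
    have y: "chart_map N \<one> u \<in> ball S.base r" using u by (simp add: V_def)
    show "Adj u w \<in> W" "Adj (inv u) w \<in> W"
      using Ad_invariant_local[OF W br inv p S_base(2) y w]
        Ad_invariant_local[OF W br inv p' _ y w] eq by (simp_all add: S_base)
  qed
  have top: "topspace (mtop N) = H" using S.topspace_M by simp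
  have loc: "\<exists>V'. openin (mtop N) V' \<and> g \<in> V' \<and> (\<forall>x\<in>V'. (\<forall>w\<in>W. Adj x w \<in> W) \<longleftrightarrow> (\<forall>w\<in>W. Adj g w \<in> W))"
    if "g \<in> topspace (mtop N)" for g
  proof -
    have g: "g \<in> H" "g \<in> carrier G" using that top H_carrier by auto
    have ig: "inv g \<in> H" using subgroup.m_inv_closed[OF subgroup_H g(1)] .
    let ?V = "{x \<in> topspace (mtop N). inv g \<otimes> x \<in> V}"
    have "continuous_map (subtopology (mtop N) H) (mtop N) (\<lambda>x. inv g \<otimes> x)"
      using S.smooth_left_mult[of "inv g"] ig by (simp add: smooth_map_on_def)
    then have "continuous_map (mtop N) (mtop N) (\<lambda>x. inv g \<otimes> x)"
      using top subtopology_topspace by metis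
    then have "openin (mtop N) ?V" using openin_continuous_map_preimage V(1) by blast
    moreover have "g \<in> ?V" using that V(2) g by simp
    moreover have "(\<forall>w\<in>W. Adj x w \<in> W) \<longleftrightarrow> (\<forall>w\<in>W. Adj g w \<in> W)" if x: "x \<in> ?V" for x
    proof -
      have xc: "x \<in> carrier G" "inv g \<otimes> x \<in> V" using x top H_carrier by auto
      have ux: "inv g \<otimes> x \<in> carrier G" using xc g by simp
      have "Adj x w = Adj g (Adj (inv g \<otimes> x) w)" for w
        using xc(1) g(2) by (simp add: Ad_mult[symmetric] m_assoc[symmetric])
      moreover have "Adj g w = Adj x (Adj (inv (inv g \<otimes> x)) w)" for w
        using xc(1) g(2) by (simp add: Ad_mult[symmetric] inv_mult_group m_assoc[symmetric])
      ultimately show ?thesis using AdV[OF xc(2)] by metis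
    qed
    ultimately show ?thesis by (intro exI[of _ ?V]) blast
  qed
  have "\<forall>w\<in>W. Adj a w \<in> W"
    by (rule connected_space_locally_constant[OF conn loc one])
      (use a top in \<open>auto simp: Ad_one\<close>)
  then show ?thesis using w by blast
qed

end

section \<open>Tangent spaces of the homogeneous space\<close>

locale lie_homogeneous = lie_sub G M br \<phi> H N h
  for G :: "'g monoid" (structure) and M :: "('g, 'e::euclidean_space) mfd"
    and br :: "'v::euclidean_space \<Rightarrow> 'v \<Rightarrow> 'v" and \<phi> :: "'v \<Rightarrow> 'e"
    and H :: "'g set" and N :: "('g, 'e) mfd" and h :: "'v set" +
  fixes Q :: "('g set, 'o::euclidean_space) mfd"
  assumes homogeneous: "homogeneous_manifold G M H h Q"
begin

sublocale Q: manifold Q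
  using homogeneous by unfold_locales (simp add: homogeneous_manifold_def)

abbreviation proj :: "'g \<Rightarrow> 'g set" where "proj g \<equiv> g <# H"
abbreviation tclass :: "'g \<Rightarrow> 'v \<Rightarrow> 'o" where "tclass \<equiv> tangent_class G M \<phi> H Q"

lemma H_subset: "H \<subseteq> carrier G"
  using subgroup.subset[OF subgroup_H] .

lemma smooth_proj: "smooth_map_on M Q (carrier G) proj"
  using homogeneous topspace_M by (simp add: homogeneous_manifold_def)

lemma proj_mult: "g \<in> carrier G \<Longrightarrow> k \<in> carrier G \<Longrightarrow> g <# proj k = proj (g \<otimes> k)"
  by (rule lcos_m_assoc[OF H_subset])

lemma proj_absorb: "g \<in> carrier G \<Longrightarrow> a \<in> H \<Longrightarrow> proj (g \<otimes> a) = proj g"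
  by (rule l_repr_independence[symmetric, OF _ _ subgroup_H]) (auto simp: l_coset_def)

lemma tangent_class_plot:
  assumes g: "g \<in> carrier G" and q: "plot M V q" "y \<in> V" "q y = \<one>" and w: "\<phi> w = velocity M q y a"
  shows "tclass g w = velocity Q (\<lambda>y. proj (g \<otimes> q y)) y a"
proof -
  have "velocity Q (\<lambda>y. proj (g \<otimes> q y)) y a = mderiv M Q proj g (velocity M (\<lambda>y. g \<otimes> q y) y a)"
    using velocity_compose[OF Q.manifold_axioms openin_carrier smooth_proj plot_left_mult[OF g q(1)] q(2)] g q(3)
    by simp
  then show ?thesis by (simp add: tangent_class_def velocity_left_mult[OF g q] w)
qed

lemma linear_tangent_class:
  assumes "g \<in> carrier G" shows "linear (tclass g)"
proof -
  have "linear (mderiv M Q proj g)"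
    by (rule linear_mderiv[OF Q.manifold_axioms openin_carrier smooth_proj assms])
  from linear_compose[OF linear_compose[OF linear_\<phi> linear_left_field[OF assms]] this]
  show ?thesis by (simp add: tangent_class_def[abs_def] o_def)
qed

text \<open>A plot inside the coset of \<open>g\<close> projects to a single point, and by
  \<open>h_velocity\<close> every \<open>v\<close> in \<open>h\<close> comes from such a
  plot.\<close>

lemma tangent_class_h:
  assumes g: "g \<in> carrier G" and v: "v \<in> h"
  shows "tclass g v = 0"
proof -
  obtain u where u: "velocity M S.\<sigma> S.base u = \<phi> v" using h_velocity[OF v] .
  have "tclass g v = velocity Q (\<lambda>y. proj (g \<otimes> S.\<sigma> y)) S.base u"
    by (rule tangent_class_plot[OF g plot_incl[OF S.\<sigma>_plot] S_base u[symmetric]])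
  also have "\<dots> = velocity Q (\<lambda>y. proj g) S.base u"
    by (rule fun_cong, rule velocity_cong[OF S.open_dom0 S_base(1)])
      (use g S.\<sigma>_carrier in \<open>simp add: proj_absorb\<close>)
  finally show ?thesis by (simp add: velocity_const)
qed

lemma tangent_class_surj:
  assumes g: "g \<in> carrier G"
  shows "range (tclass g) = model Q"
proof -
  have "(\<lambda>u. left_field G M u g) ` model M = model M"
  proof (intro equalityI subsetI)
    fix u assume "u \<in> (\<lambda>u. left_field G M u g) ` model M"
    then show "u \<in> model M"
      using left_field_\<sigma>[OF g] velocity_in_model[OF plot_left_mult[OF g \<sigma>_plot] base(1)] by auto
  next
    fix u assume u: "u \<in> model M"
    have gt: "g \<in> topspace (mtop M)" using g topspace_M by simp
    let ?m = "mparam M g" and ?e = "chart_map M g g"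
    have r: "plot M (mdom M g) (\<lambda>y. inv g \<otimes> ?m y)"
      using plot_left_mult[OF _ mparam_plot[OF gt]] g by simp
    have r1: "inv g \<otimes> ?m ?e = \<one>" using g mparam_base(2)[OF gt] by simp
    \<comment> \<open>A tangent vector at \<open>g\<close> is a velocity of the parametrisation at
      \<open>g\<close>; translating this plot back to the unit exhibits a preimage.\<close>
    have "u = velocity M ?m ?e u" by (rule velocity_mparam[OF gt u, symmetric])
    also have "\<dots> = velocity M (\<lambda>y. g \<otimes> (inv g \<otimes> ?m y)) ?e u"
      by (rule fun_cong, rule velocity_cong[OF plot_open[OF r] mparam_base(1)[OF gt]])
        (use g plot_carrier[OF mparam_plot[OF gt]] in \<open>simp add: m_assoc[symmetric]\<close>)
    also have "\<dots> = left_field G M (velocity M (\<lambda>y. inv g \<otimes> ?m y) ?e u) g"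
      by (rule velocity_left_mult[OF g r mparam_base(1)[OF gt] r1])
    finally show "u \<in> (\<lambda>u. left_field G M u g) ` model M"
      using velocity_in_model[OF r mparam_base(1)[OF gt]] by blast
  qed
  moreover have "range (tclass g) = mderiv M Q proj g ` (\<lambda>u. left_field G M u g) ` range \<phi>"
    by (simp add: tangent_class_def[abs_def] image_image)
  ultimately have "range (tclass g) = mderiv M Q proj g ` model M"
    by (simp only: range_\<phi>)
  then show ?thesis using homogeneous g by (simp add: homogeneous_manifold_def)
qed

text \<open>Dimension count: the kernel of \<open>tclass g\<close> contains \<open>h\<close>, and
  surjectivity onto \<open>model Q\<close>, whose dimension is that of the group minus that of
  \<open>h\<close>, leaves no room for more.\<close>

lemma tangent_class_eq_0:
  assumes g: "g \<in> carrier G" and h: "subspace h" and v: "tclass g v = 0"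
  shows "v \<in> h"
proof -
  let ?K = "{v. tclass g v = 0}"
  \<comment> \<open>The orthogonal complement of the kernel maps bijectively onto the image and so
    computes the rank.\<close>
  let ?C = "{y \<in> UNIV. \<forall>x\<in>?K. orthogonal x y}"
  have lin: "linear (tclass g)" by (rule linear_tangent_class[OF g])
  have K: "subspace ?K" by (rule linear_subspace_kernel[OF lin])
  have C: "subspace ?C" using subspace_orthogonal_to_vectors[of ?K] by simp
  have dims: "dim ?C + dim ?K = DIM('v)"
    using dim_subspace_orthogonal_to_vectors[OF K subspace_UNIV] by simp
  have inj: "inj_on (tclass g) ?C"
  proof (subst linear_inj_on_iff_eq_0[OF lin C], intro ballI impI)
    fix x assume "x \<in> ?C" "tclass g x = 0"
    then show "x = 0" by (auto simp: orthogonal_def)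
  qed
  have img: "tclass g ` ?C = range (tclass g)"
  proof (intro equalityI subsetI)
    fix z assume "z \<in> range (tclass g)"
    then obtain x where x: "z = tclass g x" by blast
    obtain y c where yc: "y \<in> span ?K" "\<And>w. w \<in> span ?K \<Longrightarrow> orthogonal c w" "x = y + c"
      using orthogonal_subspace_decomp_exists[of ?K x] by metis
    have sp: "span ?K = ?K" using K by (simp only: span_eq_iff)
    have "y \<in> ?K" using yc(1) unfolding sp .
    moreover have "c \<in> ?C" using yc(2) unfolding sp by (simp add: orthogonal_commute)
    ultimately have "z = tclass g c" using x yc(3) linear_add[OF lin] by simp
    then show "z \<in> tclass g ` ?C" using \<open>c \<in> ?C\<close> by blast
  qed auto
  have "span ?C = ?C" using C by (simp only: span_eq_iff)
  then have "dim (tclass g ` ?C) = dim ?C"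
    using dim_image_eq[OF lin, of ?C] inj by (simp only:)
  then have "dim ?C = dim (model Q)" by (simp only: img tangent_class_surj[OF g])
  moreover have "dim (model M) = DIM('v)"
    using dim_image_eq[OF linear_\<phi>, of UNIV] inj_\<phi> range_\<phi> by simp
  ultimately have "dim ?K = dim h"
    using dims homogeneous by (simp add: homogeneous_manifold_def)
  moreover have "h \<subseteq> ?K" using tangent_class_h[OF g] by blast
  ultimately have "h = ?K" using subspace_dim_equal[OF h K] by simp
  then show ?thesis using v by blast
qed

text \<open>Writing \<open>\<sigma> y \<otimes> g\<close> as
  \<open>g \<otimes> (inv g \<otimes> \<sigma> y \<otimes> g)\<close> converts the left action into
  the left translate by \<open>g\<close> of a plot through the unit, whose velocity is given by
  \<open>Adj (inv g) v\<close>.\<close>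

lemma induced_field_tangent_class:
  assumes g: "g \<in> carrier G"
  shows "induced_field G M \<phi> Q v (proj g) = tclass g (Adj (inv g) v)"
proof -
  have sm: "smooth_map_on M Q (carrier G) (\<lambda>a. a <# proj g)"
  proof (rule smooth_map_onI[OF Q.atlasD(1) openin_carrier])
    fix W and p :: "'e \<Rightarrow> 'g" assume p: "plot M W p"
    have "plot Q W (\<lambda>x. proj (p x \<otimes> g))"
      by (rule plot_compose[OF Q.manifold_axioms smooth_proj plot_right_mult[OF g p]])
        (use plot_carrier[OF p] g in auto)
    then show "plot Q W (\<lambda>x. p x <# proj g)"
      by (rule plot_cong) (use g plot_carrier[OF p] in \<open>simp add: proj_mult\<close>)
  qed
  have ig: "inv g \<in> carrier G" using g by simp
  let ?q = "\<lambda>y. inv g \<otimes> \<sigma> y \<otimes> inv (inv g)"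
  have q: "plot M dom0 ?q" "?q base = \<one>"
    using g by (auto intro!: plot_left_mult plot_right_mult \<sigma>_plot simp: base)
  have "induced_field G M \<phi> Q v (proj g) = velocity Q (\<lambda>y. \<sigma> y <# proj g) base (\<phi> v)"
    using velocity_compose[OF Q.manifold_axioms openin_carrier sm \<sigma>_plot base(1), of "\<phi> v"]
    by (simp add: induced_field_def base velocity_\<sigma>)
  also have "\<dots> = velocity Q (\<lambda>y. proj (g \<otimes> ?q y)) base (\<phi> v)"
    by (rule fun_cong, rule velocity_cong[OF open_dom0 base(1)])
      (use g \<sigma>_carrier in \<open>simp add: proj_mult m_assoc[symmetric]\<close>)
  also have "\<dots> = tclass g (Adj (inv g) v)"
    by (rule tangent_class_plot[symmetric, OF g q(1) base(1) q(2)])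
      (use velocity_conj[OF ig \<sigma>_plot base, of "\<phi> v"] in \<open>simp add: velocity_\<sigma> \<psi>(2)\<close>)
  finally show ?thesis .
qed

end

section \<open>The moment map\<close>

text \<open>Commuting with i, the pair \<open>(\<i>, 0)\<close>, kills the second component;
  commuting with j, the pair \<open>(0, 1)\<close>, makes the first one real, and an imaginary
  quaternion has no real part.\<close>

lemma sp1_centre:
  assumes "q \<in> sp1" "\<And>p. p \<in> sp1 \<Longrightarrow> qmult p q = qmult q p"
  shows "q = 0"
proof -
  obtain a b where q: "q = (a, b)" by (cases q)
  have "(\<i>, 0) \<in> sp1" "(0, 1) \<in> sp1" by (simp_all add: sp1_def qconj_def)
  then have "qmult (\<i>, 0) (a, b) = qmult (a, b) (\<i>, 0)" "qmult (0, 1) (a, b) = qmult (a, b) (0, 1)"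
    using assms(2) q by blast+
  moreover have "cnj a = - a" using assms(1) q by (simp add: sp1_def qconj_def)
  ultimately have "b = 0" "a = 0" by (auto simp: qmult_def complex_eq_iff)
  then show ?thesis using q by (simp add: zero_prod_def)
qed

lemma iso_sp1_centre:
  assumes s: "subspace s" and \<beta>: "iso_sp1 br s \<beta>" and \<xi>: "\<xi> \<in> s" and br: "\<And>x. x \<in> s \<Longrightarrow> br x \<xi> = 0"
  shows "\<xi> = 0"
proof -
  have bij: "bij_betw \<beta> s sp1"
    and lin: "\<And>x y a b. x \<in> s \<Longrightarrow> y \<in> s \<Longrightarrow> \<beta> (a *\<^sub>R x + b *\<^sub>R y) = a *\<^sub>R \<beta> x + b *\<^sub>R \<beta> y"
    and hom: "\<And>x y. x \<in> s \<Longrightarrow> y \<in> s \<Longrightarrow> \<beta> (br x y) = qmult (\<beta> x) (\<beta> y) - qmult (\<beta> y) (\<beta> x)"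
    using \<beta> unfolding iso_sp1_def by blast+
  have \<beta>0: "\<beta> 0 = 0" using lin[OF \<xi> \<xi>, of 0 0] by simp
  have "\<beta> \<xi> = 0"
  proof (rule sp1_centre)
    show "\<beta> \<xi> \<in> sp1" using bij \<xi> bij_betwE by blast
    fix p assume "p \<in> sp1"
    then obtain x where x: "x \<in> s" "p = \<beta> x" using bij unfolding bij_betw_def by blast
    show "qmult p (\<beta> \<xi>) = qmult (\<beta> \<xi>) p"
      using hom[OF x(1) \<xi>] br[OF x(1)] x(2) \<beta>0 by simp
  qed
  then show ?thesis using bij \<beta>0 \<xi> subspace_0[OF s] by (metis bij_betw_def inj_onD)
qed

context lie_grp_alg
begin

lemma left_deriv_linear_compose:
  fixes f :: "'g \<Rightarrow> 'f::euclidean_space" and L :: "'f \<Rightarrow> 'k::euclidean_space"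
  assumes L: "linear L" and X: "openin (mtop M) X" and f: "smooth_map_on M eucl X f" and g: "g \<in> X"
  shows "left_deriv G M (\<phi> u) (\<lambda>x. L (f x)) g = L (left_deriv G M (\<phi> u) f g)"
proof -
  have Lf: "smooth_map_on M eucl X (\<lambda>x. L (f x))"
    by (rule smooth_euclI[OF X smooth_in_linear_compose[OF L smooth_plot[OF f]]])
  have gc: "g \<in> carrier G" using X g openin_subset topspace_M by blast
  let ?V = "{y \<in> dom0. g \<otimes> \<sigma> y \<in> X}"
  have V: "plot M ?V (\<lambda>y. g \<otimes> \<sigma> y)"
    by (rule plot_subset[OF plot_left_mult[OF gc \<sigma>_plot] plot_vimage_open[OF plot_left_mult[OF gc \<sigma>_plot] X]]) auto
  have "(\<lambda>y. f (g \<otimes> \<sigma> y)) differentiable (at base)"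
    by (rule smooth_in_differentiable[OF smooth_plot[OF f V]]) (use base gc g in auto)
  then show ?thesis
    unfolding left_deriv_\<sigma>[OF X Lf g \<phi>_in] left_deriv_\<sigma>[OF X f g \<phi>_in]
    by (rule fder_linear_compose[OF L])
qed

lemma left_deriv_cong:
  fixes f f' :: "'g \<Rightarrow> 'f::euclidean_space"
  assumes f: "smooth_map_on M eucl (carrier G) f" and eq: "\<And>x. x \<in> carrier G \<Longrightarrow> f x = f' x"
    and g: "g \<in> carrier G"
  shows "smooth_map_on M eucl (carrier G) f'"
    "left_deriv G M (\<phi> u) f g = left_deriv G M (\<phi> u) f' g"
proof -
  show f': "smooth_map_on M eucl (carrier G) f'"
  proof (rule smooth_euclI[OF openin_carrier])
    fix W and p :: "'e \<Rightarrow> 'g" assume p: "plot M W p" "p ` W \<subseteq> carrier G"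
    show "smooth_in W (\<lambda>x. f' (p x))"
      using smooth_plot[OF f p] smooth_in_cong[OF plot_open[OF p(1)], of "\<lambda>x. f (p x)" "\<lambda>x. f' (p x)"]
        eq plot_carrier[OF p(1)] by simp
  qed
  show "left_deriv G M (\<phi> u) f g = left_deriv G M (\<phi> u) f' g"
    unfolding left_deriv_\<sigma>[OF openin_carrier f g \<phi>_in] left_deriv_\<sigma>[OF openin_carrier f' g \<phi>_in]
    by (rule fun_cong, rule fder_cong[OF open_dom0 base(1)]) (use eq g \<sigma>_carrier in simp)
qed

text \<open>A difference is a linear image of a pair, so both claims reduce to composition with
  linear maps.\<close>

lemma left_deriv_diff:
  fixes f f' :: "'g \<Rightarrow> 'f::euclidean_space"
  assumes f: "smooth_map_on M eucl (carrier G) f" and f': "smooth_map_on M eucl (carrier G) f'"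
    and g: "g \<in> carrier G"
  shows "smooth_map_on M eucl (carrier G) (\<lambda>x. f x - f' x)"
    "left_deriv G M (\<phi> u) (\<lambda>x. f x - f' x) g = left_deriv G M (\<phi> u) f g - left_deriv G M (\<phi> u) f' g"
proof -
  have L: "linear (\<lambda>z::'f \<times> 'f. fst z - snd z)"
    by (intro linear_compose_sub linear_fst linear_snd)
  have ff: "smooth_map_on M eucl (carrier G) (\<lambda>x. (f x, f' x))"
    by (rule smooth_euclI[OF openin_carrier smooth_in_Pair[OF smooth_plot[OF f] smooth_plot[OF f']]])
  have "smooth_map_on M eucl (carrier G) (\<lambda>x. (\<lambda>z. fst z - snd z) (f x, f' x))"
    by (rule smooth_euclI[OF openin_carrier smooth_in_linear_compose[OF L smooth_plot[OF ff]]])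
  then show "smooth_map_on M eucl (carrier G) (\<lambda>x. f x - f' x)" by simp
  have fst: "left_deriv G M (\<phi> u) f g = fst (left_deriv G M (\<phi> u) (\<lambda>x. (f x, f' x)) g)"
    using left_deriv_linear_compose[OF linear_fst openin_carrier ff g] by simp
  have snd: "left_deriv G M (\<phi> u) f' g = snd (left_deriv G M (\<phi> u) (\<lambda>x. (f x, f' x)) g)"
    using left_deriv_linear_compose[OF linear_snd openin_carrier ff g] by simp
  show "left_deriv G M (\<phi> u) (\<lambda>x. f x - f' x) g = left_deriv G M (\<phi> u) f g - left_deriv G M (\<phi> u) f' g"
    unfolding fst snd using left_deriv_linear_compose[OF L openin_carrier ff g] by simp
qed

lemma linear_left_deriv:
  fixes f :: "'g \<Rightarrow> 'f::euclidean_space"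
  assumes X: "openin (mtop M) X" and f: "smooth_map_on M eucl X f" and g: "g \<in> X"
  shows "linear (\<lambda>v. left_deriv G M (\<phi> v) f g)"
proof -
  have gc: "g \<in> carrier G" using X g openin_subset topspace_M by blast
  show ?thesis
    using linear_compose[OF linear_compose[OF linear_\<phi> linear_left_field[OF gc]] linear_mderiv[OF manifold_eucl X f g]]
    by (simp add: left_deriv_def o_def)
qed

end

section \<open>The splitting of a generalized Wolf space\<close>

locale wolf_homogeneous = lie_homogeneous G M br \<phi> H N h Q
  for G :: "'g monoid" (structure) and M :: "('g, 'e::euclidean_space) mfd"
    and br :: "'v::euclidean_space \<Rightarrow> 'v \<Rightarrow> 'v" and \<phi> :: "'v \<Rightarrow> 'e"
    and H :: "'g set" and N :: "('g, 'e) mfd" and h :: "'v set"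
    and Q :: "('g set, 'o::euclidean_space) mfd" +
  fixes h' s m :: "'v set" and lam :: real
  assumes wolf: "generalized_wolf_space br h h' s m"
    and connected_M: "connected_space (mtop M)" and connected_N: "connected_space (mtop N)"
begin

abbreviation sp :: "'v \<Rightarrow> 'v" where "sp \<equiv> s_part h' s m"
abbreviation equi :: "('g set \<Rightarrow> ('g \<times> 'v) set) \<Rightarrow> 'g \<Rightarrow> 'v" where "equi \<equiv> equivariant_map G M \<phi> H s"
abbreviation bclass :: "'g \<Rightarrow> 'v \<Rightarrow> ('g \<times> 'v) set" where "bclass \<equiv> bundle_class G M \<phi> H"

lemma wolfD:
  shows bilinear_br: "bilinear br" and br_self: "br x x = 0"
    and subspaces: "subspace h" "subspace h'" "subspace s" "subspace m"
    and sums: "h \<inter> m = {0}" "UNIV = {x + y |x y. x \<in> h \<and> y \<in> m}"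
      "h' \<inter> s = {0}" "h = {x + y |x y. x \<in> h' \<and> y \<in> s}"
    and br_h_m: "\<And>x y. x \<in> h \<Longrightarrow> y \<in> m \<Longrightarrow> br x y \<in> m"
    and br_h'_s: "\<And>x y. x \<in> h' \<Longrightarrow> y \<in> s \<Longrightarrow> br x y = 0"
    and br_h'_h': "\<And>x y. x \<in> h' \<Longrightarrow> y \<in> h' \<Longrightarrow> br x y \<in> h'"
    and br_s_s: "\<And>x y. x \<in> s \<Longrightarrow> y \<in> s \<Longrightarrow> br x y \<in> s"
    and span_br: "span {br x y |x y. x \<in> m \<and> y \<in> m} = h"
    and sp1: "\<exists>\<beta>. iso_sp1 br s \<beta>"
proof -
  have *: "semisimple br" "lie_subalgebra br h" "direct_sum UNIV h m" "\<forall>x\<in>h. \<forall>y\<in>m. br x y \<in> m"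
    "span {br x y | x y. x \<in> m \<and> y \<in> m} = h" "lie_subalgebra br h'" "lie_subalgebra br s"
    "direct_sum h h' s" "\<forall>x\<in>h'. \<forall>y\<in>s. br x y = 0"
    using wolf unfolding generalized_wolf_space_def by - (elim conjE; assumption)+
  show "bilinear br" "br x x = 0" using *(1) unfolding semisimple_def lie_algebra_def by simp_all
  show "subspace h" "subspace h'" "subspace s" "subspace m"
    using *(2,3,6,7) unfolding lie_subalgebra_def direct_sum_def by simp_all
  show "h \<inter> m = {0}" "UNIV = {x + y |x y. x \<in> h \<and> y \<in> m}"
    using *(3) unfolding direct_sum_def by - (elim conjE; assumption)+
  show "h' \<inter> s = {0}" "h = {x + y |x y. x \<in> h' \<and> y \<in> s}"
    using *(8) unfolding direct_sum_def by - (elim conjE; assumption)+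
  show "br x y \<in> m" if "x \<in> h" "y \<in> m" for x y using *(4) that by simp
  show "br x y = 0" if "x \<in> h'" "y \<in> s" for x y using *(9) that by simp
  show "br x y \<in> h'" if "x \<in> h'" "y \<in> h'" for x y
    using *(6) that unfolding lie_subalgebra_def by simp
  show "br x y \<in> s" if "x \<in> s" "y \<in> s" for x y
    using *(7) that unfolding lie_subalgebra_def by simp
  show "span {br x y | x y. x \<in> m \<and> y \<in> m} = h" by (rule *(5))
  show "\<exists>\<beta>. iso_sp1 br s \<beta>"
    using wolf unfolding generalized_wolf_space_def by - (elim conjE exE, rule exI)
qed

lemma br_add: "br (x + y) z = br x z + br y z" "br z (x + y) = br z x + br z y"
  using bilinear_br by (auto simp: bilinear_ladd bilinear_radd)

lemma br_swap: "br x y = - br y x"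
proof -
  have "br (x + y) (x + y) = br x y + br y x" by (simp only: br_add) (simp add: br_self)
  then show ?thesis by (simp add: br_self eq_neg_iff_add_eq_0)
qed

lemma decomp: obtains x y z where "x \<in> h'" "y \<in> s" "z \<in> m" "\<xi> = x + y + z"
proof -
  obtain u z where "u \<in> h" "z \<in> m" "\<xi> = u + z" using sums(2) by blast
  moreover then obtain x y where "x \<in> h'" "y \<in> s" "u = x + y" using sums(4) by blast
  ultimately show thesis using that by blast
qed

lemma h_sum: "x \<in> h' \<Longrightarrow> y \<in> s \<Longrightarrow> x + y \<in> h"
  using sums(4) by blast

lemma s_subset_h: "y \<in> s \<Longrightarrow> y \<in> h"
  using h_sum[of 0 y] subspace_0[OF subspaces(2)] by simp

lemma decomp_zero:
  assumes "x \<in> h'" "y \<in> s" "z \<in> m" "x + y + z = 0"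
  shows "x = 0" "y = 0" "z = 0"
proof -
  have "x + y = - z" using assms(4) by (simp add: eq_neg_iff_add_eq_0)
  then have "x + y \<in> m" using subspace_neg[OF subspaces(4) assms(3)] by metis
  then have "x + y \<in> h \<inter> m" using h_sum[OF assms(1,2)] by simp
  then have 1: "x + y = 0" using sums(1) by blast
  then have "x = - y" by (simp add: eq_neg_iff_add_eq_0)
  then have "x \<in> s" using subspace_neg[OF subspaces(3) assms(2)] by metis
  then have "x \<in> h' \<inter> s" using assms(1) by simp
  then show "x = 0" using sums(3) by blast
  then show "y = 0" "z = 0" using 1 assms(4) by auto
qed

lemma sp_eq:
  assumes "x \<in> h'" "y \<in> s" "z \<in> m" shows "sp (x + y + z) = y"
  unfolding s_part_def
proof (rule the_equality)
  show "y \<in> s \<and> (\<exists>x'\<in>h'. \<exists>z'\<in>m. x + y + z = x' + y + z')" using assms by blast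
  fix y' assume "y' \<in> s \<and> (\<exists>x'\<in>h'. \<exists>z'\<in>m. x + y + z = x' + y' + z')"
  then obtain x' z' where *: "y' \<in> s" "x' \<in> h'" "z' \<in> m" "x + y + z = x' + y' + z'" by blast
  have "(x - x') + (y - y') + (z - z') = 0" using *(4) by (simp add: algebra_simps)
  then have "y - y' = 0"
    using decomp_zero(2)[of "x - x'" "y - y'" "z - z'"] assms * subspaces by (simp add: subspace_diff)
  then show "y' = y" by simp
qed

lemma sp_in: "sp \<xi> \<in> s"
proof -
  obtain x y z where "x \<in> h'" "y \<in> s" "z \<in> m" "\<xi> = x + y + z" by (rule decomp)
  then show ?thesis by (simp add: sp_eq)
qed

lemma sp_m: "z \<in> m \<Longrightarrow> sp z = 0"
  using sp_eq[of 0 0 z] subspaces by (simp add: subspace_0)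

lemma linear_sp: "linear sp"
proof (rule linearI)
  fix \<xi> \<eta> c
  obtain x y z where 1: "x \<in> h'" "y \<in> s" "z \<in> m" "\<xi> = x + y + z" by (rule decomp)
  obtain x' y' z' where 2: "x' \<in> h'" "y' \<in> s" "z' \<in> m" "\<eta> = x' + y' + z'" by (rule decomp)
  have sps: "sp \<xi> = y" "sp \<eta> = y'" using 1 2 by (simp_all add: sp_eq)
  have "sp ((x + x') + (y + y') + (z + z')) = y + y'"
    using 1 2 subspaces by (intro sp_eq) (auto intro: subspace_add)
  moreover have "\<xi> + \<eta> = (x + x') + (y + y') + (z + z')" using 1 2 by (simp add: algebra_simps)
  ultimately show "sp (\<xi> + \<eta>) = sp \<xi> + sp \<eta>" by (simp only: sps)
  have "sp (c *\<^sub>R x + c *\<^sub>R y + c *\<^sub>R z) = c *\<^sub>R y"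
    using 1 subspaces by (intro sp_eq) (auto intro: subspace_scale)
  moreover have "c *\<^sub>R \<xi> = c *\<^sub>R x + c *\<^sub>R y + c *\<^sub>R z" using 1 by (simp add: algebra_simps)
  ultimately show "sp (c *\<^sub>R \<xi>) = c *\<^sub>R sp \<xi>" by (simp only: sps)
qed

text \<open>As commuting subalgebras with sum \<open>h\<close>, both \<open>h'\<close> and
  \<open>s\<close> are ideals of \<open>h\<close>.\<close>

lemma ad_invariant:
  assumes "x \<in> h"
  shows "w \<in> h' \<Longrightarrow> br x w \<in> h'" "w \<in> s \<Longrightarrow> br x w \<in> s" "w \<in> m \<Longrightarrow> br x w \<in> m"
proof -
  obtain a b where x: "a \<in> h'" "b \<in> s" "x = a + b" using assms sums(4) by blast
  show "br x w \<in> h'" if "w \<in> h'"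
    using x that br_h'_h' br_h'_s[OF that x(2)] br_swap[of b w] by (simp add: br_add)
  show "br x w \<in> s" if "w \<in> s"
    using x that br_s_s br_h'_s[OF x(1) that] by (simp add: br_add)
  show "br x w \<in> m" if "w \<in> m" using assms that by (rule br_h_m)
qed

lemma Ad_H:
  assumes "a \<in> H"
  shows "w \<in> h' \<Longrightarrow> Adj a w \<in> h'" "w \<in> s \<Longrightarrow> Adj a w \<in> s" "w \<in> m \<Longrightarrow> Adj a w \<in> m"
  using Ad_invariant[OF _ bilinear_br _ connected_N assms] subspaces ad_invariant by blast+

text \<open>Each of the three summands is preserved by \<open>Ad_H\<close>, so the projection
  commutes with the action of \<open>H\<close>. This is the source of the equivariance of the moment
  map.\<close>

lemma sp_Ad:
  assumes a: "a \<in> H" shows "sp (Adj a \<xi>) = Adj a (sp \<xi>)"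
proof -
  obtain x y z where 1: "x \<in> h'" "y \<in> s" "z \<in> m" "\<xi> = x + y + z" by (rule decomp)
  have "Adj a \<xi> = Adj a x + Adj a y + Adj a z"
    using 1 linear_add[OF linear_Ad[OF H_carrier[OF a]]] by simp
  then show ?thesis using 1 sp_eq Ad_H[OF a] by simp
qed

section \<open>Sections of the quaternionic bundle\<close>

lemma inv_H: "a \<in> H \<Longrightarrow> inv a \<in> H"
  using subgroup.m_inv_closed[OF subgroup_H] .

lemma Ad_inv_cancel: "a \<in> carrier G \<Longrightarrow> Adj (inv a) (Adj a \<xi>) = \<xi>"
  by (simp add: Ad_mult[symmetric] Ad_one)

text \<open>Only the unit of \<open>H\<close> fixes \<open>g\<close>, so a class contains one pair
  with first component \<open>g\<close>. The description by \<open>THE\<close> in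
  \<open>equivariant_map\<close> thereby makes sense.\<close>

lemma bundle_class_inj:
  assumes g: "g \<in> carrier G" and eq: "bclass g \<xi> = bclass g \<xi>'" shows "\<xi> = \<xi>'"
proof -
  have "(g \<otimes> \<one>, Adj (inv \<one>) \<xi>) \<in> bclass g \<xi>"
    using subgroup.one_closed[OF subgroup_H] unfolding bundle_class_def by blast
  then have "(g, \<xi>) \<in> bclass g \<xi>'" using g eq by (simp add: Ad_one)
  then obtain a where a: "a \<in> H" "g = g \<otimes> a" "\<xi> = Adj (inv a) \<xi>'" unfolding bundle_class_def by blast
  have "a = \<one>" using a(2) g H_carrier[OF a(1)] by (metis l_cancel_one')
  then show ?thesis using a(3) by (simp add: Ad_one)
qed

lemma bundle_class_shift:
  assumes g: "g \<in> carrier G" and a: "a \<in> H"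
  shows "bclass (g \<otimes> a) (Adj (inv a) \<xi>) = bclass g \<xi>"
proof -
  have *: "bclass (g \<otimes> a) (Adj (inv a) \<xi>) \<subseteq> bclass g \<xi>"
    if g: "g \<in> carrier G" and a: "a \<in> H" for g a \<xi>
  proof
    fix z assume "z \<in> bclass (g \<otimes> a) (Adj (inv a) \<xi>)"
    then obtain b where b: "b \<in> H" "z = (g \<otimes> a \<otimes> b, Adj (inv b) (Adj (inv a) \<xi>))"
      unfolding bundle_class_def by blast
    have "z = (g \<otimes> (a \<otimes> b), Adj (inv (a \<otimes> b)) \<xi>)"
      using b g H_carrier[OF a] H_carrier[OF b(1)] by (simp add: m_assoc inv_mult_group Ad_mult)
    then show "z \<in> bclass g \<xi>"
      using subgroup.m_closed[OF subgroup_H a b(1)] unfolding bundle_class_def by blast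
  qed
  have ac: "a \<in> carrier G" using H_carrier[OF a] .
  \<comment> \<open>The reverse inclusion is the same inclusion, taken for the inverse of
    \<open>a\<close>.\<close>
  have "bclass g \<xi> = bclass (g \<otimes> a \<otimes> inv a) (Adj (inv (inv a)) (Adj (inv a) \<xi>))"
    using g ac by (simp add: m_assoc Ad_mult[symmetric] Ad_one)
  also have "\<dots> \<subseteq> bclass (g \<otimes> a) (Adj (inv a) \<xi>)"
    using g ac by (intro * inv_H[OF a]) simp
  finally show ?thesis using *[OF g a] by blast
qed

lemma in_proj: "g \<in> carrier G \<Longrightarrow> k \<in> proj g \<longleftrightarrow> (\<exists>a\<in>H. k = g \<otimes> a)"
  by (auto simp: l_coset_def)

lemma equi_eq:
  assumes "g \<in> carrier G" "\<xi> \<in> s" "\<tau> (proj g) = bclass g \<xi>" shows "equi \<tau> g = \<xi>"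
  unfolding equivariant_map_def
  by (rule the_equality) (use assms bundle_class_inj in auto)

lemma section_equi:
  assumes sec: "quaternionic_section G M \<phi> H s \<tau>" and g: "g \<in> carrier G"
  shows "equi \<tau> g \<in> s" "\<tau> (proj g) = bclass g (equi \<tau> g)"
proof -
  have "proj g \<in> lcosets H" using g by (auto simp: LCOSETS_def)
  then obtain k \<xi> where k: "k \<in> proj g" "\<xi> \<in> s" "\<tau> (proj g) = bclass k \<xi>"
    using sec unfolding quaternionic_section_def by blast
  then obtain a where a: "a \<in> H" "k = g \<otimes> a" using in_proj[OF g] by blast
  have "bclass k \<xi> = bclass g (Adj a \<xi>)"
    using bundle_class_shift[OF g a(1), of "Adj a \<xi>"] a H_carrier[OF a(1)] by (simp add: Ad_inv_cancel)
  then have *: "\<tau> (proj g) = bclass g (Adj a \<xi>)" "Adj a \<xi> \<in> s" using k Ad_H(2)[OF a(1)] by auto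
  then have "equi \<tau> g = Adj a \<xi>" using equi_eq[OF g] by blast
  then show "equi \<tau> g \<in> s" "\<tau> (proj g) = bclass g (equi \<tau> g)" using * by auto
qed

lemma section_equivariant:
  assumes sec: "quaternionic_section G M \<phi> H s \<tau>" and g: "g \<in> carrier G" and a: "a \<in> H"
  shows "equi \<tau> (g \<otimes> a) = Adj (inv a) (equi \<tau> g)"
proof (rule equi_eq)
  show "g \<otimes> a \<in> carrier G" using g H_carrier[OF a] by simp
  show "Adj (inv a) (equi \<tau> g) \<in> s" using Ad_H(2)[OF inv_H[OF a]] section_equi(1)[OF sec g] by blast
  show "\<tau> (proj (g \<otimes> a)) = bclass (g \<otimes> a) (Adj (inv a) (equi \<tau> g))"
    using section_equi(2)[OF sec g] by (simp add: proj_absorb[OF g a] bundle_class_shift[OF g a])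
qed

section \<open>Existence of the moment map\<close>

definition \<mu>0 :: "'v \<Rightarrow> 'g \<Rightarrow> 'v" where
  "\<mu>0 v g = - lam *\<^sub>R sp (Adj (inv g) v)"

lemma linear_lam_sp: "linear (\<lambda>\<xi>. - lam *\<^sub>R sp \<xi>)"
  using linear_compose[OF linear_sp linear_scaleR[of "- lam"]] by (simp only: o_def)

lemma \<mu>0_smooth: "smooth_map_on M eucl (carrier G) (\<mu>0 v)"
  unfolding \<mu>0_def
  by (rule smooth_euclI[OF openin_carrier smooth_in_linear_compose[OF linear_lam_sp smooth_plot[OF smooth_Ad_inv]]])

lemma \<mu>0_in: "\<mu>0 v g \<in> s"
  unfolding \<mu>0_def by (rule subspace_scale[OF subspaces(3) sp_in])

lemma \<mu>0_equivariant:
  assumes g: "g \<in> carrier G" and a: "a \<in> H"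
  shows "\<mu>0 v (g \<otimes> a) = Adj (inv a) (\<mu>0 v g)"
  using g H_carrier[OF a] sp_Ad[OF inv_H[OF a]] linear_cmul[OF linear_Ad[of "inv a"]]
  by (simp add: \<mu>0_def inv_mult_group Ad_mult del: scaleR_minus_left)

text \<open>The vector \<open>Adj (inv g) v\<close> represents the induced field at
  \<open>g\<close>, and the kernel \<open>h\<close> of \<open>tclass g\<close> meets
  \<open>m\<close> trivially; so its \<open>m\<close>-component is the only representative in
  \<open>m\<close>.\<close>

lemma m_coord_induced:
  assumes g: "g \<in> carrier G" and x: "x \<in> h" and z: "z \<in> m" and eq: "Adj (inv g) v = x + z"
  shows "m_coord G M \<phi> H m Q g (induced_field G M \<phi> Q v (proj g)) = z"
  unfolding m_coord_def induced_field_tangent_class[OF g] eq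
proof (rule the_equality)
  have lin: "linear (tclass g)" by (rule linear_tangent_class[OF g])
  show *: "z \<in> m \<and> tclass g z = tclass g (x + z)"
    using z tangent_class_h[OF g x] by (simp add: linear_add[OF lin])
  fix w assume w: "w \<in> m \<and> tclass g w = tclass g (x + z)"
  then have "tclass g (w - z) = 0" using * by (simp add: linear_diff[OF lin])
  then have "w - z \<in> h" by (rule tangent_class_eq_0[OF g subspaces(1)])
  then have "w - z \<in> h \<inter> m" using w z subspace_diff[OF subspaces(4)] by simp
  then show "w = z" using sums(1) by auto
qed

text \<open>Differentiating \<open>Adj (inv g) v = x + z\<close> gives
  \<open>- br w (x + z)\<close>, which is \<open>br x w + br z w\<close>. The first term lies in
  \<open>m\<close> and is killed by \<open>sp\<close>; the second is the bracket in
  \<open>Theta\<close>. The sign from the inverse and the sign from the swap cancel, so the factor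
  in \<open>\<mu>0\<close> is exactly the \<open>- lam\<close> of \<open>Theta\<close>.\<close>

lemma nabla_\<mu>0:
  assumes g: "g \<in> carrier G" and w: "w \<in> m"
  shows "left_deriv G M (\<phi> w) (\<mu>0 v) g =
    Theta br h' s m lam (m_coord G M \<phi> H m Q g (induced_field G M \<phi> Q v (proj g))) w"
proof -
  obtain x z where xz: "x \<in> h" "z \<in> m" "Adj (inv g) v = x + z" using sums(2) by blast
  have "left_deriv G M (\<phi> w) (\<mu>0 v) g = - lam *\<^sub>R sp (left_deriv G M (\<phi> w) (\<lambda>g. Adj (inv g) v) g)"
    unfolding \<mu>0_def by (rule left_deriv_linear_compose[OF linear_lam_sp openin_carrier smooth_Ad_inv g])
  also have "\<dots> = - lam *\<^sub>R sp (br x w + br z w)"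
    using br_swap[of w] by (simp add: left_deriv_Ad_inv[OF g] xz(3) br_add add.commute)
  also have "\<dots> = - lam *\<^sub>R sp (br z w)"
    using br_h_m[OF xz(1) w] by (simp add: linear_add[OF linear_sp] sp_m)
  finally show ?thesis using m_coord_induced[OF g xz] by (simp add: Theta_def)
qed

text \<open>A section is a function of the coset, so a representative is picked; by equivariance of
  \<open>\<mu>0\<close> the resulting class does not depend on it.\<close>

definition \<mu>_section :: "'v \<Rightarrow> 'g set \<Rightarrow> ('g \<times> 'v) set" where
  "\<mu>_section v x = bclass (SOME g. g \<in> x) (\<mu>0 v (SOME g. g \<in> x))"

lemma \<mu>_section_proj:
  assumes g: "g \<in> carrier G" shows "\<mu>_section v (proj g) = bclass g (\<mu>0 v g)"
proof -
  have "g \<in> proj g" by (rule lcos_self[OF g subgroup_H])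
  then have "(SOME k. k \<in> proj g) \<in> proj g" by (rule someI)
  then obtain a where a: "a \<in> H" "(SOME k. k \<in> proj g) = g \<otimes> a" using in_proj[OF g] by blast
  show ?thesis
    unfolding \<mu>_section_def a(2) by (simp add: \<mu>0_equivariant[OF g a(1)] bundle_class_shift[OF g a(1)])
qed

lemma equi_\<mu>_section: "g \<in> carrier G \<Longrightarrow> equi (\<mu>_section v) g = \<mu>0 v g"
  by (rule equi_eq) (simp_all add: \<mu>0_in \<mu>_section_proj)

lemma moment_map_exists: "quaternionic_moment_map G M br \<phi> H h' s m Q lam t \<mu>_section"
  unfolding quaternionic_moment_map_def
proof (intro conjI ballI allI)
  have eq: "\<mu>0 v g = equi (\<mu>_section v) g" if "g \<in> carrier G" for v g
    using equi_\<mu>_section[OF that] by simp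
  fix v
  show "quaternionic_section G M \<phi> H s (\<mu>_section v)"
    unfolding quaternionic_section_def
  proof (intro conjI ballI)
    show "smooth_map M eucl (equi (\<mu>_section v))"
      using left_deriv_cong(1)[OF \<mu>0_smooth eq one_closed] by (simp add: topspace_M)
    fix x assume "x \<in> lcosets H"
    then obtain g where g: "g \<in> carrier G" "x = proj g" by (auto simp: LCOSETS_def)
    then show "\<exists>g\<in>x. \<exists>\<xi>\<in>s. \<mu>_section v x = bclass g \<xi>"
      using lcos_self[OF g(1) subgroup_H] \<mu>_section_proj \<mu>0_in by blast
  qed
  fix g assume g: "g \<in> carrier G"
  show "equi (\<mu>_section (a *\<^sub>R v + b *\<^sub>R w)) g =
      a *\<^sub>R equi (\<mu>_section v) g + b *\<^sub>R equi (\<mu>_section w) g" for w a b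
  proof -
    have lin: "linear (\<lambda>v. \<mu>0 v g)"
      using linear_compose[OF linear_Ad linear_lam_sp, of "inv g"] g by (simp add: \<mu>0_def o_def)
    show ?thesis using g by (simp add: equi_\<mu>_section linear_add[OF lin] linear_cmul[OF lin])
  qed
  fix w assume w: "w \<in> m"
  show "nabla G M \<phi> (equi (\<mu>_section v)) g w =
      Theta br h' s m lam (m_coord G M \<phi> H m Q g (induced_field G M \<phi> Q v (proj g))) w"
    using nabla_\<mu>0[OF g w, of v]
      left_deriv_cong(2)[of "\<mu>0 v" "equi (\<mu>_section v)", OF \<mu>0_smooth eq g]
    by (simp add: nabla_def)
qed

text \<open>A function annihilated by the horizontal fields is annihilated by their brackets, hence by all
  left-invariant fields, because \<open>[m, m] = h\<close>.\<close>

lemma horizontal_constant: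
  fixes d :: "'g \<Rightarrow> 'f::euclidean_space"
  assumes d: "smooth_map_on M eucl (carrier G) d"
    and hor: "\<And>g w. g \<in> carrier G \<Longrightarrow> w \<in> m \<Longrightarrow> left_deriv G M (\<phi> w) d g = 0"
    and g: "g \<in> carrier G"
  shows "d g = d \<one>"
proof -
  have hd: "left_deriv G M (\<phi> u) d g \<bullet> b = 0" if g: "g \<in> carrier G" for u g b
  proof -
    \<comment> \<open>Components are taken because the bracket relation speaks of real-valued
      functions.\<close>
    let ?f = "\<lambda>x. d x \<bullet> b"
    have lb: "linear (\<lambda>y::'f. y \<bullet> b)" by (simp add: linear_iff inner_add_left)
    have f: "smooth_map_on M eucl (carrier G) ?f"
      by (rule smooth_euclI[OF openin_carrier smooth_in_linear_compose[OF lb smooth_plot[OF d]]])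
    have fd: "left_deriv G M (\<phi> u) ?f k = left_deriv G M (\<phi> u) d k \<bullet> b" if "k \<in> carrier G" for u k
      by (rule left_deriv_linear_compose[OF lb openin_carrier d that])
    \<comment> \<open>Each of the two terms of the commutator differentiates a function that
      vanishes identically.\<close>
    have zero: "left_deriv G M (\<phi> a) (left_deriv G M (\<phi> w) ?f) g = 0" if w: "w \<in> m" for a w
    proof -
      have "left_deriv G M (\<phi> a) (left_deriv G M (\<phi> w) ?f) g =
          fder (\<lambda>y. left_deriv G M (\<phi> w) ?f (g \<otimes> \<sigma> y)) base (\<phi> a)"
        by (rule left_deriv_\<sigma>[OF openin_carrier smooth_left_deriv[OF openin_carrier f \<phi>_in] g \<phi>_in])
      also have "\<dots> = fder (\<lambda>y. 0) base (\<phi> a)"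
        by (rule fun_cong, rule fder_cong[OF open_dom0 base(1)])
          (use g \<sigma>_carrier in \<open>simp add: fd hor[OF _ w]\<close>)
      finally show ?thesis by simp
    qed
    let ?K = "{u. left_deriv G M (\<phi> u) ?f g = 0}"
    have lin: "linear (\<lambda>u. left_deriv G M (\<phi> u) ?f g)" by (rule linear_left_deriv[OF openin_carrier f g])
    have K: "subspace ?K" by (rule linear_subspace_kernel[OF lin])
    have "{br x y |x y. x \<in> m \<and> y \<in> m} \<subseteq> ?K"
      using bracket[OF openin_carrier f g] zero by auto
    then have "h \<subseteq> ?K" using span_minimal[OF _ K] span_br by blast
    moreover have "m \<subseteq> ?K" using fd[OF g] hor[OF g] by auto
    moreover obtain x z where "x \<in> h" "z \<in> m" "u = x + z" using sums(2) by blast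
    ultimately have "u \<in> ?K" using subspace_add[OF K] by blast
    then show ?thesis using fd[OF g] by simp
  qed
  have left0: "left_deriv G M (\<phi> u) d k = 0" if "k \<in> carrier G" for u k
    using hd[OF that] by (metis inner_eq_zero_iff)
  have loc: "\<exists>V. openin (mtop M) V \<and> q \<in> V \<and> (\<forall>x\<in>V. d x = d \<one> \<longleftrightarrow> d q = d \<one>)"
    if q: "q \<in> topspace (mtop M)" for q
  proof -
    let ?e = "chart_map M q q"
    obtain r where r: "r > 0" "ball ?e r \<subseteq> mdom M q"
      using plot_open[OF mparam_plot[OF q]] mparam_base(1)[OF q] open_contains_ball by blast
    have p: "plot M (ball ?e r) (mparam M q)" by (rule plot_subset[OF mparam_plot[OF q] open_ball r(2)])
    let ?V = "{x \<in> fst (chart_at M q). chart_map M q x \<in> ball ?e r}"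
    have *: "d x = d q" if x: "x \<in> ?V" for x
    proof -
      \<comment> \<open>All directions are covered now, so the coordinate expression of
        \<open>d\<close> has zero derivative on a convex set.\<close>
      have "d (mparam M q (chart_map M q x)) = d (mparam M q ?e)"
      proof (rule has_derivative_zero_unique[where s = "ball ?e r" and f = "\<lambda>y. d (mparam M q y)"])
        fix y assume y: "y \<in> ball ?e r"
        have sm: "smooth_in (ball ?e r) (\<lambda>y. d (mparam M q y))"
          by (rule smooth_plot[OF d p]) (use plot_carrier[OF p] in auto)
        have "fder (\<lambda>y. d (mparam M q y)) y = (\<lambda>h. 0)"
          using fder_plot_ldiff[OF openin_carrier d p y plot_carrier[OF p y]] left0[OF plot_carrier[OF p y]]
          by auto
        then show "((\<lambda>y. d (mparam M q y)) has_derivative (\<lambda>h. 0)) (at y within ball ?e r)"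
          using smooth_in_has_derivative[OF sm y] has_derivative_at_withinI by metis
      qed (use x r in auto)
      then show ?thesis using mparam_chart(2)[OF q] mparam_base(2)[OF q] x by simp
    qed
    show ?thesis
    proof (intro exI conjI ballI)
      show "openin (mtop M) ?V" "q \<in> ?V" by (rule chart_ball[OF q r(1)])+
      show "d x = d \<one> \<longleftrightarrow> d q = d \<one>" if "x \<in> ?V" for x by (simp only: *[OF that])
    qed
  qed
  show ?thesis
    by (rule connected_space_locally_constant[OF connected_M loc one_topspace]) (use g topspace_M in auto)
qed

section \<open>Uniqueness of the moment map\<close>

lemma moment_map_unique:
  assumes \<mu>: "quaternionic_moment_map G M br \<phi> H h' s m Q lam t \<mu>" and v: "v \<in> t" and g: "g \<in> carrier G"
  shows "equi (\<mu> v) g = \<mu>0 v g"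
proof -
  have sec: "quaternionic_section G M \<phi> H s (\<mu> v)"
    using \<mu> v unfolding quaternionic_moment_map_def by blast
  have smooth: "smooth_map_on M eucl (carrier G) (equi (\<mu> v))"
    using sec by (simp add: quaternionic_section_def topspace_M)
  let ?d = "\<lambda>x. equi (\<mu> v) x - \<mu>0 v x"
  have hor: "left_deriv G M (\<phi> w) ?d k = 0" if k: "k \<in> carrier G" and w: "w \<in> m" for k w
  proof -
    have "nabla G M \<phi> (equi (\<mu> v)) k w =
        Theta br h' s m lam (m_coord G M \<phi> H m Q k (induced_field G M \<phi> Q v (proj k))) w"
      using \<mu> v k w unfolding quaternionic_moment_map_def by blast
    then show ?thesis
      unfolding left_deriv_diff(2)[OF smooth \<mu>0_smooth k] nabla_\<mu>0[OF k w] nabla_def by simp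
  qed
  have const: "?d k = ?d \<one>" if "k \<in> carrier G" for k
    by (rule horizontal_constant[OF left_deriv_diff(1)[OF smooth \<mu>0_smooth one_closed] _ that])
      (rule hor)
  define \<xi> where "\<xi> = ?d \<one>"
  have \<xi>: "\<xi> \<in> s"
    unfolding \<xi>_def using section_equi(1)[OF sec one_closed] \<mu>0_in subspace_diff[OF subspaces(3)] by blast
  have fixed: "Adj a \<xi> = \<xi>" if a: "a \<in> H" for a
  proof -
    have ac: "a \<in> carrier G" using H_carrier[OF a] .
    \<comment> \<open>Equivariance acts through inverses, so moving by \<open>inv a\<close> applies
      \<open>Ad\<close> of \<open>a\<close>.\<close>
    have "?d (\<one> \<otimes> inv a) = Adj a \<xi>"
      using section_equivariant[OF sec one_closed inv_H[OF a]] \<mu>0_equivariant[OF one_closed inv_H[OF a]]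
        linear_diff[OF linear_Ad[OF ac]] ac by (simp add: \<xi>_def)
    then show ?thesis using const[of "\<one> \<otimes> inv a"] ac by (simp add: \<xi>_def)
  qed
  have "br x \<xi> = 0" if x: "x \<in> s" for x
  proof -
    obtain u where u: "velocity M S.\<sigma> S.base u = \<phi> x" using h_velocity[OF s_subset_h[OF x]] .
    \<comment> \<open>The bracket is the derivative of \<open>Ad\<close> at the unit and may be
      computed along a plot inside \<open>H\<close>, where \<open>fixed\<close> makes the function
      constant.\<close>
    have "br x \<xi> = left_deriv G M (\<phi> x) (\<lambda>g. Adj g \<xi>) \<one>"
      by (simp add: left_deriv_Ad Ad_one)
    also have "\<dots> = fder (\<lambda>y. Adj (\<one> \<otimes> S.\<sigma> y) \<xi>) S.base u"
      using left_deriv_plot[OF openin_carrier smooth_Ad one_closed plot_incl[OF S.\<sigma>_plot] S_base, of \<xi> u] u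
      by simp
    also have "\<dots> = fder (\<lambda>y. \<xi>) S.base u"
      by (rule fun_cong, rule fder_cong[OF S.open_dom0 S_base(1)])
        (use S.\<sigma>_carrier H_carrier in \<open>simp add: fixed\<close>)
    finally show ?thesis by simp
  qed
  then have "\<xi> = 0" using iso_sp1_centre[OF subspaces(3) _ \<xi>] sp1 by blast
  then show ?thesis using const[OF g] by (simp add: \<xi>_def)
qed

end

theorem mainTheorem1:
  fixes br :: "'v::euclidean_space \<Rightarrow> 'v \<Rightarrow> 'v"
    and h h' s m t :: "'v set"
    and G :: "'g monoid"
    and M :: "('g, 'e::euclidean_space) mfd"
    and \<phi> :: "'v \<Rightarrow> 'e"
    and H H' S T :: "'g set"
    and Q :: "('g set, 'o::euclidean_space) mfd"
    and lam :: real
  assumes wolf: "generalized_wolf_space br h h' s m"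
    and G: "lie_group G M" "connected_space (mtop M)" "simply_connected_space (mtop M)"
    and lie_G: "has_lie_algebra G M br \<phi>"
    and H': "connected_lie_subgroup G M \<phi> H' h'"
    and S: "connected_lie_subgroup G M \<phi> S s"
    and H: "connected_lie_subgroup G M \<phi> H h" "H = H' <#>\<^bsub>G\<^esub> S"
    and Q: "homogeneous_manifold G M H h Q"
    and lam: "lam > 0"
    and T: "virtual_lie_subgroup G M \<phi> T t"
  shows "\<exists>c::real. c \<noteq> 0 \<and>
    (\<exists>\<mu>. quaternionic_moment_map G M br \<phi> H h' s m Q lam t \<mu>) \<and>
    (\<forall>\<mu>. quaternionic_moment_map G M br \<phi> H h' s m Q lam t \<mu> \<longrightarrow>
      (\<forall>g\<in>carrier G. \<forall>v\<in>t.
        equivariant_map G M \<phi> H s (\<mu> v) g = c *\<^sub>R s_part h' s m (Ad G M \<phi> (inv\<^bsub>G\<^esub> g) v)))"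
proof -
  obtain N where N: "immersed_lie_subgroup G M \<phi> H N h" "connected_space (mtop N)"
    using H(1) unfolding connected_lie_subgroup_def by blast
  interpret group G using G(1) by (simp add: lie_group_def)
  interpret wolf_homogeneous G M br \<phi> H N h Q h' s m lam
    by unfold_locales (use wolf G lie_G N Q in simp_all)
  show ?thesis
  \<comment> \<open>The scalar is the factor of \<open>\<mu>0\<close>, dictated by the normalisation
    of \<open>Theta\<close>; a moment map is exhibited as well, so that the formula is not
    vacuous.\<close>
  proof (intro exI[of _ "- lam"] conjI allI impI ballI)
    show "- lam \<noteq> 0" using lam by simp
    show "\<exists>\<mu>. quaternionic_moment_map G M br \<phi> H h' s m Q lam t \<mu>"
      using moment_map_exists by blast
    fix \<mu> g v
    assume "quaternionic_moment_map G M br \<phi> H h' s m Q lam t \<mu>" "g \<in> carrier G" "v \<in> t"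
    then show "equivariant_map G M \<phi> H s (\<mu> v) g =
        - lam *\<^sub>R s_part h' s m (Ad G M \<phi> (inv\<^bsub>G\<^esub> g) v)"
      using moment_map_unique unfolding \<mu>0_def by blast
  qed
qed

end
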